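(* There exists a relational structure $\mathbb S$ such that: (1) $\mathbb S$ is $\omega$-categorical and has less than double exponential orbit growth; (2) $\operatorname{Pol}(\mathbb S)$ has a minion homomorphism to $\mathscr P$; (3) $\operatorname{Pol}(\mathbb S)$ has no uniformly continuous minion homomorphism to $\mathscr P$.
   Context: $\operatorname{Pol}(\mathbb A)$ is the clone of polymorphisms of $\mathbb A$ (homomorphisms $\mathbb A^n\to\mathbb A$, $n\ge1$, with componentwise relations on $\mathbb A^n$). $\mathscr P$ is the clone on $\{0,1\}$ consisting only of projections. A minion homomorphism $\xi:\mathscr A\to\mathscr B$ between clones is an arity-preserving map with $\xi(f(x_{\pi(1)},\dots,x_{\pi(n)}))=\xi(f)(x_{\pi(1)},\dots,x_{\pi(n)})$ for all $n$-ary $f\in\mathscr A$ and all $\pi:\{1,\dots,n\}\to\{1,\dots,k\}$. A map $\xi:\mathscr A\to\mathscr B$ (with $\mathscr A$ on domain $A$) is uniformly continuous if for every $n\ge1$ there is a finite $S\subseteq A^n$ such that for all $n$-ary $f,g\in\mathscr A$, $f|_S=g|_S$ implies $\xi(f)=\xi(g)$. For $k\ge1$ let $f_k$ be the number of orbits of the natural action of $\operatorname{Aut}(\mathbb S)$ on $S^k$; $\mathbb S$ is $\omega$-categorical if all $f_k$ are finite (for countable $\mathbb S$), and has less than double exponential orbit growth if $\lim_{k\to\infty} f_k/2^{2^k}=0$. *)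

theory Defs
  imports Complex_Main "HOL-Library.Countable_Set" "HOL-Library.NList" "HOL-Algebra.Group_Action"
begin

text \<open>Tuples are lists: \<open>nlists n A\<close> is the set of \<open>n\<close>-tuples over \<open>A\<close>, indexed from \<open>0\<close>.\<close>

section \<open>Relational structures\<close>

record ('a, 'r) rel_structure = "'a partial_object" +
  symbols :: "'r set"
  arity :: "'r \<Rightarrow> nat"
  interp :: "'r \<Rightarrow> 'a list set"

definition relational_structure :: "('a, 'r) rel_structure \<Rightarrow> bool" where
  "relational_structure S \<longleftrightarrow>
     carrier S \<noteq> {} \<and> (\<forall>R \<in> symbols S. interp S R \<subseteq> nlists (arity S R) (carrier S))"

definition structure_hom :: "('a, 'r) rel_structure \<Rightarrow> ('b, 'r) rel_structure \<Rightarrow> ('a \<Rightarrow> 'b) set" where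
  "structure_hom S T =
     {h \<in> carrier S \<rightarrow>\<^sub>E carrier T. \<forall>R \<in> symbols S. \<forall>xs \<in> interp S R. map h xs \<in> interp T R}"

definition power_structure :: "('a, 'r) rel_structure \<Rightarrow> nat \<Rightarrow> ('a list, 'r) rel_structure" where
  "power_structure S n =
     \<lparr> carrier = nlists n (carrier S),
       symbols = symbols S,
       arity = arity S,
       interp = (\<lambda>R. {xs \<in> nlists (arity S R) (nlists n (carrier S)).
                        \<forall>i<n. map (\<lambda>x. x ! i) xs \<in> interp S R}) \<rparr>"


section \<open>Automorphisms and orbit growth\<close>

definition structure_aut :: "('a, 'r) rel_structure \<Rightarrow> ('a \<Rightarrow> 'a) set" where
  "structure_aut S =
     {g \<in> Bij (carrier S). \<forall>R \<in> symbols S. \<forall>xs \<in> nlists (arity S R) (carrier S).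
        map g xs \<in> interp S R \<longleftrightarrow> xs \<in> interp S R}"

definition Aut :: "('a, 'r) rel_structure \<Rightarrow> ('a \<Rightarrow> 'a) monoid" where
  "Aut S = BijGroup (carrier S) \<lparr>carrier := structure_aut S\<rparr>"

definition tuple_action :: "'a set \<Rightarrow> nat \<Rightarrow> ('a \<Rightarrow> 'a) \<Rightarrow> 'a list \<Rightarrow> 'a list" where
  "tuple_action A k g = (\<lambda>x \<in> nlists k A. map g x)"

definition tuple_orbits :: "('a, 'r) rel_structure \<Rightarrow> nat \<Rightarrow> 'a list set set" where
  "tuple_orbits S k = orbits (Aut S) (nlists k (carrier S)) (tuple_action (carrier S) k)"

definition omega_categorical :: "('a, 'r) rel_structure \<Rightarrow> bool" where
  "omega_categorical S \<longleftrightarrow> countable (carrier S) \<and> (\<forall>k\<ge>1. finite (tuple_orbits S k))"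

text \<open>As \<open>card\<close> of an infinite set is \<open>0\<close>, the following is only meaningful for
  structures all of whose orbit counts are finite.\<close>

definition less_than_double_exponential_orbit_growth :: "('a, 'r) rel_structure \<Rightarrow> bool" where
  "less_than_double_exponential_orbit_growth S \<longleftrightarrow>
     (\<lambda>k. real (card (tuple_orbits S k)) / 2 ^ (2 ^ k)) \<longlonglongrightarrow> 0"


section \<open>Clones and minion homomorphisms\<close>

text \<open>\<open>ops C n\<close> is the set of \<open>n\<close>-ary members of \<open>C\<close>; only \<open>n \<ge> 1\<close> matters.
  Members are extensional on \<open>nlists n (carrier C)\<close>. Since operations of different arities may
  coincide as such HOL functions (both being constantly \<open>undefined\<close>), the arity is kept as an
  explicit index, also for maps between clones.\<close>

record 'a op_clone = "'a partial_object" +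
  ops :: "nat \<Rightarrow> ('a list \<Rightarrow> 'a) set"

definition Pol :: "('a, 'r) rel_structure \<Rightarrow> 'a op_clone" where
  "Pol S = \<lparr> carrier = carrier S, ops = (\<lambda>n. structure_hom (power_structure S n) S) \<rparr>"

definition projection_clone :: "nat op_clone" where
  "projection_clone =
     \<lparr> carrier = {0, 1}, ops = (\<lambda>n. {(\<lambda>x \<in> nlists n {0, 1}. x ! i) | i. i < n}) \<rparr>"

text \<open>The \<open>k\<close>-ary operation \<open>f(x\<^bsub>\<pi>(0)\<^esub>, \<dots>, x\<^bsub>\<pi>(n-1)\<^esub>)\<close> obtained from an \<open>n\<close>-ary \<open>f\<close>.\<close>

definition minor :: "'a set \<Rightarrow> nat \<Rightarrow> nat \<Rightarrow> (nat \<Rightarrow> nat) \<Rightarrow> ('a list \<Rightarrow> 'a) \<Rightarrow> 'a list \<Rightarrow> 'a" where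
  "minor A n k \<pi> f = (\<lambda>x \<in> nlists k A. f (map (\<lambda>i. x ! \<pi> i) [0..<n]))"

definition minion_hom ::
  "'a op_clone \<Rightarrow> 'b op_clone \<Rightarrow> (nat \<Rightarrow> ('a list \<Rightarrow> 'a) \<Rightarrow> ('b list \<Rightarrow> 'b)) \<Rightarrow> bool" where
  "minion_hom C D \<xi> \<longleftrightarrow>
     (\<forall>n\<ge>1. \<forall>f \<in> ops C n. \<xi> n f \<in> ops D n) \<and>
     (\<forall>n\<ge>1. \<forall>k\<ge>1. \<forall>f \<in> ops C n. \<forall>\<pi> \<in> {..<n} \<rightarrow> {..<k}.
        \<xi> k (minor (carrier C) n k \<pi> f) = minor (carrier D) n k \<pi> (\<xi> n f))"

definition uniformly_continuous_clone_map ::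
  "'a op_clone \<Rightarrow> (nat \<Rightarrow> ('a list \<Rightarrow> 'a) \<Rightarrow> ('b list \<Rightarrow> 'b)) \<Rightarrow> bool" where
  "uniformly_continuous_clone_map C \<xi> \<longleftrightarrow>
     (\<forall>n\<ge>1. \<exists>F. finite F \<and> F \<subseteq> nlists n (carrier C) \<and>
        (\<forall>f \<in> ops C n. \<forall>g \<in> ops C n. (\<forall>x \<in> F. f x = g x) \<longrightarrow> \<xi> n f = \<xi> n g))"


section \<open>Well-formedness of the notions\<close>

text \<open>These two would loop together with \<open>in_nlists_iff\<close>.\<close>

declare nlistsE_length [simp del] nlistsE_set [simp del]

lemma in_nlists_iff: "x \<in> nlists k A \<longleftrightarrow> length x = k \<and> (\<forall>y \<in> set x. y \<in> A)"
  by (auto simp: nlists_def)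

lemma map_in_nlists: "x \<in> nlists k A \<Longrightarrow> g \<in> A \<rightarrow> B \<Longrightarrow> map g x \<in> nlists k B"
  by (simp add: in_nlists_iff Pi_iff)

lemma Bij_inv_map:
  assumes "g \<in> Bij A" "x \<in> nlists k A"
  shows "map g (map (restrict (inv_into A g) A) x) = x"
    and "map (restrict (inv_into A g) A) x \<in> nlists k A"
proof -
  have b: "bij_betw g A A" using assms by (simp add: Bij_def)
  have "g (restrict (inv_into A g) A y) = y" if "y \<in> set x" for y
    using that assms(2) b by (simp add: in_nlists_iff bij_betw_inv_into_right)
  then show "map g (map (restrict (inv_into A g) A) x) = x"
    unfolding map_map by (intro map_idI) simp
  show "map (restrict (inv_into A g) A) x \<in> nlists k A"
    by (rule map_in_nlists[OF assms(2)]) (simp add: Bij_inv_into_mem[OF assms(1)])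
qed

lemma structure_aut_subgroup: "subgroup (structure_aut S) (BijGroup (carrier S))"
proof (rule subgroup.intro)
  show "structure_aut S \<subseteq> carrier (BijGroup (carrier S))"
    by (auto simp: structure_aut_def BijGroup_def)
next
  fix g h assume gh: "g \<in> structure_aut S" "h \<in> structure_aut S"
  then have B: "g \<in> Bij (carrier S)" "h \<in> Bij (carrier S)" by (auto simp: structure_aut_def)
  have c: "map (compose (carrier S) g h) xs = map g (map h xs)" "map h xs \<in> nlists n (carrier S)"
    if "xs \<in> nlists n (carrier S)" for xs n
    using that Bij_imp_funcset[OF B(2)] by (simp_all add: in_nlists_iff compose_eq Pi_iff)
  show "g \<otimes>\<^bsub>BijGroup (carrier S)\<^esub> h \<in> structure_aut S"
    using gh B by (simp add: structure_aut_def BijGroup_def compose_Bij c del: map_map)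
next
  have "map (\<lambda>x\<in>carrier S. x) xs = xs" if "xs \<in> nlists n (carrier S)" for xs n
    using that by (intro map_idI) (simp add: in_nlists_iff)
  then show "\<one>\<^bsub>BijGroup (carrier S)\<^esub> \<in> structure_aut S"
    by (simp add: structure_aut_def BijGroup_def id_Bij)
next
  fix g assume g: "g \<in> structure_aut S"
  then have B: "g \<in> Bij (carrier S)" by (auto simp: structure_aut_def)
  show "inv\<^bsub>BijGroup (carrier S)\<^esub> g \<in> structure_aut S"
    unfolding structure_aut_def inv_BijGroup[OF B]
  proof (intro CollectI conjI ballI)
    fix R xs assume R: "R \<in> symbols S" "xs \<in> nlists (arity S R) (carrier S)"
    let ?ys = "map (\<lambda>x\<in>carrier S. inv_into (carrier S) g x) xs"
    have "map g ?ys \<in> interp S R \<longleftrightarrow> ?ys \<in> interp S R"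
      using g R(1) Bij_inv_map(2)[OF B R(2)] unfolding structure_aut_def by blast
    then show "?ys \<in> interp S R \<longleftrightarrow> xs \<in> interp S R"
      by (simp only: Bij_inv_map(1)[OF B R(2)])
  qed (rule restrict_inv_into_Bij[OF B])
qed

lemma group_Aut: "group (Aut S)"
  unfolding Aut_def by (rule subgroup.subgroup_is_group[OF structure_aut_subgroup group_BijGroup])

lemma tuple_action_Bij:
  assumes "g \<in> Bij A"
  shows "tuple_action A k g \<in> Bij (nlists k A)"
proof -
  have b: "bij_betw g A A" using assms by (simp add: Bij_def)
  have "inj_on (map g) (nlists k A)"
  proof (rule inj_onI)
    fix x y assume xy: "x \<in> nlists k A" "y \<in> nlists k A" "map g x = map g y"
    have "set x \<union> set y \<subseteq> A" using xy(1,2) unfolding in_nlists_iff by blast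
    then have "inj_on g (set x \<union> set y)"
      by (rule inj_on_subset[OF bij_betw_imp_inj_on[OF b]])
    then show "x = y" using xy(3) by (simp only: inj_on_map_eq_map)
  qed
  moreover have "map g ` nlists k A = nlists k A"
  proof
    show "map g ` nlists k A \<subseteq> nlists k A"
      by (rule image_subsetI) (rule map_in_nlists[OF _ Bij_imp_funcset[OF assms]])
    show "nlists k A \<subseteq> map g ` nlists k A"
    proof
      fix x assume x: "x \<in> nlists k A"
      show "x \<in> map g ` nlists k A"
        by (rule image_eqI[where f = "map g", OF Bij_inv_map(1)[OF assms x, symmetric] Bij_inv_map(2)[OF assms x]])
    qed
  qed
  ultimately show ?thesis
    by (simp add: Bij_def tuple_action_def bij_betw_def)
qed

lemma group_action_tuples: "group_action (Aut S) (nlists k (carrier S)) (tuple_action (carrier S) k)"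
proof (intro group_action.intro group_hom.intro group_hom_axioms.intro group_Aut group_BijGroup homI)
  let ?A = "carrier S" and ?N = "nlists k (carrier S)"
  have B: "g \<in> Bij ?A" if "g \<in> carrier (Aut S)" for g
    using that by (simp add: Aut_def structure_aut_def)
  show "tuple_action ?A k g \<in> carrier (BijGroup ?N)" if "g \<in> carrier (Aut S)" for g
    using tuple_action_Bij[OF B[OF that]] by (simp add: BijGroup_def)
  show "tuple_action ?A k (g \<otimes>\<^bsub>Aut S\<^esub> h) =
      tuple_action ?A k g \<otimes>\<^bsub>BijGroup ?N\<^esub> tuple_action ?A k h"
    if "g \<in> carrier (Aut S)" "h \<in> carrier (Aut S)" for g h
  proof -
    have h: "map h x \<in> ?N" if "x \<in> ?N" for x
      using map_in_nlists[OF that Bij_imp_funcset[OF B]] \<open>h \<in> carrier (Aut S)\<close> by blast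
    have "tuple_action ?A k (compose ?A g h) = compose ?N (tuple_action ?A k g) (tuple_action ?A k h)"
    proof
      fix x
      show "tuple_action ?A k (compose ?A g h) x =
        compose ?N (tuple_action ?A k g) (tuple_action ?A k h) x"
      proof (cases "x \<in> ?N")
        case True
        then show ?thesis using h[OF True]
          by (simp add: tuple_action_def compose_def) (simp add: in_nlists_iff)
      qed (simp add: tuple_action_def compose_def)
    qed
    then show ?thesis
      using B[OF that(1)] B[OF that(2)] by (simp add: Aut_def BijGroup_def tuple_action_Bij)
  qed
qed

lemma Pol_proj: "i < n \<Longrightarrow> (\<lambda>x \<in> nlists n (carrier S). x ! i) \<in> ops (Pol S) n"
proof -
  assume i: "i < n"
  let ?p = "\<lambda>x \<in> nlists n (carrier S). x ! i"
  have m: "map ?p xs = map (\<lambda>x. x ! i) xs" if "xs \<in> nlists m (nlists n (carrier S))" for xs m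
    using that by (simp add: in_nlists_iff[of xs])
  have "?p \<in> nlists n (carrier S) \<rightarrow>\<^sub>E carrier S"
    using i by (auto simp: in_nlists_iff)
  then show ?thesis
    unfolding Pol_def structure_hom_def power_structure_def using i by (auto simp only: m
        rel_structure.simps op_clone.simps partial_object.simps mem_Collect_eq)
qed

lemma Pol_minor:
  assumes f: "f \<in> ops (Pol S) n" and \<pi>: "\<pi> \<in> {..<n} \<rightarrow> {..<k}"
  shows "minor (carrier S) n k \<pi> f \<in> ops (Pol S) k"
proof -
  let ?A = "carrier S" and ?p = "\<lambda>x::'a list. map (\<lambda>i. x ! \<pi> i) [0..<n]"
  have p: "?p x \<in> nlists n ?A" if "x \<in> nlists k ?A" for x
    using that \<pi> by (auto simp: in_nlists_iff Pi_iff)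
  have fp: "f \<in> nlists n ?A \<rightarrow>\<^sub>E ?A"
    using f by (simp add: Pol_def structure_hom_def power_structure_def)
  have "map (minor ?A n k \<pi> f) xs \<in> interp S R"
    if R: "R \<in> symbols S" and xs: "xs \<in> nlists (arity S R) (nlists k ?A)"
      and i: "\<forall>i<k. map (\<lambda>x. x ! i) xs \<in> interp S R" for R xs
  proof -
    have 1: "map ?p xs \<in> nlists (arity S R) (nlists n ?A)"
      by (rule map_in_nlists[OF xs]) (use p in blast)
    have 2: "map (\<lambda>x. x ! j) (map ?p xs) \<in> interp S R" if "j < n" for j
    proof -
      have "map (\<lambda>x. x ! j) (map ?p xs) = map (\<lambda>x. x ! \<pi> j) xs" using that by simp
      moreover have "\<pi> j < k" using that \<pi> by auto
      ultimately show ?thesis using i by (simp del: map_map)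
    qed
    have "map f (map ?p xs) \<in> interp S R"
      using f R 1 2 by (simp add: Pol_def structure_hom_def power_structure_def del: map_map)
    moreover have "map (minor ?A n k \<pi> f) xs = map f (map ?p xs)"
      using xs by (simp add: minor_def in_nlists_iff[of xs])
    ultimately show ?thesis by (simp only:)
  qed
  moreover have "minor ?A n k \<pi> f \<in> nlists k ?A \<rightarrow>\<^sub>E ?A"
    using p fp unfolding minor_def by (intro restrict_PiE_iff[THEN iffD2] ballI) blast
  ultimately show ?thesis
    by (simp add: Pol_def structure_hom_def power_structure_def)
qed

end

theory Submission
  imports Defs "HOL-Analysis.Function_Topology"
begin

text \<open>
  The structure is the Fraisse-type limit of finite linear orders in which a family of finite
  configurations \<open>F\<^sub>h\<close> is forbidden, homogenised in the style of Cherlin, Shelah and Shi.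
  The configuration \<open>F\<^sub>h\<close> has nodes \<open>0, \<dots>, h - 1\<close>, and \<open>h\<close> links from every node to every node. It is
  an increasing chain: core elements, of which there are \<open>core_size h\<close>, sit at the even positions, and the
  link \<open>v\<close> sits at position \<open>2v + 1\<close>. Node \<open>i\<close> stands for one tuple of a relation \<open>R\<^bsub>h,i\<^esub>\<close>, consisting of
  the whole core and the links between \<open>i\<close> and other nodes.

  \<^emph>\<open>Minion homomorphism.\<close> By compactness, if there is none, then finitely many polymorphisms admit no
  choice of coordinates that respects the coincidences among their binary minors. Take \<open>h\<close> large, let the
  nodes be these polymorphisms and the links their coincidences. Unsatisfiability says that a certain
  structure in which every link has a \<open>0\<close>-copy and a \<open>1\<close>-copy does not contain \<open>F\<^sub>h\<close>, so it embeds; applying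
  the polymorphisms to it produces \<open>F\<^sub>h\<close>, a contradiction.

  \<^emph>\<open>No uniformly continuous one.\<close> For each finite set \<open>E\<close> there are polymorphisms satisfying on \<open>E\<close> the
  non-trivial identities \<open>p(x,y,y) = p(y,x,y) = f\<^sub>1(x,x,y)\<close>, \<open>f\<^sub>i(x,y,y) = f\<^bsub>i+1\<^esub>(x,x,y)\<close>,
  \<open>f\<^sub>m(x,y,y) = q(x,x,y) = q(x,y,x)\<close> for large \<open>m\<close>: glue copies of the cube of the structure accordingly. A copy of
  \<open>F\<^sub>h\<close> with a core larger than \<open>E\<close> lies in one of the copies, and one with a smaller core has fewer than \<open>m\<close>
  nodes; in either case it avoids some \<open>f\<^sub>i\<close>, and without \<open>f\<^sub>i\<close> the identities are satisfied by projections, which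
  map the copy of \<open>F\<^sub>h\<close> into the original structure.

  \<^emph>\<open>Orbit growth.\<close> As all tuples are increasing, a \<open>k\<close>-element substructure is given by a set of subsets of the
  \<open>k\<close> elements of prescribed sizes, and a single binomial coefficient is \<open>o(2\<^sup>k)\<close>.
\<close>

section \<open>Forbidden configurations and labelled orders\<close>

text \<open>The base \<open>16\<close> makes the core at least the fourth power of the number of node sets, \<open>2\<^sup>h\<close>, which keeps
  the orbit growth below \<open>2 ^ 2 ^ k\<close>.\<close>

definition core_size :: "nat \<Rightarrow> nat" where
  "core_size h = 16 ^ Suc h"

definition link_source :: "nat \<Rightarrow> nat \<Rightarrow> nat" where
  "link_source h v = v div h\<^sup>2"

definition link_target :: "nat \<Rightarrow> nat \<Rightarrow> nat" where
  "link_target h v = v div h mod h"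

definition boundary :: "nat \<Rightarrow> nat set \<Rightarrow> nat set" where
  "boundary h A = {v. v < h ^ 3 \<and> (link_source h v \<in> A) \<noteq> (link_target h v \<in> A)}"

definition positions :: "nat \<Rightarrow> nat set \<Rightarrow> nat set" where
  "positions h A = (\<lambda>p. 2 * p) ` {..<core_size h} \<union> (\<lambda>v. 2 * v + 1) ` boundary h A"

definition position_list :: "nat \<Rightarrow> nat set \<Rightarrow> nat list" where
  "position_list h A = sorted_list_of_set (positions h A)"

type_synonym 'a fact = "nat \<times> nat set \<times> 'a list"

definition holds :: "'a fact set \<Rightarrow> nat \<Rightarrow> nat set \<Rightarrow> (nat \<Rightarrow> 'a) \<Rightarrow> bool" where
  "holds T h A \<psi> \<longleftrightarrow> (h, A, map \<psi> (position_list h A)) \<in> T"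

section \<open>Positions of cores and links, and assignments of elements to them\<close>

lemma cube_less_core_size: "h ^ 3 < core_size h"
proof -
  have "h < 2 ^ h" by (rule less_exp)
  then have "h ^ 3 \<le> (2 ^ h) ^ 3" by (intro power_mono) auto
  also have "\<dots> = 8 ^ h" by (simp flip: power_mult add: mult.commute[of h] power_mult)
  also have "\<dots> \<le> 16 ^ h" by (intro power_mono) auto
  also have "\<dots> < core_size h" by (simp add: core_size_def)
  finally show ?thesis .
qed

lemma finite_boundary [simp]: "finite (boundary h A)"
  by (rule finite_subset[of _ "{..<h ^ 3}"]) (auto simp: boundary_def)

lemma finite_positions [simp]: "finite (positions h A)"
  by (simp add: positions_def)

lemma set_position_list [simp]: "set (position_list h A) = positions h A"
  by (simp add: position_list_def)

lemma length_position_list [simp]: "length (position_list h A) = card (positions h A)"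
  by (simp add: position_list_def)

lemma core_in_positions: "p < core_size h \<Longrightarrow> 2 * p \<in> positions h A"
  by (auto simp: positions_def)

lemma link_in_positions: "v \<in> boundary h A \<Longrightarrow> 2 * v + 1 \<in> positions h A"
  by (auto simp: positions_def)

lemma positions_Un: "positions h (A \<union> B) \<subseteq> positions h A \<union> positions h B"
  by (auto simp: positions_def boundary_def)

lemma image_positions_Un:
  "\<psi> ` positions h A \<subseteq> X \<Longrightarrow> \<psi> ` positions h B \<subseteq> X \<Longrightarrow> \<psi> ` positions h (A \<union> B) \<subseteq> X"
  using positions_Un[of h A B] by blast

lemma positions_Union: "finite A \<Longrightarrow> A \<noteq> {} \<Longrightarrow> positions h A \<subseteq> (\<Union>i\<in>A. positions h {i})"
  by (induction A rule: finite_ne_induct) (use positions_Un[of h "{_}"] in force)+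

lemma core_size_le_card_positions: "core_size h \<le> card (positions h A)"
proof -
  have "card ((\<lambda>p. 2 * p) ` {..<core_size h}) \<le> card (positions h A)"
    by (intro card_mono) (auto simp: positions_def)
  then show ?thesis by (simp add: card_image inj_on_def)
qed

lemma holds_cong:
  "(\<And>p. p \<in> positions h A \<Longrightarrow> \<psi> p = \<psi>' p) \<Longrightarrow> holds T h A \<psi> = holds T h A \<psi>'"
  unfolding holds_def by (intro arg_cong[where f = "\<lambda>ys. (h, A, ys) \<in> T"] map_cong) auto

lemma map_position_list_exhaust:
  assumes "length ys = card (positions h A)"
  obtains \<psi> where "ys = map \<psi> (position_list h A)"
proof -
  have d: "distinct (position_list h A)" by (simp add: position_list_def)
  have "ys = map (\<lambda>p. the (map_of (zip (position_list h A) ys) p)) (position_list h A)"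
    using assms d by (intro nth_equalityI) (auto simp: map_of_zip_nth)
  then show ?thesis using that by blast
qed

lemma sorted_map_position_list:
  "sorted_wrt (\<lambda>a b. (a, b) \<in> L) (map \<psi> (position_list h A)) \<longleftrightarrow>
     (\<forall>p \<in> positions h A. \<forall>q \<in> positions h A. p < q \<longrightarrow> (\<psi> p, \<psi> q) \<in> L)"
    (is "?l \<longleftrightarrow> ?r")
proof -
  let ?xs = "position_list h A"
  have s: "sorted_wrt (<) ?xs" by (simp add: position_list_def)
  have "?l \<longleftrightarrow> (\<forall>i j. i < j \<longrightarrow> j < length ?xs \<longrightarrow> (\<psi> (?xs ! i), \<psi> (?xs ! j)) \<in> L)"
    unfolding sorted_wrt_map by (simp only: sorted_wrt_iff_nth_less)
  also have "\<dots> \<longleftrightarrow> ?r"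
  proof (intro iffI ballI impI allI)
    fix p q assume a: "\<forall>i j. i < j \<longrightarrow> j < length ?xs \<longrightarrow> (\<psi> (?xs ! i), \<psi> (?xs ! j)) \<in> L"
      and "p \<in> positions h A" "q \<in> positions h A" "p < q"
    then obtain i j where ij: "i < length ?xs" "j < length ?xs" "p = ?xs ! i" "q = ?xs ! j"
      by (metis in_set_conv_nth set_position_list)
    have "i < j"
      using s ij \<open>p < q\<close> sorted_wrt_nth_less[OF s, of j i] by (cases i j rule: linorder_cases) auto
    then show "(\<psi> p, \<psi> q) \<in> L" using a ij by blast
  next
    fix i j assume a: "\<forall>p\<in>positions h A. \<forall>q\<in>positions h A. p < q \<longrightarrow> (\<psi> p, \<psi> q) \<in> L"
      and ij: "i < j" "j < length ?xs"
    have "?xs ! i < ?xs ! j" using s ij by (simp add: sorted_wrt_iff_nth_less)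
    moreover have "?xs ! i \<in> positions h A" "?xs ! j \<in> positions h A"
      using ij by (metis nth_mem order.strict_trans set_position_list)+
    ultimately show "(\<psi> (?xs ! i), \<psi> (?xs ! j)) \<in> L" using a by blast
  qed
  finally show ?thesis .
qed

text \<open>Every core position lies in both sets, and an odd position \<open>2 * v + 1\<close> is
  followed by the core position \<open>2 * Suc v\<close>. The latter exists because there are fewer
  links than core elements.\<close>

lemma positions_separated:
  assumes "p \<in> positions h A" "q \<in> positions h B" "p < q"
  obtains c where "c \<in> positions h A" "c \<in> positions h B" "p \<le> c" "c \<le> q"
proof -
  consider (p) i where "p = 2 * i" "i < core_size h" | (q) i where "q = 2 * i" "i < core_size h"
    | (pq) v w where "p = 2 * v + 1" "q = 2 * w + 1" "v \<in> boundary h A"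
    using assms(1,2) by (auto simp: positions_def)
  then show ?thesis
  proof cases
    case pq
    then have "Suc v < core_size h" using cube_less_core_size[of h] by (auto simp: boundary_def)
    then show ?thesis using that[of "2 * Suc v"] core_in_positions[of "Suc v" h] pq assms(3) by auto
  next
    case p
    then show ?thesis using that[of p] core_in_positions[of i h] assms by auto
  next
    case q
    then show ?thesis using that[of q] core_in_positions[of i h] assms by auto
  qed
qed

text \<open>Lets monotonicity be checked part by part: a position of one part and a position of
  another are compared through a core element between them.\<close>

lemma positions_mono_glue:
  assumes "trans L" "p \<in> positions h A" "q \<in> positions h B" "p < q"
    and "\<And>p q. p \<in> positions h A \<Longrightarrow> q \<in> positions h A \<Longrightarrow> p < q \<Longrightarrow> (\<psi> p, \<psi> q) \<in> L"
    and "\<And>p q. p \<in> positions h B \<Longrightarrow> q \<in> positions h B \<Longrightarrow> p < q \<Longrightarrow> (\<psi> p, \<psi> q) \<in> L"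
  shows "(\<psi> p, \<psi> q) \<in> L"
proof -
  obtain c where c: "c \<in> positions h A" "c \<in> positions h B" "p \<le> c" "c \<le> q"
    using positions_separated assms(2-4) by metis
  then consider "p = c" | "c = q" | "p < c" "c < q" by linarith
  then show ?thesis
  proof cases
    case 1
    then show ?thesis using assms(6)[of p q] assms(3,4) c by simp
  next
    case 2
    then show ?thesis using assms(5)[of p q] assms(2,4) c by simp
  next
    case 3
    then show ?thesis
      using assms(5)[OF assms(2) c(1)] assms(6)[OF c(2) assms(3)] transD[OF assms(1)] by blast
  qed
qed

text \<open>A link of both \<open>A\<close> and \<open>B\<close> has one end in each of them, so it is in both boundaries.\<close>

lemma combine_assignments:
  assumes "A \<inter> B = {}"
    and "\<forall>p \<in> positions h A. \<psi>\<^sub>A p = \<psi> p" and "\<forall>p \<in> positions h B. \<psi>\<^sub>B p = \<psi> p"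
  shows "\<exists>\<psi>'. (\<forall>A' p. A' \<subseteq> A \<longrightarrow> p \<in> positions h A' \<longrightarrow> \<psi>' p = \<psi>\<^sub>A p) \<and>
    (\<forall>B' p. B' \<subseteq> B \<longrightarrow> p \<in> positions h B' \<longrightarrow> \<psi>' p = \<psi>\<^sub>B p) \<and>
    (\<forall>p \<in> positions h (A \<union> B). \<psi>' p = \<psi> p)"
proof -
  \<comment> \<open>\<open>N A\<close> has room for every subset of \<open>A\<close>: besides the
    core and the boundary it contains the links inside \<open>A\<close>, where
    \<open>\<psi>\<^sub>A\<close> is independent of \<open>\<psi>\<^sub>B\<close>.\<close>
  define N where "N A = (\<lambda>p. 2 * p) ` {..<core_size h} \<union>
      (\<lambda>v. 2 * v + 1) ` {v. v < h ^ 3 \<and> (link_source h v \<in> A \<or> link_target h v \<in> A)}" for A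
  have N: "positions h A' \<subseteq> N C" if "A' \<subseteq> C" for A' C
    using that by (auto simp: N_def positions_def boundary_def)
  have NN: "N A \<inter> N B \<subseteq> positions h A \<inter> positions h B"
    using assms(1) by (fastforce simp: N_def positions_def boundary_def image_iff)
  define \<psi>' where "\<psi>' p = (if p \<in> N A then \<psi>\<^sub>A p else \<psi>\<^sub>B p)" for p
  have B: "\<psi>' p = \<psi>\<^sub>B p" if "p \<in> N B" for p
    using that NN assms(2,3) unfolding \<psi>'_def by (metis Int_iff subsetD)
  show ?thesis
  proof (intro exI[of _ \<psi>'] conjI allI impI ballI)
    show "\<psi>' p = \<psi>\<^sub>A p" if "A' \<subseteq> A" "p \<in> positions h A'" for A' p
      using N[OF that(1)] that(2) by (auto simp: \<psi>'_def)
    show "\<psi>' p = \<psi>\<^sub>B p" if "B' \<subseteq> B" "p \<in> positions h B'" for B' p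
      using N[OF that(1)] that(2) B by auto
    show "\<psi>' p = \<psi> p" if "p \<in> positions h (A \<union> B)" for p
    proof (cases "p \<in> positions h A")
      case True
      then show ?thesis using N[of A A] assms(2) by (auto simp: \<psi>'_def)
    next
      case False
      then have "p \<in> positions h B" using that positions_Un[of h A B] by blast
      then show ?thesis using N[of B B] assms(3) B by auto
    qed
  qed
qed

text \<open>The fact \<open>holds T h A \<psi>\<close> expresses that the part of \<open>F\<^sub>h\<close> formed by the nodes in \<open>A\<close> maps into the structure,
  or into some extension of it, with boundary \<open>\<psi>\<close>. Remembering these facts turns the class into
  an amalgamation class; \<open>F\<^sub>h\<close> itself is forbidden by \<open>A \<subset> {..<h}\<close>.\<close>

definition labelled_order :: "'a set \<Rightarrow> ('a \<times> 'a) set \<Rightarrow> 'a fact set \<Rightarrow> bool" where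
  "labelled_order X L T \<longleftrightarrow>
     L \<subseteq> X \<times> X \<and> irrefl L \<and> trans L \<and> total_on X L \<and>
     (\<forall>h A ys. (h, A, ys) \<in> T \<longrightarrow> A \<noteq> {} \<and> A \<subset> {..<h} \<and> length ys = card (positions h A) \<and>
        set ys \<subseteq> X \<and> sorted_wrt (\<lambda>a b. (a, b) \<in> L) ys) \<and>
     (\<forall>h A B \<psi>. A \<inter> B = {} \<longrightarrow> holds T h A \<psi> \<longrightarrow> holds T h B \<psi> \<longrightarrow> holds T h (A \<union> B) \<psi>)"

section \<open>Properties and constructions of labelled orders\<close>

lemma labelled_orderD:
  assumes "labelled_order X L T"
  shows "L \<subseteq> X \<times> X" "irrefl L" "trans L" "total_on X L"
    and "(h, A, ys) \<in> T \<Longrightarrow> A \<noteq> {}" "(h, A, ys) \<in> T \<Longrightarrow> A \<subset> {..<h}"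
    and "(h, A, ys) \<in> T \<Longrightarrow> length ys = card (positions h A)" "(h, A, ys) \<in> T \<Longrightarrow> set ys \<subseteq> X"
    and "(h, A, ys) \<in> T \<Longrightarrow> sorted_wrt (\<lambda>a b. (a, b) \<in> L) ys"
    and "A \<inter> B = {} \<Longrightarrow> holds T h A \<psi> \<Longrightarrow> holds T h B \<psi> \<Longrightarrow> holds T h (A \<union> B) \<psi>"
  using assms unfolding labelled_order_def by blast+

lemma labelled_order_holdsD:
  assumes "labelled_order X L T" "holds T h A \<psi>"
  shows "A \<noteq> {}" "A \<subset> {..<h}" "p \<in> positions h A \<Longrightarrow> \<psi> p \<in> X"
    "p \<in> positions h A \<Longrightarrow> q \<in> positions h A \<Longrightarrow> p < q \<Longrightarrow> (\<psi> p, \<psi> q) \<in> L"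
proof -
  note a = assms(2)[unfolded holds_def]
  show "A \<noteq> {}" "A \<subset> {..<h}" using labelled_orderD(5,6)[OF assms(1) a] by auto
  show "p \<in> positions h A \<Longrightarrow> \<psi> p \<in> X" using labelled_orderD(8)[OF assms(1) a] by auto
  show "p \<in> positions h A \<Longrightarrow> q \<in> positions h A \<Longrightarrow> p < q \<Longrightarrow> (\<psi> p, \<psi> q) \<in> L"
    using labelled_orderD(9)[OF assms(1) a] unfolding sorted_map_position_list by blast
qed

lemma labelled_orderI:
  assumes "L \<subseteq> X \<times> X" "irrefl L" "trans L" "total_on X L"
    and "\<And>h A ys. (h, A, ys) \<in> T \<Longrightarrow> length ys = card (positions h A)"
    and "\<And>h A \<psi>. holds T h A \<psi> \<Longrightarrow> A \<noteq> {} \<and> A \<subset> {..<h}"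
    and "\<And>h A \<psi> p. holds T h A \<psi> \<Longrightarrow> p \<in> positions h A \<Longrightarrow> \<psi> p \<in> X"
    and "\<And>h A \<psi> p q. holds T h A \<psi> \<Longrightarrow> p \<in> positions h A \<Longrightarrow> q \<in> positions h A \<Longrightarrow> p < q \<Longrightarrow> (\<psi> p, \<psi> q) \<in> L"
    and "\<And>h A B \<psi>. A \<inter> B = {} \<Longrightarrow> holds T h A \<psi> \<Longrightarrow> holds T h B \<psi> \<Longrightarrow> holds T h (A \<union> B) \<psi>"
  shows "labelled_order X L T"
proof -
  have "A \<noteq> {} \<and> A \<subset> {..<h} \<and> set ys \<subseteq> X \<and> sorted_wrt (\<lambda>a b. (a, b) \<in> L) ys"
    if y: "(h, A, ys) \<in> T" for h A ys
  proof -
    obtain \<psi> where \<psi>: "ys = map \<psi> (position_list h A)"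
      using map_position_list_exhaust assms(5)[OF y] by metis
    then have "holds T h A \<psi>" using y by (simp add: holds_def)
    then show ?thesis
      using assms(6,7,8) unfolding \<psi> sorted_map_position_list by auto
  qed
  then show ?thesis unfolding labelled_order_def using assms by auto
qed

text \<open>This is how the two auxiliary structures below are obtained.
  \<open>Ed h i \<psi>\<close> says that node \<open>i\<close> alone can be placed by
  \<open>\<psi>\<close>; a fact for \<open>A\<close> arises by placing all nodes of \<open>A\<close>
  at once and forgetting the links inside \<open>A\<close>. The hypothesis \<open>nf\<close> says
  that no complete configuration occurs.\<close>

lemma labelled_order_generated:
  fixes Ed :: "nat \<Rightarrow> nat \<Rightarrow> (nat \<Rightarrow> 'a) \<Rightarrow> bool"
  assumes "L \<subseteq> X \<times> X" "irrefl L" "trans L" "total_on X L"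
    and cong: "\<And>h i \<psi> \<psi>'. Ed h i \<psi> \<Longrightarrow> (\<And>p. p \<in> positions h {i} \<Longrightarrow> \<psi>' p = \<psi> p) \<Longrightarrow> Ed h i \<psi>'"
    and X: "\<And>h i \<psi> p. Ed h i \<psi> \<Longrightarrow> p \<in> positions h {i} \<Longrightarrow> \<psi> p \<in> X"
    and L: "\<And>h i \<psi> p q. Ed h i \<psi> \<Longrightarrow> p \<in> positions h {i} \<Longrightarrow> q \<in> positions h {i} \<Longrightarrow> p < q \<Longrightarrow> (\<psi> p, \<psi> q) \<in> L"
    and nf: "\<And>h \<psi>. h > 0 \<Longrightarrow> \<exists>i<h. \<not> Ed h i \<psi>"
    and T: "T = {(h, A, map \<psi> (position_list h A)) | h A \<psi>. A \<noteq> {} \<and> A \<subseteq> {..<h} \<and> (\<forall>i\<in>A. Ed h i \<psi>)}"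
  shows "labelled_order X L T"
proof -
  \<comment> \<open>\<open>\<psi>'\<close> and \<open>\<psi>\<close> may differ at the links inside
    \<open>A\<close>, which do not occur in the list of the fact.\<close>
  have H: "holds T h A \<psi> \<longleftrightarrow> A \<noteq> {} \<and> A \<subseteq> {..<h} \<and>
      (\<exists>\<psi>'. (\<forall>p \<in> positions h A. \<psi>' p = \<psi> p) \<and> (\<forall>i\<in>A. Ed h i \<psi>'))"
      (is "_ \<longleftrightarrow> ?r") for h A \<psi>
  proof
    assume "holds T h A \<psi>"
    then obtain \<psi>' where "map \<psi> (position_list h A) = map \<psi>' (position_list h A)"
      "A \<noteq> {}" "A \<subseteq> {..<h}" "\<forall>i\<in>A. Ed h i \<psi>'"
      unfolding holds_def T by blast
    then show ?r by (auto simp: map_eq_conv intro!: exI[of _ \<psi>'])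
  next
    assume ?r
    then obtain \<psi>' where \<psi>': "\<forall>p \<in> positions h A. \<psi>' p = \<psi> p" "A \<noteq> {}" "A \<subseteq> {..<h}" "\<forall>i\<in>A. Ed h i \<psi>'"
      by blast
    then have "map \<psi> (position_list h A) = map \<psi>' (position_list h A)" by auto
    then show "holds T h A \<psi>" unfolding holds_def T using \<psi>' by blast
  qed
  show ?thesis
  proof (rule labelled_orderI)
    show "A \<noteq> {} \<and> A \<subset> {..<h}" if "holds T h A \<psi>" for h A \<psi>
    proof -
      have "A \<noteq> {..<h}"
      proof
        assume A: "A = {..<h}"
        with that have "h > 0" by (auto simp: H)
        then show False using that nf unfolding H A by (meson lessThan_iff)
      qed
      then show ?thesis using that unfolding H by blast
    qed
  next
    fix h A \<psi> p assume h: "holds T h A \<psi>" and p: "p \<in> positions h A"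
    then obtain \<psi>' where \<psi>': "\<psi>' p = \<psi> p" "\<forall>i\<in>A. Ed h i \<psi>'" "A \<noteq> {}" "finite A"
      unfolding H by (meson finite_lessThan finite_subset)
    then obtain i where "i \<in> A" "p \<in> positions h {i}" using positions_Union[of A h] p by blast
    then show "\<psi> p \<in> X" using X \<psi>' by metis
  next
    fix h A \<psi> p q assume h: "holds T h A \<psi>" and p: "p \<in> positions h A" "q \<in> positions h A" "p < q"
    then obtain \<psi>' where \<psi>': "\<psi>' p = \<psi> p" "\<psi>' q = \<psi> q" "\<forall>i\<in>A. Ed h i \<psi>'" "A \<noteq> {}" "finite A"
      unfolding H by (meson finite_lessThan finite_subset)
    then obtain i j where ij: "i \<in> A" "p \<in> positions h {i}" "j \<in> A" "q \<in> positions h {j}"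
      using positions_Union[of A h] p by blast
    have "(\<psi>' p, \<psi>' q) \<in> L"
      by (rule positions_mono_glue[OF assms(3) ij(2,4) p(3)]) (use L \<psi>'(3) ij in blast)+
    then show "(\<psi> p, \<psi> q) \<in> L" using \<psi>' by simp
  next
    fix h A B \<psi> assume AB: "A \<inter> B = {}" "holds T h A \<psi>" "holds T h B \<psi>"
    obtain \<psi>\<^sub>A where A: "\<forall>p \<in> positions h A. \<psi>\<^sub>A p = \<psi> p" "\<And>i. i \<in> A \<Longrightarrow> Ed h i \<psi>\<^sub>A"
      using AB(2) unfolding H by blast
    obtain \<psi>\<^sub>B where B: "\<forall>p \<in> positions h B. \<psi>\<^sub>B p = \<psi> p" "\<And>i. i \<in> B \<Longrightarrow> Ed h i \<psi>\<^sub>B"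
      using AB(3) unfolding H by blast
    obtain \<psi>' where 1: "\<forall>A' p. A' \<subseteq> A \<longrightarrow> p \<in> positions h A' \<longrightarrow> \<psi>' p = \<psi>\<^sub>A p"
      and 2: "\<forall>B' p. B' \<subseteq> B \<longrightarrow> p \<in> positions h B' \<longrightarrow> \<psi>' p = \<psi>\<^sub>B p"
      and 3: "\<forall>p \<in> positions h (A \<union> B). \<psi>' p = \<psi> p"
      using combine_assignments[OF AB(1) A(1) B(1)] by (elim exE conjE)
    have "Ed h i \<psi>'" if "i \<in> A" for i using cong[OF A(2)[OF that]] 1[rule_format, of "{i}"] that by simp
    moreover have "Ed h i \<psi>'" if "i \<in> B" for i using cong[OF B(2)[OF that]] 2[rule_format, of "{i}"] that by simp
    ultimately show "holds T h (A \<union> B) \<psi>"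
      using AB(2,3) 3 unfolding H by (auto intro!: exI[of _ \<psi>'])
  qed (use assms in \<open>auto simp: T\<close>)
qed

text \<open>The source of later contradictions: if every single node of \<open>{..<h}\<close> is a
  fact under one assignment, then so is \<open>{..<h}\<close> itself, which a labelled order
  excludes.\<close>

lemma labelled_order_finite_union:
  assumes "labelled_order X L T" "finite A" "A \<noteq> {}" "\<And>i. i \<in> A \<Longrightarrow> holds T h {i} \<psi>"
  shows "holds T h A \<psi>"
  using assms(2,3,4)
proof (induction A rule: finite_ne_induct)
  case (insert i A)
  then show ?case using labelled_orderD(10)[OF assms(1), of "{i}" A] by auto
qed auto

lemma labelled_order_restrict:
  assumes "labelled_order X L T" "Y \<subseteq> X"
  shows "labelled_order Y (L \<inter> Y \<times> Y) {(h, A, ys) \<in> T. set ys \<subseteq> Y}"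
proof -
  note D = labelled_orderD[OF assms(1)]
  have H: "holds {(h, A, ys) \<in> T. set ys \<subseteq> Y} h A \<psi> \<longleftrightarrow> holds T h A \<psi> \<and> \<psi> ` positions h A \<subseteq> Y" for h A \<psi>
    by (auto simp: holds_def)
  show ?thesis
  proof (rule labelled_orderI)
    show "trans (L \<inter> Y \<times> Y)" using D(3) unfolding trans_def by blast
    show "total_on Y (L \<inter> Y \<times> Y)" using D(4) assms(2) unfolding total_on_def by blast
    show "irrefl (L \<inter> Y \<times> Y)" using D(2) unfolding irrefl_def by blast
    fix h A B \<psi>
    assume "A \<inter> B = {}" "holds {(h, A, ys) \<in> T. set ys \<subseteq> Y} h A \<psi>" "holds {(h, A, ys) \<in> T. set ys \<subseteq> Y} h B \<psi>"
    then show "holds {(h, A, ys) \<in> T. set ys \<subseteq> Y} h (A \<union> B) \<psi>"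
      unfolding H using D(10)[of A B h \<psi>] image_positions_Un[of \<psi> h A Y B] by simp
  next
    fix h A \<psi> assume "holds {(h, A, ys) \<in> T. set ys \<subseteq> Y} h A \<psi>"
    then have h: "holds T h A \<psi>" "\<psi> ` positions h A \<subseteq> Y" by (auto simp: H)
    show "A \<noteq> {} \<and> A \<subset> {..<h}" using labelled_order_holdsD(1,2)[OF assms(1) h(1)] by simp
    show "\<psi> p \<in> Y" if "p \<in> positions h A" for p using h that by auto
    show "(\<psi> p, \<psi> q) \<in> L \<inter> Y \<times> Y" if "p \<in> positions h A" "q \<in> positions h A" "p < q" for p q
      using h that labelled_order_holdsD(4)[OF assms(1) h(1) that] by auto
  qed (use D(7) in auto)
qed

lemma labelled_order_image:
  assumes "labelled_order X L T" "inj_on g X"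
  shows "labelled_order (g ` X) ((\<lambda>(a, b). (g a, g b)) ` L) ((\<lambda>(h, A, ys). (h, A, map g ys)) ` T)"
    (is "labelled_order _ ?L ?T")
proof -
  note D = labelled_orderD[OF assms(1)]
  define k where "k = inv_into X g"
  have k: "x \<in> X \<Longrightarrow> k (g x) = x" for x using assms(2) by (simp add: k_def)
  have H: "holds ?T h A \<psi> \<longleftrightarrow> \<psi> ` positions h A \<subseteq> g ` X \<and> holds T h A (k \<circ> \<psi>)" for h A \<psi>
  proof
    assume "holds ?T h A \<psi>"
    then obtain ys where ys: "(h, A, ys) \<in> T" "map \<psi> (position_list h A) = map g ys"
      unfolding holds_def by auto
    then have "\<psi> ` positions h A = g ` set ys" by (metis list.set_map set_position_list)
    moreover have "map (k \<circ> \<psi>) (position_list h A) = ys"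
    proof -
      have "map (k \<circ> \<psi>) (position_list h A) = map k (map g ys)"
        unfolding ys(2)[symmetric] by simp
      also have "\<dots> = ys" using D(8)[OF ys(1)] by (auto simp: k intro!: map_idI)
      finally show ?thesis .
    qed
    ultimately show "\<psi> ` positions h A \<subseteq> g ` X \<and> holds T h A (k \<circ> \<psi>)"
      using D(8)[OF ys(1)] ys(1) by (auto simp: holds_def)
  next
    assume a: "\<psi> ` positions h A \<subseteq> g ` X \<and> holds T h A (k \<circ> \<psi>)"
    have "map \<psi> (position_list h A) = map g (map (k \<circ> \<psi>) (position_list h A))"
      using a by (force simp: k)
    then show "holds ?T h A \<psi>" using a unfolding holds_def by (force simp del: map_map)
  qed
  have L: "(a, b) \<in> ?L \<longleftrightarrow> a \<in> g ` X \<and> b \<in> g ` X \<and> (k a, k b) \<in> L" for a b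
    using D(1) by (force simp: k image_iff)
  show ?thesis
  proof (rule labelled_orderI)
    show "irrefl ?L" using D(2) unfolding irrefl_def L by blast
    show "trans ?L" using D(3) unfolding trans_def L by blast
    show "total_on (g ` X) ?L" using D(4) unfolding total_on_def L by (auto simp: k)
    fix h A ys assume "(h, A, ys) \<in> ?T"
    then show "length ys = card (positions h A)" using D(7) by auto
  next
    fix h A B \<psi> assume "A \<inter> B = {}" "holds ?T h A \<psi>" "holds ?T h B \<psi>"
    then show "holds ?T h (A \<union> B) \<psi>" 
      unfolding H using D(10)[of A B h "k \<circ> \<psi>"] image_positions_Un[of \<psi> h A "g ` X" B] by simp
  next
    fix h A \<psi> assume "holds ?T h A \<psi>"
    then have h: "holds T h A (k \<circ> \<psi>)" "\<psi> ` positions h A \<subseteq> g ` X" by (auto simp: H)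
    show "A \<noteq> {} \<and> A \<subset> {..<h}" using labelled_order_holdsD(1,2)[OF assms(1) h(1)] by simp
    show "\<psi> p \<in> g ` X" if "p \<in> positions h A" for p using h that by auto
    show "(\<psi> p, \<psi> q) \<in> ?L" if "p \<in> positions h A" "q \<in> positions h A" "p < q" for p q
      using h that labelled_order_holdsD(4)[OF assms(1) h(1) that] by (auto simp: L)
  qed (use D(1) in auto)
qed

section \<open>Amalgamation\<close>

text \<open>A link leaving \<open>B\<close> either leaves \<open>A \<union> B\<close> as well or
  ends in \<open>A\<close>; in the latter case it also leaves \<open>A\<close>.\<close>

lemma positions_disjoint_part:
  "A \<inter> B = {} \<Longrightarrow> positions h B \<subseteq> positions h (A \<union> B) \<union> positions h A"
  by (auto simp: positions_def boundary_def)

lemma boundary_all: "boundary h {..<h} = {}"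
proof (cases "h = 0")
  case False
  have "link_source h v < h" "link_target h v < h" if "v < h ^ 3" for v
    using that False by (simp_all add: link_source_def link_target_def less_mult_imp_div_less power3_eq_cube power2_eq_square)
  then show ?thesis by (auto simp: boundary_def)
qed (simp add: boundary_def)

text \<open>With no node left outside there are no boundary links, so only the core remains, which
  is common to all \<open>A\<close>.\<close>

lemma positions_all_subset: "positions h {..<h} \<subseteq> positions h A"
  by (auto simp: positions_def boundary_all)

lemma linear_order_insert:
  assumes L: "L \<subseteq> X \<times> X" "irrefl L" "trans L" "total_on X L"
    and L': "L' \<subseteq> insert p Z \<times> insert p Z" "irrefl L'" "trans L'" "total_on (insert p Z) L'"
    and Z: "Z \<subseteq> X" "p \<notin> X" "L \<inter> Z \<times> Z = L' \<inter> Z \<times> Z"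
  obtains L'' where "L'' \<subseteq> insert p X \<times> insert p X" "irrefl L''" "trans L''" "total_on (insert p X) L''"
    "L'' \<inter> X \<times> X = L" "L'' \<inter> insert p Z \<times> insert p Z = L'"
proof -
  \<comment> \<open>\<open>D\<close> is the lower part of the cut into which \<open>p\<close> is
    put: everything below or equal to some point of \<open>Z\<close> that precedes \<open>p\<close>.
    The remaining points of \<open>X\<close> come after \<open>p\<close>.\<close>
  define D where "D = {a \<in> X. \<exists>z\<in>Z. (z, p) \<in> L' \<and> (a = z \<or> (a, z) \<in> L)}"
  define L'' where "L'' = L \<union> D \<times> {p} \<union> {p} \<times> (X - D)"
  have DX: "D \<subseteq> X" by (auto simp: D_def)
  have down: "a \<in> D" if "(a, b) \<in> L" "b \<in> D" for a b
    using that L(1) transD[OF L(3)] unfolding D_def by blast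
  have ZL: "(a, b) \<in> L \<longleftrightarrow> (a, b) \<in> L'" if "a \<in> Z" "b \<in> Z" for a b
    using Z(3) that by blast
  have ZD: "z \<in> D \<longleftrightarrow> (z, p) \<in> L'" if "z \<in> Z" for z
    using that Z(1) ZL transD[OF L'(3)] unfolding D_def by blast
  have ZD': "z \<notin> D \<longleftrightarrow> (p, z) \<in> L'" if "z \<in> Z" for z
  proof -
    have "z \<noteq> p" using that Z by blast
    then show ?thesis
      using ZD[OF that] that L'(2,4) transD[OF L'(3), of z p z] unfolding total_on_def irrefl_def by blast
  qed
  have low: "(a, b) \<in> L" if "a \<in> D" "b \<in> X - D" for a b
    using that down[of b a] DX L(4) unfolding total_on_def by (metis DiffE subsetD)
  show ?thesis
  proof (rule that[of L''])
    show "L'' \<subseteq> insert p X \<times> insert p X" using L(1) DX by (auto simp: L''_def)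
    show "irrefl L''" using L(2) DX Z(2) by (auto simp: L''_def irrefl_def)
    show "trans L''"
    proof (rule transI)
      fix a b c assume a: "(a, b) \<in> L''" "(b, c) \<in> L''"
      consider "a = p" | "b = p" | "c = p" | "a \<noteq> p" "b \<noteq> p" "c \<noteq> p" by blast
      then show "(a, c) \<in> L''"
      proof cases
        case 1
        then show ?thesis using a L(1) Z(2) DX down unfolding L''_def by blast
      next
        case 2
        then show ?thesis using a L(1) Z(2) DX low unfolding L''_def by blast
      next
        case 3
        then show ?thesis using a L(1) Z(2) DX down unfolding L''_def by blast
      next
        case 4
        then show ?thesis using a transD[OF L(3)] unfolding L''_def by blast
      qed
    qed
    show "total_on (insert p X) L''" using L(4) unfolding L''_def total_on_def by blast
    show "L'' \<inter> X \<times> X = L" using L(1) Z(2) by (auto simp: L''_def)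
    show "L'' \<inter> insert p Z \<times> insert p Z = L'"
    proof -
      have "(a, b) \<in> L'' \<inter> insert p Z \<times> insert p Z \<longleftrightarrow> (a, b) \<in> L'" for a b
      proof (cases "a \<in> insert p Z \<and> b \<in> insert p Z")
        case True
        then consider "a = p" "b = p" | "a = p" "b \<in> Z" | "a \<in> Z" "b = p" | "a \<in> Z" "b \<in> Z" by blast
        then show ?thesis
        proof cases
          case 1
          then show ?thesis using L(1) L'(2) Z DX by (auto simp: L''_def irrefl_def)
        next
          case 2
          then show ?thesis using L(1) Z DX ZD'[of b] by (auto simp: L''_def)
        next
          case 3
          then show ?thesis using L(1) Z DX ZD[of a] by (auto simp: L''_def)
        next
          case 4
          then show ?thesis using Z ZL[of a b] by (auto simp: L''_def)
        qed
      qed (use L'(1) in blast)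
      then show ?thesis by (intro equalityI subrelI) blast+
    qed
  qed
qed

text \<open>The facts of the amalgam are the unions of a fact on \<open>X\<close> and a fact on
  \<open>insert p Z\<close>, with the links between the two parts forgotten. The point is that
  closing under such unions creates neither a new fact on one of the two sides nor a complete
  configuration.\<close>

lemma one_point_amalgamation:
  assumes X: "labelled_order X L T" and Y: "labelled_order (insert p Z) L' T'"
    and Z: "Z \<subseteq> X" "p \<notin> X" and LL: "L \<inter> Z \<times> Z = L' \<inter> Z \<times> Z"
    and TT: "\<And>h A ys. set ys \<subseteq> Z \<Longrightarrow> (h, A, ys) \<in> T \<longleftrightarrow> (h, A, ys) \<in> T'"
  obtains L'' T'' where "labelled_order (insert p X) L'' T''"
    "L'' \<inter> X \<times> X = L" "\<And>h A ys. set ys \<subseteq> X \<Longrightarrow> (h, A, ys) \<in> T'' \<longleftrightarrow> (h, A, ys) \<in> T"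
    "L'' \<inter> insert p Z \<times> insert p Z = L'"
    "\<And>h A ys. set ys \<subseteq> insert p Z \<Longrightarrow> (h, A, ys) \<in> T'' \<longleftrightarrow> (h, A, ys) \<in> T'"
proof -
  note DX = labelled_orderD[OF X] and DY = labelled_orderD[OF Y]
  note HX = labelled_order_holdsD[OF X] and HY = labelled_order_holdsD[OF Y]
  obtain L'' where L'': "L'' \<subseteq> insert p X \<times> insert p X" "irrefl L''" "trans L''" "total_on (insert p X) L''"
    "L'' \<inter> X \<times> X = L" "L'' \<inter> insert p Z \<times> insert p Z = L'"
    using linear_order_insert[OF DX(1-4) DY(1-4) Z LL] by blast
  \<comment> \<open>\<open>A\<close> splits into a part witnessed in \<open>X\<close> and a part witnessed in \<open>insert p Z\<close>; when both are
    non-empty, the links between them, and the core, lie in \<open>Z\<close>.\<close>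
  define W where "W h A \<psi> A1 A2 \<longleftrightarrow> A = A1 \<union> A2 \<and> A1 \<inter> A2 = {} \<and> A \<noteq> {} \<and>
    (A1 = {} \<or> holds T h A1 \<psi>) \<and> (A2 = {} \<or> holds T' h A2 \<psi>)" for h A \<psi> A1 A2
  define T'' where "T'' = {(h, A, map \<psi> (position_list h A)) | h A \<psi>. \<exists>A1 A2. W h A \<psi> A1 A2}"
  have H: "holds T'' h A \<psi> \<longleftrightarrow> (\<exists>\<psi>' A1 A2. (\<forall>p \<in> positions h A. \<psi>' p = \<psi> p) \<and> W h A \<psi>' A1 A2)"
    (is "_ \<longleftrightarrow> ?r") for h A \<psi>
  proof
    assume "holds T'' h A \<psi>"
    then obtain \<psi>' A1 A2 where "map \<psi> (position_list h A) = map \<psi>' (position_list h A)" "W h A \<psi>' A1 A2"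
      unfolding holds_def T''_def by blast
    then show ?r by (auto simp: map_eq_conv intro!: exI[of _ \<psi>'])
  next
    assume ?r
    then obtain \<psi>' A1 A2 where \<psi>': "\<forall>p \<in> positions h A. \<psi>' p = \<psi> p" "W h A \<psi>' A1 A2" by blast
    then have "map \<psi> (position_list h A) = map \<psi>' (position_list h A)" by auto
    then show "holds T'' h A \<psi>" unfolding holds_def T''_def using \<psi>' by blast
  qed
  have hZ: "holds T h A \<psi> \<longleftrightarrow> holds T' h A \<psi>" if "\<psi> ` positions h A \<subseteq> Z" for h A \<psi>
    using TT[of "map \<psi> (position_list h A)"] that by (simp add: holds_def)
  have XY: "a \<in> Z" if "a \<in> X" "a \<in> insert p Z" for a using that Z(2) by blast
  \<comment> \<open>Links of \<open>A2\<close> that are not in the boundary of \<open>A\<close> go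
    to \<open>A1\<close>, so their values lie in \<open>X\<close> too. Hence the fact for
    \<open>A2\<close> lives on \<open>Z\<close>, where \<open>T\<close> and \<open>T'\<close>
    agree.\<close>
  have KX: "holds T h A \<psi>" if w: "W h A \<psi> A1 A2" and \<psi>: "\<psi> ` positions h A \<subseteq> X" for h A \<psi> A1 A2
  proof (cases "A2 = {}")
    case True
    then show ?thesis using w by (auto simp: W_def)
  next
    case False
    then have A2: "holds T' h A2 \<psi>" using w by (simp add: W_def)
    show ?thesis
    proof (cases "A1 = {}")
      case True
      then have A: "A = A2" using w by (simp add: W_def)
      then have "\<psi> ` positions h A \<subseteq> Z" using HY(3)[OF A2] \<psi> XY by blast
      then show ?thesis using A2 hZ A by blast
    next
      case False
      then have A1: "holds T h A1 \<psi>" using w by (simp add: W_def)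
      have "\<psi> q \<in> X" if "q \<in> positions h A2" for q
        using positions_disjoint_part[of A1 A2 h] w that \<psi> HX(3)[OF A1] by (auto simp: W_def)
      then have "\<psi> ` positions h A2 \<subseteq> Z" using HY(3)[OF A2] XY by blast
      then have "holds T h A2 \<psi>" using A2 hZ by blast
      then show ?thesis using DX(10)[OF _ A1] w by (auto simp: W_def)
    qed
  qed
  have KY: "holds T' h A \<psi>" if w: "W h A \<psi> A1 A2" and \<psi>: "\<psi> ` positions h A \<subseteq> insert p Z" for h A \<psi> A1 A2
  proof (cases "A1 = {}")
    case True
    then show ?thesis using w by (auto simp: W_def)
  next
    case False
    then have A1: "holds T h A1 \<psi>" using w by (simp add: W_def)
    show ?thesis
    proof (cases "A2 = {}")
      case True
      then have A: "A = A1" using w by (simp add: W_def)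
      then have "\<psi> ` positions h A \<subseteq> Z" using HX(3)[OF A1] \<psi> XY by blast
      then show ?thesis using A1 hZ A by blast
    next
      case False
      then have A2: "holds T' h A2 \<psi>" using w by (simp add: W_def)
      have "\<psi> q \<in> insert p Z" if "q \<in> positions h A1" for q
        using positions_disjoint_part[of A2 A1 h] w that \<psi> HY(3)[OF A2] by (auto simp: W_def Un_commute)
      then have "\<psi> ` positions h A1 \<subseteq> Z" using HX(3)[OF A1] XY by blast
      then have "holds T' h A1 \<psi>" using A1 hZ by blast
      then show ?thesis using DY(10)[OF _ _ A2] w by (auto simp: W_def)
    qed
  qed
  have facts: "(h, A, ys) \<in> T'' \<longleftrightarrow> (h, A, ys) \<in> T" if "set ys \<subseteq> X" for h A ys
  proof
    assume "(h, A, ys) \<in> T''"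
    then obtain \<psi> A1 A2 where "ys = map \<psi> (position_list h A)" "W h A \<psi> A1 A2" by (auto simp: T''_def)
    then show "(h, A, ys) \<in> T" using KX[of h A \<psi> A1 A2] that by (simp add: holds_def)
  next
    assume y: "(h, A, ys) \<in> T"
    obtain \<psi> where \<psi>: "ys = map \<psi> (position_list h A)" by (rule map_position_list_exhaust[OF DX(7)[OF y]])
    then have "W h A \<psi> A {}" using y DX(5) by (auto simp: W_def holds_def)
    then show "(h, A, ys) \<in> T''" unfolding T''_def \<psi> by blast
  qed
  have facts': "(h, A, ys) \<in> T'' \<longleftrightarrow> (h, A, ys) \<in> T'" if "set ys \<subseteq> insert p Z" for h A ys
  proof
    assume "(h, A, ys) \<in> T''"
    then obtain \<psi> A1 A2 where "ys = map \<psi> (position_list h A)" "W h A \<psi> A1 A2" by (auto simp: T''_def)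
    then show "(h, A, ys) \<in> T'" using KY[of h A \<psi> A1 A2] that by (simp add: holds_def)
  next
    assume y: "(h, A, ys) \<in> T'"
    obtain \<psi> where \<psi>: "ys = map \<psi> (position_list h A)" by (rule map_position_list_exhaust[OF DY(7)[OF y]])
    then have "W h A \<psi> {} A" using y DY(5) by (auto simp: W_def holds_def)
    then show "(h, A, ys) \<in> T''" unfolding T''_def \<psi> by blast
  qed
  have "labelled_order (insert p X) L'' T''"
  proof (rule labelled_orderI[OF L''(1-4)])
    fix h A ys assume "(h, A, ys) \<in> T''"
    then show "length ys = card (positions h A)" by (auto simp: T''_def)
  next
    fix h A \<psi> assume "holds T'' h A \<psi>"
    then obtain \<psi>' A1 A2 where \<psi>': "\<forall>p \<in> positions h A. \<psi>' p = \<psi> p" and w: "W h A \<psi>' A1 A2"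
      unfolding H by blast
    have A1: "A1 \<subset> {..<h}" "\<And>q. q \<in> positions h A1 \<Longrightarrow> \<psi>' q \<in> X"
      "\<And>q r. q \<in> positions h A1 \<Longrightarrow> r \<in> positions h A1 \<Longrightarrow> q < r \<Longrightarrow> (\<psi>' q, \<psi>' r) \<in> L''" if "A1 \<noteq> {}"
      using w that HX[of h A1 \<psi>'] L''(5) by (auto simp: W_def)
    have A2: "A2 \<subset> {..<h}" "\<And>q. q \<in> positions h A2 \<Longrightarrow> \<psi>' q \<in> insert p Z"
      "\<And>q r. q \<in> positions h A2 \<Longrightarrow> r \<in> positions h A2 \<Longrightarrow> q < r \<Longrightarrow> (\<psi>' q, \<psi>' r) \<in> L''" if "A2 \<noteq> {}"
      using w that HY[of h A2 \<psi>'] L''(6) by (auto simp: W_def)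
    \<comment> \<open>A complete configuration has only the core as its boundary. The core lies on
      the side of any non-empty part, so the whole would already be a fact on that side.\<close>
    have "A \<noteq> {..<h}"
    proof
      assume A: "A = {..<h}"
      have "A1 \<noteq> {} \<Longrightarrow> \<psi>' ` positions h A \<subseteq> X" using A1(2) positions_all_subset[of h A1] unfolding A by blast
      moreover have "A2 \<noteq> {} \<Longrightarrow> \<psi>' ` positions h A \<subseteq> insert p Z"
        using A2(2) positions_all_subset[of h A2] unfolding A by blast
      ultimately have "holds T h A \<psi>' \<or> holds T' h A \<psi>'" using KX[OF w] KY[OF w] w by (auto simp: W_def)
      then show False using HX(2) HY(2) A by blast
    qed
    moreover have "A1 \<subseteq> {..<h}" "A2 \<subseteq> {..<h}" using A1(1) A2(1) by blast+
    ultimately show "A \<noteq> {} \<and> A \<subset> {..<h}" using w by (auto simp: W_def)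
    \<comment> \<open>Only non-empty parts are used: \<open>positions h {}\<close> still contains
      the core, but an empty part imposes no condition on its values.\<close>
    define I where "I = {B \<in> {A1, A2}. B \<noteq> {}}"
    have pos: "\<exists>B \<in> I. q \<in> positions h B" if "q \<in> positions h A" for q
      using positions_Un[of h A1 A2] w that by (cases "A1 = {}"; cases "A2 = {}") (auto simp: W_def I_def)
    show "\<psi> q \<in> insert p X" if q: "q \<in> positions h A" for q
    proof -
      obtain B where "B \<in> I" "q \<in> positions h B" using pos[OF q] by blast
      then have "\<psi>' q \<in> insert p X" using A1(2)[of q] A2(2)[of q] Z(1) unfolding I_def by blast
      then show ?thesis using \<psi>' q by simp
    qed
    show "(\<psi> q, \<psi> r) \<in> L''" if qr: "q \<in> positions h A" "r \<in> positions h A" "q < r" for q r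
    proof -
      obtain B C where BC: "B \<in> I" "C \<in> I" "q \<in> positions h B" "r \<in> positions h C"
        using pos[OF qr(1)] pos[OF qr(2)] by blast
      have mono: "(\<psi>' q, \<psi>' r) \<in> L''"
        if "B \<in> I" "q \<in> positions h B" "r \<in> positions h B" "q < r" for B q r
        using that A1(3)[of q r] A2(3)[of q r] unfolding I_def by blast
      have "(\<psi>' q, \<psi>' r) \<in> L''"
        by (rule positions_mono_glue[OF L''(3) BC(3,4) qr(3)]) (use mono BC in blast)+
      then show ?thesis using \<psi>' qr by simp
    qed
  next
    fix h A B \<psi> assume AB: "A \<inter> B = {}" "holds T'' h A \<psi>" "holds T'' h B \<psi>"
    obtain \<psi>\<^sub>A A1 A2 where A: "\<forall>p \<in> positions h A. \<psi>\<^sub>A p = \<psi> p" "W h A \<psi>\<^sub>A A1 A2" using AB(2) H by blast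
    obtain \<psi>\<^sub>B B1 B2 where B: "\<forall>p \<in> positions h B. \<psi>\<^sub>B p = \<psi> p" "W h B \<psi>\<^sub>B B1 B2" using AB(3) H by blast
    obtain \<psi>' where 1: "\<forall>A' p. A' \<subseteq> A \<longrightarrow> p \<in> positions h A' \<longrightarrow> \<psi>' p = \<psi>\<^sub>A p"
      and 2: "\<forall>B' p. B' \<subseteq> B \<longrightarrow> p \<in> positions h B' \<longrightarrow> \<psi>' p = \<psi>\<^sub>B p"
      and 3: "\<forall>p \<in> positions h (A \<union> B). \<psi>' p = \<psi> p"
      using combine_assignments[OF AB(1) A(1) B(1)] by (elim exE conjE)
    have sub: "A1 \<subseteq> A" "A2 \<subseteq> A" "B1 \<subseteq> B" "B2 \<subseteq> B" using A(2) B(2) by (auto simp: W_def)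
    have c: "holds T h A1 \<psi>\<^sub>A = holds T h A1 \<psi>'" "holds T' h A2 \<psi>\<^sub>A = holds T' h A2 \<psi>'"
      "holds T h B1 \<psi>\<^sub>B = holds T h B1 \<psi>'" "holds T' h B2 \<psi>\<^sub>B = holds T' h B2 \<psi>'"
      by (rule holds_cong, use 1 2 sub in metis)+
    \<comment> \<open>The four parts are regrouped by side: \<open>A1 \<union> B1\<close> in
      \<open>X\<close> and \<open>A2 \<union> B2\<close> in \<open>insert p Z\<close>.\<close>
    have d: "A1 \<inter> B1 = {}" "A2 \<inter> B2 = {}" using sub AB(1) by blast+
    have "A1 \<union> B1 = {} \<or> holds T h (A1 \<union> B1) \<psi>'"
      using A(2) B(2) c DX(10)[OF d(1), of h \<psi>'] by (auto simp: W_def)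
    moreover have "A2 \<union> B2 = {} \<or> holds T' h (A2 \<union> B2) \<psi>'"
      using A(2) B(2) c DY(10)[OF d(2), of h \<psi>'] by (auto simp: W_def)
    moreover have "(A1 \<union> B1) \<inter> (A2 \<union> B2) = {}" using A(2) B(2) sub AB(1) by (auto simp: W_def)
    moreover have "A \<union> B = A1 \<union> B1 \<union> (A2 \<union> B2)" "A \<union> B \<noteq> {}" using A(2) B(2) by (auto simp: W_def)
    ultimately have "W h (A \<union> B) \<psi>' (A1 \<union> B1) (A2 \<union> B2)" unfolding W_def by blast
    then show "holds T'' h (A \<union> B) \<psi>" unfolding H using 3 by blast
  qed
  then show ?thesis using that L''(5,6) facts facts' by blast
qed

section \<open>The generic labelled order\<close>

text \<open>The one-point extension axioms of a Fraisse limit. \<open>p\<close> is only a name for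
  the new point in the abstract extension; the point realising it is \<open>d\<close>.\<close>

definition extension_property :: "(nat \<times> nat) set \<Rightarrow> nat fact set \<Rightarrow> bool" where
  "extension_property L T \<longleftrightarrow>
     (\<forall>Y p L' T'. finite Y \<longrightarrow> p \<notin> Y \<longrightarrow> labelled_order (insert p Y) L' T' \<longrightarrow>
        L \<inter> Y \<times> Y = L' \<inter> Y \<times> Y \<longrightarrow>
        (\<forall>h A ys. set ys \<subseteq> Y \<longrightarrow> ((h, A, ys) \<in> T \<longleftrightarrow> (h, A, ys) \<in> T')) \<longrightarrow>
        (\<exists>d. d \<notin> Y \<and> (\<forall>a\<in>Y. ((a, d) \<in> L \<longleftrightarrow> (a, p) \<in> L') \<and> ((d, a) \<in> L \<longleftrightarrow> (p, a) \<in> L')) \<and>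
           (\<forall>h A ys. set ys \<subseteq> insert p Y \<longrightarrow> ((h, A, map (id(p := d)) ys) \<in> T \<longleftrightarrow> (h, A, ys) \<in> T'))))"

lemma labelled_order_empty: "labelled_order {} {} {}"
  by (simp add: labelled_order_def holds_def)

lemma labelled_order_singleton: "labelled_order {p} {} {}"
  by (simp add: labelled_order_def holds_def)

lemma strictly_sorted_distinct:
  assumes "irrefl L" "sorted_wrt (\<lambda>a b. (a, b) \<in> L) ys"
  shows "distinct ys"
  using assms(2) by (induction ys) (use assms(1) in \<open>auto simp: irrefl_def\<close>)

text \<open>Facts list distinct elements and include a whole core. Hence a finite set carries facts
  for small \<open>h\<close> only, although infinitely many configurations are forbidden.\<close>

lemma labelled_order_fact_bounds:
  assumes "labelled_order X L T" "finite X" "(h, A, ys) \<in> T"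
  shows "core_size h \<le> card X" "length ys \<le> card X"
proof -
  note D = labelled_orderD[OF assms(1)]
  have "distinct ys" using strictly_sorted_distinct[OF D(2)] D(9)[OF assms(3)] by blast
  then have "length ys = card (set ys)" by (simp add: distinct_card)
  also have "\<dots> \<le> card X" using D(8)[OF assms(3)] assms(2) by (intro card_mono)
  finally show l: "length ys \<le> card X" .
  show "core_size h \<le> card X"
    using core_size_le_card_positions[of h A] D(7)[OF assms(3)] l by simp
qed

lemma labelled_order_fact_nonempty:
  assumes "labelled_order X L T" "(h, A, ys) \<in> T"
  shows "ys \<noteq> []"
proof -
  have "0 < core_size h" by (simp add: core_size_def)
  then show ?thesis
    using core_size_le_card_positions[of h A] labelled_orderD(7)[OF assms] by auto
qed

lemma less_core_size: "h < core_size h"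
proof -
  have "h < 2 ^ h" by (rule less_exp)
  also have "\<dots> \<le> 16 ^ h" by (intro power_mono) auto
  also have "\<dots> \<le> core_size h" by (simp add: core_size_def)
  finally show ?thesis .
qed

lemma labelled_order_finite:
  assumes "labelled_order X L T" "finite X"
  shows "finite T"
proof (rule finite_subset)
  show "T \<subseteq> {..card X} \<times> Pow {..card X} \<times> {ys. set ys \<subseteq> X \<and> length ys \<le> card X}"
  proof
    fix x assume "x \<in> T"
    then obtain h A ys where x: "x = (h, A, ys)" and y: "(h, A, ys) \<in> T" by (cases x) auto
    have "h < card X" using labelled_order_fact_bounds(1)[OF assms y] less_core_size[of h] by simp
    then show "x \<in> {..card X} \<times> Pow {..card X} \<times> {ys. set ys \<subseteq> X \<and> length ys \<le> card X}"
      using labelled_orderD(6,8)[OF assms(1) y] labelled_order_fact_bounds(2)[OF assms y] x by auto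
  qed
  show "finite ({..card X} \<times> Pow {..card X} \<times> {ys. set ys \<subseteq> X \<and> length ys \<le> card X})"
    using assms(2) by (intro finite_cartesian_product finite_lists_length_le) auto
qed

section \<open>Stagewise construction of the generic order\<close>

definition extension_tasks :: "(nat set \<times> nat \<times> (nat \<times> nat) set \<times> nat fact set) set" where
  "extension_tasks = {(Y, p, L', T'). finite Y \<and> p \<notin> Y \<and> labelled_order (insert p Y) L' T'}"

lemma countable_extension_tasks: "countable extension_tasks"
proof (rule countable_subset)
  let ?F = "{(h, A, ys) :: nat fact | h A ys. finite A}"
  have "?F \<subseteq> UNIV \<times> Collect finite \<times> UNIV" by auto
  then have F: "countable ?F"
    by (rule countable_subset) (intro countable_SIGMA countable_Collect_finite countableI_type)
  show "extension_tasks \<subseteq> Collect finite \<times> UNIV \<times> Collect finite \<times> {T. T \<subseteq> ?F \<and> finite T}"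
  proof
    fix x assume "x \<in> extension_tasks"
    then obtain Y p L' T' where x: "x = (Y, p, L', T')" and Y: "finite (insert p Y)"
      and o: "labelled_order (insert p Y) L' T'"
      by (auto simp: extension_tasks_def)
    have "finite L'"
      using labelled_orderD(1)[OF o] Y by (rule finite_subset[OF _ finite_cartesian_product]) (rule Y)
    moreover have "finite A" if "(h, A, ys) \<in> T'" for h A ys
      using labelled_orderD(6)[OF o that] finite_subset[of A "{..<h}"] by auto
    ultimately show "x \<in> Collect finite \<times> UNIV \<times> Collect finite \<times> {T. T \<subseteq> ?F \<and> finite T}"
      using labelled_order_finite[OF o Y] Y by (auto simp: x)
  qed
  show "countable (Collect finite \<times> (UNIV :: nat set) \<times> Collect finite \<times> {T. T \<subseteq> ?F \<and> finite T} ::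
      (nat set \<times> nat \<times> (nat \<times> nat) set \<times> nat fact set) set)"
    using F countable_Collect_finite_subset[OF F]
    by (intro countable_SIGMA countable_Collect_finite countableI_type) (simp add: conj_commute)
qed

lemma image_fact_iff:
  assumes "inj_on g X" "labelled_order X L T" "set ys \<subseteq> X"
  shows "(h, A, map g ys) \<in> (\<lambda>(h, A, ys). (h, A, map g ys)) ` T \<longleftrightarrow> (h, A, ys) \<in> T"
proof
  assume "(h, A, map g ys) \<in> (\<lambda>(h, A, ys). (h, A, map g ys)) ` T"
  then obtain zs where z: "(h, A, zs) \<in> T" "map g ys = map g zs" by auto
  then have "ys = zs"
    using labelled_orderD(8)[OF assms(2) z(1)] assms(3) inj_on_subset[OF assms(1)] by (metis inj_on_map_eq_map Un_least)
  then show "(h, A, ys) \<in> T" using z by simp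
qed force

lemma image_pair_iff:
  assumes "inj_on g X" "L \<subseteq> X \<times> X" "a \<in> X" "b \<in> X"
  shows "(g a, g b) \<in> (\<lambda>(a, b). (g a, g b)) ` L \<longleftrightarrow> (a, b) \<in> L"
proof
  assume "(g a, g b) \<in> (\<lambda>(a, b). (g a, g b)) ` L"
  then obtain a' b' where "(a', b') \<in> L" "g a = g a'" "g b = g b'" by auto
  then show "(a, b) \<in> L" using assms inj_onD[OF assms(1), of a a'] inj_onD[OF assms(1), of b b'] by auto
qed force

lemma extension_step:
  assumes o: "labelled_order {..<n} L T"
    and task: "(Y, p, L', T') \<in> extension_tasks" and Y: "Y \<subseteq> {..<n}"
    and LL: "L \<inter> Y \<times> Y = L' \<inter> Y \<times> Y"
    and TT: "\<forall>h A ys. set ys \<subseteq> Y \<longrightarrow> ((h, A, ys) \<in> T \<longleftrightarrow> (h, A, ys) \<in> T')"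
  shows "\<exists>L2 T2. labelled_order {..<Suc n} L2 T2 \<and> L2 \<inter> {..<n} \<times> {..<n} = L \<and>
      (\<forall>h A ys. set ys \<subseteq> {..<n} \<longrightarrow> ((h, A, ys) \<in> T2 \<longleftrightarrow> (h, A, ys) \<in> T)) \<and>
      (\<forall>a\<in>Y. ((a, n) \<in> L2 \<longleftrightarrow> (a, p) \<in> L') \<and> ((n, a) \<in> L2 \<longleftrightarrow> (p, a) \<in> L')) \<and>
      (\<forall>h A ys. set ys \<subseteq> insert p Y \<longrightarrow> ((h, A, map (id(p := n)) ys) \<in> T2 \<longleftrightarrow> (h, A, ys) \<in> T'))"
proof -
  \<comment> \<open>The placeholder \<open>p\<close> may already be a point of
    \<open>{..<n}\<close>, so it is renamed to the fresh point \<open>n\<close> before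
    amalgamating.\<close>
  define g where "g = id(p := n)"
  have t: "p \<notin> Y" "labelled_order (insert p Y) L' T'" using task by (auto simp: extension_tasks_def)
  have n: "n \<notin> Y" using Y by auto
  have inj: "inj_on g (insert p Y)" using t(1) n by (auto simp: inj_on_def g_def)
  have gY: "a \<in> Y \<Longrightarrow> g a = a" for a using t(1) by (auto simp: g_def)
  have gp: "g p = n" by (simp add: g_def)
  let ?L = "(\<lambda>(a, b). (g a, g b)) ` L'" and ?T = "(\<lambda>(h, A, ys). (h, A, map g ys)) ` T'"
  have "g ` insert p Y = insert n Y" using gY gp by force
  then have oI: "labelled_order (insert n Y) ?L ?T"
    using labelled_order_image[OF t(2) inj] by simp
  note pair = image_pair_iff[OF inj labelled_orderD(1)[OF t(2)]]
  note fact = image_fact_iff[OF inj t(2)]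
  have LI: "L \<inter> Y \<times> Y = ?L \<inter> Y \<times> Y"
  proof -
    have "(a, b) \<in> L \<longleftrightarrow> (a, b) \<in> ?L" if "a \<in> Y" "b \<in> Y" for a b
    proof -
      have "(a, b) \<in> ?L \<longleftrightarrow> (a, b) \<in> L'" using pair[of a b] that by (simp add: gY)
      then show ?thesis using LL that by blast
    qed
    then show ?thesis by (intro equalityI subrelI) (metis IntD1 IntD2 IntI mem_Sigma_iff)+
  qed
  have TI: "(h, A, ys) \<in> T \<longleftrightarrow> (h, A, ys) \<in> ?T" if "set ys \<subseteq> Y" for h A ys
  proof -
    have "map g ys = ys" using that gY by (intro map_idI) auto
    then show ?thesis using fact[of ys, where h = h and A = A] that TT[rule_format, OF that, of h A] by (simp add: subset_insertI2)
  qed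
  obtain L2 T2 where r: "labelled_order (insert n {..<n}) L2 T2"
    "L2 \<inter> {..<n} \<times> {..<n} = L" "\<And>h A ys. set ys \<subseteq> {..<n} \<Longrightarrow> (h, A, ys) \<in> T2 \<longleftrightarrow> (h, A, ys) \<in> T"
    "L2 \<inter> insert n Y \<times> insert n Y = ?L"
    "\<And>h A ys. set ys \<subseteq> insert n Y \<Longrightarrow> (h, A, ys) \<in> T2 \<longleftrightarrow> (h, A, ys) \<in> ?T"
    using one_point_amalgamation[OF o oI Y _ LI TI] by auto
  have "((a, n) \<in> L2 \<longleftrightarrow> (a, p) \<in> L') \<and> ((n, a) \<in> L2 \<longleftrightarrow> (p, a) \<in> L')" if "a \<in> Y" for a
  proof -
    have "(a, n) \<in> L2 \<longleftrightarrow> (a, n) \<in> ?L" "(n, a) \<in> L2 \<longleftrightarrow> (n, a) \<in> ?L" using r(4) that by blast+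
    then show ?thesis using pair[of a p] pair[of p a] that gY gp by simp
  qed
  moreover have "(h, A, map g ys) \<in> T2 \<longleftrightarrow> (h, A, ys) \<in> T'" if "set ys \<subseteq> insert p Y" for h A ys
  proof -
    have "set (map g ys) \<subseteq> insert n Y" using that gY gp by auto
    then show ?thesis using r(5) fact[OF that] by simp
  qed
  ultimately show ?thesis
    using r(1-3) unfolding g_def lessThan_Suc by (intro exI[of _ L2] exI[of _ T2]) blast
qed

text \<open>Position sets are finite, so every instance of a clause of \<open>labelled_order\<close>
  concerns finitely many points and can be checked at a single stage.\<close>

lemma labelled_order_limit:
  fixes L :: "nat \<Rightarrow> (nat \<times> nat) set" and T :: "nat \<Rightarrow> nat fact set"
  assumes o: "\<And>n. labelled_order {..<n} (L n) (T n)"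
    and L: "\<And>n. L (Suc n) \<inter> {..<n} \<times> {..<n} = L n"
    and T: "\<And>n h A ys. set ys \<subseteq> {..<n} \<Longrightarrow> (h, A, ys) \<in> T (Suc n) \<longleftrightarrow> (h, A, ys) \<in> T n"
  shows "labelled_order UNIV (\<Union>n. L n) (\<Union>n. T n)"
    and "a < n \<Longrightarrow> b < n \<Longrightarrow> (a, b) \<in> (\<Union>n. L n) \<longleftrightarrow> (a, b) \<in> L n"
    and "set ys \<subseteq> {..<n} \<Longrightarrow> (h, A, ys) \<in> (\<Union>n. T n) \<longleftrightarrow> (h, A, ys) \<in> T n"
proof -
  let ?L = "\<Union>n. L n" and ?T = "\<Union>n. T n"
  note D = labelled_orderD[OF o]
  have L1: "(a, b) \<in> L m \<longleftrightarrow> (a, b) \<in> L n" if "n \<le> m" "a < n" "b < n" for a b n m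
    using that(1)
  proof (induction m rule: dec_induct)
    case (step m)
    then have "(a, b) \<in> L (Suc m) \<longleftrightarrow> (a, b) \<in> L m" using L[of m] that(2,3) by fastforce
    then show ?case using step by simp
  qed simp
  have T1: "(h, A, ys) \<in> T m \<longleftrightarrow> (h, A, ys) \<in> T n" if "n \<le> m" "set ys \<subseteq> {..<n}" for h A ys n m
    using that(1)
  proof (induction m rule: dec_induct)
    case (step m)
    then have "set ys \<subseteq> {..<m}" using that(2) by force
    then show ?case using T[of ys m] step by simp
  qed simp
  show L2: "(a, b) \<in> ?L \<longleftrightarrow> (a, b) \<in> L n" if "a < n" "b < n" for a b n
  proof
    assume "(a, b) \<in> ?L"
    then obtain m where m: "(a, b) \<in> L m" by blast
    then have "a < m" "b < m" using D(1)[of m] by auto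
    then show "(a, b) \<in> L n" using m L1[of m n a b] L1[of n m a b] that by (cases "m \<le> n") auto
  qed blast
  show T2: "(h, A, ys) \<in> ?T \<longleftrightarrow> (h, A, ys) \<in> T n" if "set ys \<subseteq> {..<n}" for h A ys n
  proof
    assume "(h, A, ys) \<in> ?T"
    then obtain m where m: "(h, A, ys) \<in> T m" by blast
    then have "set ys \<subseteq> {..<m}" using D(8) by blast
    then show "(h, A, ys) \<in> T n" using m T1[of m n ys] T1[of n m ys] that by (cases "m \<le> n") auto
  qed blast
  have fin: "\<exists>n. F \<subseteq> {..<n}" if "finite F" for F :: "nat set"
    using that finite_nat_set_iff_bounded by auto
  have hn: "\<exists>n. \<forall>p\<in>positions h A. \<psi> p < n" for h A and \<psi> :: "nat \<Rightarrow> nat"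
    using fin[of "\<psi> ` positions h A"] by auto
  have hT: "holds ?T h A \<psi> \<longleftrightarrow> holds (T n) h A \<psi>" if "\<forall>p\<in>positions h A. \<psi> p < n" for h A \<psi> n
    unfolding holds_def using T2[of "map \<psi> (position_list h A)" n] that by auto
  show "labelled_order UNIV ?L ?T"
  proof (rule labelled_orderI)
    show "irrefl ?L" using D(2) by (auto simp: irrefl_def)
    show "trans ?L"
    proof (rule transI)
      fix a b c assume a: "(a, b) \<in> ?L" "(b, c) \<in> ?L"
      obtain n where n: "{a, b, c} \<subseteq> {..<n}" using fin[of "{a, b, c}"] by auto
      then have "(a, b) \<in> L n" "(b, c) \<in> L n" using a L2[of _ n] by auto
      then show "(a, c) \<in> ?L" using transD[OF D(3)] by blast
    qed
    show "total_on UNIV ?L"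
    proof (rule total_onI)
      fix a b :: nat assume "a \<noteq> b"
      moreover obtain n where n: "{a, b} \<subseteq> {..<n}" using fin[of "{a, b}"] by auto
      ultimately have "(a, b) \<in> L n \<or> (b, a) \<in> L n" using D(4)[of n] by (auto simp: total_on_def)
      then show "(a, b) \<in> ?L \<or> (b, a) \<in> ?L" by blast
    qed
    show "length ys = card (positions h A)" if "(h, A, ys) \<in> ?T" for h A ys using that D(7) by auto
  next
    fix h A \<psi> assume a: "holds ?T h A \<psi>"
    obtain n where n: "\<forall>p\<in>positions h A. \<psi> p < n" using hn by blast
    note h = labelled_order_holdsD[OF o a[unfolded hT[OF n]]]
    show "A \<noteq> {} \<and> A \<subset> {..<h}" using h by simp
    show "(\<psi> p, \<psi> q) \<in> ?L" if "p \<in> positions h A" "q \<in> positions h A" "p < q" for p q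
      using h(4)[OF that] by blast
  next
    fix h A B \<psi> assume a: "A \<inter> B = {}" "holds ?T h A \<psi>" "holds ?T h B \<psi>"
    obtain n where n: "\<psi> ` (positions h A \<union> positions h B) \<subseteq> {..<n}"
      using fin[of "\<psi> ` (positions h A \<union> positions h B)"] by auto
    then have n': "\<forall>p\<in>positions h A. \<psi> p < n" "\<forall>p\<in>positions h B. \<psi> p < n" "\<forall>p\<in>positions h (A \<union> B). \<psi> p < n"
      using positions_Un[of h A B] by auto
    show "holds ?T h (A \<union> B) \<psi>"
      using D(10)[OF a(1)] a(2,3) unfolding hT[OF n'(1)] hT[OF n'(2)] hT[OF n'(3)] by blast
  qed auto
qed

lemma ex_generic_labelled_order:
  obtains L :: "(nat \<times> nat) set" and T where "labelled_order UNIV L T" "extension_property L T"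
proof -
  have ne: "({}, 0, {}, {}) \<in> extension_tasks"
    using labelled_order_singleton by (auto simp: extension_tasks_def)
  \<comment> \<open>Decoding pairs makes each task appear at arbitrarily late stages, in particular
    after all points of its base \<open>Y\<close> exist.\<close>
  define task where "task n = from_nat_into extension_tasks (fst (prod_decode n))" for n
  have task: "task n \<in> extension_tasks" for n
    unfolding task_def using ne by (intro from_nat_into) auto
  define compat where "compat n L T t \<longleftrightarrow> (case t of (Y, p, L', T') \<Rightarrow> Y \<subseteq> {..<n} \<and> L \<inter> Y \<times> Y = L' \<inter> Y \<times> Y \<and>
      (\<forall>h A ys. set ys \<subseteq> Y \<longrightarrow> ((h, A, ys) \<in> T \<longleftrightarrow> (h, A, ys) \<in> T')))"
    for n and L :: "(nat \<times> nat) set" and T :: "nat fact set" and t :: "nat set \<times> nat \<times> (nat \<times> nat) set \<times> nat fact set"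
  define realised where "realised n L2 T2 t \<longleftrightarrow> (case t of (Y, p, L', T') \<Rightarrow>
      (\<forall>a\<in>Y. ((a, n) \<in> L2 \<longleftrightarrow> (a, p) \<in> L') \<and> ((n, a) \<in> L2 \<longleftrightarrow> (p, a) \<in> L')) \<and>
      (\<forall>h A ys. set ys \<subseteq> insert p Y \<longrightarrow> ((h, A, map (id(p := n)) ys) \<in> T2 \<longleftrightarrow> (h, A, ys) \<in> T')))"
    for n and L2 :: "(nat \<times> nat) set" and T2 :: "nat fact set" and t :: "nat set \<times> nat \<times> (nat \<times> nat) set \<times> nat fact set"
  define P where "P n s \<longleftrightarrow> labelled_order {..<n} (fst s) (snd s)"
    for n :: nat and s :: "(nat \<times> nat) set \<times> nat fact set"
  define Q where "Q n s s' \<longleftrightarrow> fst s' \<inter> {..<n} \<times> {..<n} = fst s \<and>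
      (\<forall>h A ys. set ys \<subseteq> {..<n} \<longrightarrow> ((h, A, ys) \<in> snd s' \<longleftrightarrow> (h, A, ys) \<in> snd s)) \<and>
      (compat n (fst s) (snd s) (task n) \<longrightarrow> realised n (fst s') (snd s') (task n))"
    for n :: nat and s s' :: "(nat \<times> nat) set \<times> nat fact set"
  have step: "\<exists>s'. P (Suc n) s' \<and> Q n s s'" if s: "P n s" for n s
  proof -
    \<comment> \<open>If the scheduled task does not fit the current stage, a point is added over
      the empty base instead, so that stage \<open>n\<close> always creates the point
      \<open>n\<close>.\<close>
    obtain t where t: "t \<in> extension_tasks" "compat n (fst s) (snd s) t"
      "compat n (fst s) (snd s) (task n) \<longrightarrow> t = task n"
    proof (cases "compat n (fst s) (snd s) (task n)")
      case False
      have "compat n (fst s) (snd s) ({}, 0, {}, {})"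
        using labelled_order_fact_nonempty[OF s[unfolded P_def]] by (auto simp: compat_def)
      then show ?thesis using that False ne by blast
    qed (use that task in blast)
    obtain Y p L' T' where tt: "t = (Y, p, L', T')" by (cases t)
    obtain L2 T2 where "labelled_order {..<Suc n} L2 T2" "L2 \<inter> {..<n} \<times> {..<n} = fst s"
      "\<forall>h A ys. set ys \<subseteq> {..<n} \<longrightarrow> ((h, A, ys) \<in> T2 \<longleftrightarrow> (h, A, ys) \<in> snd s)" "realised n L2 T2 t"
      using extension_step[of n "fst s" "snd s" Y p L' T'] s t(1,2) unfolding tt compat_def realised_def P_def by auto
    then show ?thesis unfolding P_def Q_def using t(3) by (intro exI[of _ "(L2, T2)"]) auto
  qed
  have "P 0 ({}, {})" using labelled_order_empty by (simp add: P_def)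
  then obtain s where s: "\<And>n. P n (s n)" "\<And>n. Q n (s n) (s (Suc n))"
    using dependent_nat_choice[of P Q, OF _ step] by blast
  let ?L = "\<Union>n. fst (s n)" and ?T = "\<Union>n. snd (s n)"
  note lim = labelled_order_limit[of "\<lambda>n. fst (s n)" "\<lambda>n. snd (s n)", OF s(1)[unfolded P_def]]
  have Q: "fst (s (Suc n)) \<inter> {..<n} \<times> {..<n} = fst (s n)"
    "set ys \<subseteq> {..<n} \<Longrightarrow> (h, A, ys) \<in> snd (s (Suc n)) \<longleftrightarrow> (h, A, ys) \<in> snd (s n)"
    "compat n (fst (s n)) (snd (s n)) (task n) \<Longrightarrow> realised n (fst (s (Suc n))) (snd (s (Suc n))) (task n)" for n ys h A
    using s(2)[of n] unfolding Q_def by blast+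
  note lim = lim[OF Q(1,2)]
  have "extension_property ?L ?T"
    unfolding extension_property_def
  proof (intro allI impI)
    fix Y p L' T'
    assume Y: "finite Y" "p \<notin> Y" "labelled_order (insert p Y) L' T'" "?L \<inter> Y \<times> Y = L' \<inter> Y \<times> Y"
      "\<forall>h A ys. set ys \<subseteq> Y \<longrightarrow> ((h, A, ys) \<in> ?T \<longleftrightarrow> (h, A, ys) \<in> T')"
    let ?t = "(Y, p, L', T')"
    have "?t \<in> extension_tasks" using Y by (simp add: extension_tasks_def)
    then obtain i where i: "from_nat_into extension_tasks i = ?t"
      using from_nat_into_surj[OF countable_extension_tasks] by blast
    obtain m where m: "Y \<subseteq> {..<m}" using Y(1) finite_nat_set_iff_bounded by auto
    define n where "n = prod_encode (i, m)"
    have "m \<le> n" unfolding n_def by (rule le_prod_encode_2)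
    then have Yn: "Y \<subseteq> {..<n}" using m by force
    have tn: "task n = ?t" by (simp add: task_def n_def i)
    have "fst (s n) \<inter> Y \<times> Y = L' \<inter> Y \<times> Y" using Y(4) lim(2)[of _ n] Yn by blast
    moreover have "(h, A, ys) \<in> snd (s n) \<longleftrightarrow> (h, A, ys) \<in> T'" if "set ys \<subseteq> Y" for h A ys
      using Y(5) that lim(3)[of ys n h A] Yn by blast
    ultimately have "compat n (fst (s n)) (snd (s n)) (task n)" using Yn by (auto simp: compat_def tn)
    note r = Q(3)[OF this, unfolded tn realised_def prod.case]
    show "\<exists>d. d \<notin> Y \<and> (\<forall>a\<in>Y. ((a, d) \<in> ?L \<longleftrightarrow> (a, p) \<in> L') \<and> ((d, a) \<in> ?L \<longleftrightarrow> (p, a) \<in> L')) \<and>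
       (\<forall>h A ys. set ys \<subseteq> insert p Y \<longrightarrow> ((h, A, map (id(p := d)) ys) \<in> ?T \<longleftrightarrow> (h, A, ys) \<in> T'))"
    proof (intro exI[of _ n] conjI)
      show "n \<notin> Y" using Yn by auto
      show "\<forall>a\<in>Y. ((a, n) \<in> ?L \<longleftrightarrow> (a, p) \<in> L') \<and> ((n, a) \<in> ?L \<longleftrightarrow> (p, a) \<in> L')"
      proof
        fix a assume a: "a \<in> Y"
        then have "a < Suc n" using Yn by auto
        then show "((a, n) \<in> ?L \<longleftrightarrow> (a, p) \<in> L') \<and> ((n, a) \<in> ?L \<longleftrightarrow> (p, a) \<in> L')"
          using r a lim(2)[of a "Suc n" n] lim(2)[of n "Suc n" a] by simp
      qed
      show "\<forall>h A ys. set ys \<subseteq> insert p Y \<longrightarrow> ((h, A, map (id(p := n)) ys) \<in> ?T \<longleftrightarrow> (h, A, ys) \<in> T')"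
      proof (intro allI impI)
        fix h A ys assume ys: "set ys \<subseteq> insert p Y"
        then have "set (map (id(p := n)) ys) \<subseteq> {..<Suc n}" using Yn by auto
        then show "(h, A, map (id(p := n)) ys) \<in> ?T \<longleftrightarrow> (h, A, ys) \<in> T'"
          using r ys lim(3)[of "map (id(p := n)) ys" "Suc n" h A] by simp
      qed
    qed
  qed
  then show ?thesis using that lim(1) by blast
qed

section \<open>Universality and homogeneity\<close>

text \<open>Partial isomorphism: sending \<open>\<alpha> i\<close> to \<open>\<beta> i\<close> is
  well defined and injective and respects order and facts in both directions. Sequences, possibly
  with repetitions, are easy to prolong in back-and-forth arguments.\<close>

definition same_type :: "nat \<Rightarrow> ('a \<times> 'a) set \<Rightarrow> 'a fact set \<Rightarrow> (nat \<Rightarrow> 'a) \<Rightarrow>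
    ('b \<times> 'b) set \<Rightarrow> 'b fact set \<Rightarrow> (nat \<Rightarrow> 'b) \<Rightarrow> bool" where
  "same_type n L T \<alpha> L' T' \<beta> \<longleftrightarrow>
     (\<forall>i<n. \<forall>j<n. \<alpha> i = \<alpha> j \<longleftrightarrow> \<beta> i = \<beta> j) \<and>
     (\<forall>i<n. \<forall>j<n. (\<alpha> i, \<alpha> j) \<in> L \<longleftrightarrow> (\<beta> i, \<beta> j) \<in> L') \<and>
     (\<forall>h A is. set is \<subseteq> {..<n} \<longrightarrow> ((h, A, map \<alpha> is) \<in> T \<longleftrightarrow> (h, A, map \<beta> is) \<in> T'))"

lemma same_typeD:
  assumes "same_type n L T \<alpha> L' T' \<beta>"
  shows "i < n \<Longrightarrow> j < n \<Longrightarrow> \<alpha> i = \<alpha> j \<longleftrightarrow> \<beta> i = \<beta> j"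
    and "i < n \<Longrightarrow> j < n \<Longrightarrow> (\<alpha> i, \<alpha> j) \<in> L \<longleftrightarrow> (\<beta> i, \<beta> j) \<in> L'"
    and "set is \<subseteq> {..<n} \<Longrightarrow> (h, A, map \<alpha> is) \<in> T \<longleftrightarrow> (h, A, map \<beta> is) \<in> T'"
  using assms by (auto simp: same_type_def)

lemma same_type_sym: "same_type n L T \<alpha> L' T' \<beta> \<Longrightarrow> same_type n L' T' \<beta> L T \<alpha>"
  by (auto simp: same_type_def)

lemma same_type_reindex:
  assumes "same_type n L T \<alpha> L' T' \<beta>"
    and "\<And>i. i < m \<Longrightarrow> r i < n" "\<And>i. i < m \<Longrightarrow> \<alpha>' i = \<alpha> (r i)" "\<And>i. i < m \<Longrightarrow> \<beta>' i = \<beta> (r i)"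
  shows "same_type m L T \<alpha>' L' T' \<beta>'"
proof -
  have "(h, A, map \<alpha>' is) \<in> T \<longleftrightarrow> (h, A, map \<beta>' is) \<in> T'" if "set is \<subseteq> {..<m}" for h A "is"
  proof -
    have "map \<alpha>' is = map \<alpha> (map r is)" "map \<beta>' is = map \<beta> (map r is)"
      using that assms(3,4) by auto
    moreover have "set (map r is) \<subseteq> {..<n}" using that assms(2) by auto
    ultimately show ?thesis using same_typeD(3)[OF assms(1)] by metis
  qed
  then show ?thesis using assms same_typeD(1,2)[OF assms(1)] by (simp add: same_type_def)
qed

lemma pointwise_limit:
  fixes s :: "nat \<Rightarrow> nat \<Rightarrow> 'a" and m :: "nat \<Rightarrow> nat"
  assumes "\<And>n i. i < m n \<Longrightarrow> s (Suc n) i = s n i" "mono m" "\<And>i. \<exists>n. i < m n"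
  obtains t where "\<And>n i. i < m n \<Longrightarrow> t i = s n i"
proof -
  have eq: "s n i = s n' i" if "i < m n" "n \<le> n'" for n n' i
    using that(2)
  proof (induction n' rule: dec_induct)
    case (step k)
    have "m n \<le> m k" using step monoD[OF assms(2)] by simp
    then show ?case using assms(1)[of i k] that(1) step by simp
  qed simp
  show ?thesis
  proof (rule that[of "\<lambda>i. s (LEAST n. i < m n) i"])
    fix n i assume i: "i < m n"
    then show "s (LEAST n. i < m n) i = s n i"
      using LeastI[of "\<lambda>n. i < m n", OF i] Least_le[of "\<lambda>n. i < m n", OF i] by (intro eq)
  qed
qed

locale generic_order =
  fixes L :: "(nat \<times> nat) set" and T :: "nat fact set"
  assumes order: "labelled_order UNIV L T" and ext: "extension_property L T"
begin

text \<open>One step of back-and-forth. The source is an arbitrary labelled order and only the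
  target is generic, so the step serves both universality and homogeneity.\<close>

lemma forth:
  fixes \<alpha> :: "nat \<Rightarrow> 'b"
  assumes o: "labelled_order X L' T'" and st: "same_type n L' T' \<alpha> L T \<beta>"
    and \<alpha>: "\<alpha> ` {..<n} \<subseteq> X" and b: "b \<in> X"
  obtains d where "same_type (Suc n) L' T' (\<alpha>(n := b)) L T (\<beta>(n := d))"
proof (cases "b \<in> \<alpha> ` {..<n}")
  case True
  then obtain i where i: "i < n" "b = \<alpha> i" by auto
  show ?thesis
    by (rule that[of "\<beta> i"], rule same_type_reindex[OF st, where r = "\<lambda>k. if k = n then i else k"])
      (use i in auto)
next
  case False
  define Y where "Y = \<beta> ` {..<n}"
  define X' where "X' = insert b (\<alpha> ` {..<n})"
  define \<alpha>' where "\<alpha>' = \<alpha>(n := b)"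
  obtain p where p: "p \<notin> Y" using ex_new_if_finite[of Y] by (auto simp: Y_def)
  define \<beta>' where "\<beta>' = \<beta>(n := p)"
  \<comment> \<open>\<open>g\<close> sends \<open>\<alpha>' i\<close> to \<open>\<beta>' i\<close>,
    whatever index is chosen for the point. It copies the extension by \<open>b\<close> onto
    \<open>insert p Y\<close>, where the extension property applies.\<close>
  define g where "g x = \<beta>' (SOME i. i < Suc n \<and> \<alpha>' i = x)" for x
  have eq: "\<alpha>' i = \<alpha>' j \<longleftrightarrow> \<beta>' i = \<beta>' j" if "i < Suc n" "j < Suc n" for i j
    using that same_typeD(1)[OF st, of i j] False p by (auto simp: \<alpha>'_def \<beta>'_def Y_def less_Suc_eq)
  have g: "g (\<alpha>' i) = \<beta>' i" if "i < Suc n" for i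
  proof -
    have "(SOME j. j < Suc n \<and> \<alpha>' j = \<alpha>' i) < Suc n \<and> \<alpha>' (SOME j. j < Suc n \<and> \<alpha>' j = \<alpha>' i) = \<alpha>' i"
      by (rule someI[of _ i]) (use that in simp)
    then show ?thesis unfolding g_def using eq that by blast
  qed
  have X': "X' = \<alpha>' ` {..<Suc n}" by (auto simp: X'_def \<alpha>'_def lessThan_Suc)
  have inj: "inj_on g X'" unfolding X' inj_on_def by (auto simp: g eq)
  have "X' \<subseteq> X" using \<alpha> b by (auto simp: X'_def)
  note o' = labelled_order_restrict[OF o this]
  let ?L = "L' \<inter> X' \<times> X'" and ?T = "{(h, A, ys) \<in> T'. set ys \<subseteq> X'}"
  let ?LI = "(\<lambda>(a, b). (g a, g b)) ` ?L" and ?TI = "(\<lambda>(h, A, ys). (h, A, map g ys)) ` ?T"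
  have gX: "g ` X' = insert p Y"
    unfolding X' image_image using g by (auto simp: \<beta>'_def Y_def lessThan_Suc image_iff)
  have oI: "labelled_order (insert p Y) ?LI ?TI"
    using labelled_order_image[OF o' inj] unfolding gX .
  have LI: "(\<beta>' i, \<beta>' j) \<in> ?LI \<longleftrightarrow> (\<alpha>' i, \<alpha>' j) \<in> L'" if "i < Suc n" "j < Suc n" for i j
    using image_pair_iff[OF inj, of ?L "\<alpha>' i" "\<alpha>' j"] that g X' by auto
  have TI: "(h, A, map \<beta>' is) \<in> ?TI \<longleftrightarrow> (h, A, map \<alpha>' is) \<in> T'" if "set is \<subseteq> {..<Suc n}" for h A "is"
  proof -
    have "set (map \<alpha>' is) \<subseteq> X'" using that X' by auto
    moreover have "map \<beta>' is = map g (map \<alpha>' is)" using that g by auto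
    ultimately show ?thesis using image_fact_iff[OF inj o', of "map \<alpha>' is" h A] by (simp del: map_map)
  qed
  have \<alpha>n: "\<alpha>' i = \<alpha> i" "\<beta>' i = \<beta> i" if "i < n" for i using that by (auto simp: \<alpha>'_def \<beta>'_def)
  have LY: "L \<inter> Y \<times> Y = ?LI \<inter> Y \<times> Y"
  proof -
    have "(a, b) \<in> L \<longleftrightarrow> (a, b) \<in> ?LI" if ab: "a \<in> Y" "b \<in> Y" for a b
    proof -
      obtain i j where "i < n" "j < n" "a = \<beta> i" "b = \<beta> j" using ab by (auto simp: Y_def)
      then show ?thesis using LI[of i j] same_typeD(2)[OF st, of i j] \<alpha>n by simp
    qed
    then show ?thesis by (intro equalityI subrelI) (metis IntD1 IntD2 IntI mem_Sigma_iff)+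
  qed
  have TY: "(h, A, ys) \<in> T \<longleftrightarrow> (h, A, ys) \<in> ?TI" if "set ys \<subseteq> Y" for h A ys
  proof -
    have "ys \<in> lists (\<beta> ` {..<n})" using that by (auto simp: Y_def)
    then obtain "is" where "is": "set is \<subseteq> {..<n}" "ys = map \<beta> is" unfolding lists_image by auto
    have e: "map \<beta>' is = map \<beta> is" "map \<alpha>' is = map \<alpha> is" using "is"(1) \<alpha>n by auto
    have "set is \<subseteq> {..<Suc n}" using "is"(1) by auto
    note TI[OF this, of h A, unfolded e]
    then show ?thesis unfolding "is"(2) using same_typeD(3)[OF st "is"(1), of h A] by (simp only:)
  qed
  have "finite Y" by (simp add: Y_def)
  note step = ext[unfolded extension_property_def, THEN spec[of _ Y], THEN spec[of _ p], THEN spec[of _ ?LI],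
      THEN spec[of _ ?TI], THEN mp, OF this, THEN mp, OF p, THEN mp, OF oI, THEN mp, OF LY, THEN mp]
  have "\<forall>h A ys. set ys \<subseteq> Y \<longrightarrow> ((h, A, ys) \<in> T \<longleftrightarrow> (h, A, ys) \<in> ?TI)"
    using TY by (intro allI impI)
  from step[OF this] obtain d where d: "d \<notin> Y"
    "\<forall>a\<in>Y. ((a, d) \<in> L \<longleftrightarrow> (a, p) \<in> ?LI) \<and> ((d, a) \<in> L \<longleftrightarrow> (p, a) \<in> ?LI)"
    "\<forall>h A ys. set ys \<subseteq> insert p Y \<longrightarrow> ((h, A, map (id(p := d)) ys) \<in> T \<longleftrightarrow> (h, A, ys) \<in> ?TI)"
    by (elim exE conjE)
  note d = d(1) d(2)[rule_format] d(3)[rule_format]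
  define \<gamma> where "\<gamma> = \<beta>(n := d)"
  have \<gamma>: "(id(p := d)) (\<beta>' i) = \<gamma> i" if "i < Suc n" for i
    using that p by (auto simp: \<gamma>_def \<beta>'_def Y_def less_Suc_eq)
  have \<gamma>n: "\<gamma> n = d" "\<beta>' n = p" "i < n \<Longrightarrow> \<gamma> i = \<beta> i" for i by (auto simp: \<gamma>_def \<beta>'_def)
  have Yi: "\<beta> i \<in> Y" if "i < n" for i using that by (simp add: Y_def)
  have "same_type (Suc n) L' T' \<alpha>' L T \<gamma>"
    unfolding same_type_def
  proof (intro conjI allI impI)
    fix i j assume ij: "i < Suc n" "j < Suc n"
    show "\<alpha>' i = \<alpha>' j \<longleftrightarrow> \<gamma> i = \<gamma> j"
      using ij eq[OF ij] d(1) p Yi by (auto simp: \<gamma>_def \<beta>'_def less_Suc_eq)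
    consider "i < n" "j < n" | "i < n" "j = n" | "i = n" "j < n" | "i = n" "j = n" using ij by linarith
    then show "(\<alpha>' i, \<alpha>' j) \<in> L' \<longleftrightarrow> (\<gamma> i, \<gamma> j) \<in> L"
    proof cases
      case 1
      then show ?thesis using same_typeD(2)[OF st, of i j] \<gamma>n(3) \<alpha>n by simp
    next
      case 2
      then show ?thesis using LI[OF ij] d(2)[OF Yi[of i]] \<gamma>n \<alpha>n by simp
    next
      case 3
      then show ?thesis using LI[OF ij] d(2)[OF Yi[of j]] \<gamma>n \<alpha>n by simp
    next
      case 4
      then show ?thesis
        using labelled_orderD(2)[OF o] labelled_orderD(2)[OF order] by (simp add: irrefl_def)
    qed
  next
    fix h A "is" assume "is": "set is \<subseteq> {..<Suc n}"
    have "(id(p := d)) (\<beta>' i) = \<gamma> i" if "i \<in> set is" for i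
      using that "is" by (intro \<gamma>) auto
    then have "map \<gamma> is = map (id(p := d)) (map \<beta>' is)" by (simp del: fun_upd_apply)
    moreover have "set (map \<beta>' is) \<subseteq> insert p Y" using "is" by (auto simp: \<beta>'_def Y_def less_Suc_eq subset_iff)
    ultimately show "(h, A, map \<alpha>' is) \<in> T' \<longleftrightarrow> (h, A, map \<gamma> is) \<in> T"
      using d(3)[of "map \<beta>' is" h A] TI[OF "is", of h A] by (simp only: simp_thms)
  qed
  then show ?thesis using that unfolding \<alpha>'_def \<gamma>_def by blast
qed

text \<open>Universality: \<open>forth\<close> is iterated along an enumeration of \<open>X\<close>,
  in which points recur when \<open>X\<close> is finite.\<close>

lemma embedding:
  fixes L' :: "('b \<times> 'b) set"
  assumes o: "labelled_order X L' T'" and X: "countable X" "X \<noteq> {}"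
  obtains \<phi> where "\<And>x y. x \<in> X \<Longrightarrow> y \<in> X \<Longrightarrow> (\<phi> x, \<phi> y) \<in> L \<longleftrightarrow> (x, y) \<in> L'"
    "\<And>h A ys. set ys \<subseteq> X \<Longrightarrow> (h, A, map \<phi> ys) \<in> T \<longleftrightarrow> (h, A, ys) \<in> T'"
proof -
  define \<alpha> where "\<alpha> = from_nat_into X"
  have \<alpha>: "range \<alpha> = X" unfolding \<alpha>_def using X by (intro range_from_nat_into)
  define P where "P n \<beta> \<longleftrightarrow> same_type n L' T' \<alpha> L T \<beta>" for n \<beta>
  define Q where "Q n \<beta> \<beta>' \<longleftrightarrow> (\<forall>i<n. \<beta>' i = \<beta> i)" for n :: nat and \<beta> \<beta>' :: "nat \<Rightarrow> nat"
  have step: "\<exists>\<beta>'. P (Suc n) \<beta>' \<and> Q n \<beta> \<beta>'" if P: "P n \<beta>" for n \<beta>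
  proof -
    obtain d where "same_type (Suc n) L' T' (\<alpha>(n := \<alpha> n)) L T (\<beta>(n := d))"
      using forth[OF o P[unfolded P_def], of "\<alpha> n"] \<alpha> by blast
    then show ?thesis unfolding P_def Q_def by (intro exI[of _ "\<beta>(n := d)"]) simp
  qed
  have "(h, A, []) \<notin> T'" "(h, A, []) \<notin> T" for h A
    using labelled_order_fact_nonempty[OF o] labelled_order_fact_nonempty[OF order] by blast+
  then have "P 0 undefined" by (simp add: P_def same_type_def)
  then obtain s where s: "\<And>n. P n (s n)" "\<And>n. Q n (s n) (s (Suc n))"
    using dependent_nat_choice[of P Q, OF _ step] by blast
  obtain \<beta> where \<beta>: "\<And>n i. i < n \<Longrightarrow> \<beta> i = s n i"
    using pointwise_limit[of "\<lambda>n. n" s] s(2) unfolding Q_def by (metis lessI monoI)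
  have st: "same_type n L' T' \<alpha> L T \<beta>" for n
    by (rule same_type_reindex[OF s(1)[of n, unfolded P_def], where r = id]) (use \<beta> in auto)
  define idx where "idx x = (SOME i. \<alpha> i = x)" for x
  have idx: "\<alpha> (idx x) = x" if "x \<in> X" for x
    using that \<alpha> unfolding idx_def by (metis (mono_tags) rangeE someI)
  show ?thesis
  proof (rule that[of "\<lambda>x. \<beta> (idx x)"])
    fix x y assume xy: "x \<in> X" "y \<in> X"
    then show "(\<beta> (idx x), \<beta> (idx y)) \<in> L \<longleftrightarrow> (x, y) \<in> L'"
      using same_typeD(2)[OF st[of "Suc (max (idx x) (idx y))"], of "idx x" "idx y"] idx by simp
  next
    fix h A ys assume ys: "set ys \<subseteq> X"
    obtain n where n: "idx ` set ys \<subseteq> {..<n}" using finite_nat_set_iff_bounded[of "idx ` set ys"] by auto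
    have "map \<alpha> (map idx ys) = ys" using ys idx by (auto intro!: map_idI)
    then show "(h, A, map (\<lambda>x. \<beta> (idx x)) ys) \<in> T \<longleftrightarrow> (h, A, ys) \<in> T'"
      using same_typeD(3)[OF st[of n], of "map idx ys" h A] n by (simp add: comp_def)
  qed
qed

lemma homogeneous:
  assumes st: "same_type k L T \<alpha> L T \<beta>"
  obtains g where "bij g" "\<And>x y. (g x, g y) \<in> L \<longleftrightarrow> (x, y) \<in> L"
    "\<And>h A ys. (h, A, map g ys) \<in> T \<longleftrightarrow> (h, A, ys) \<in> T" "\<And>i. i < k \<Longrightarrow> g (\<alpha> i) = \<beta> i"
proof -
  \<comment> \<open>After the first \<open>k\<close> pairs, step \<open>n\<close> puts
    \<open>n\<close> at index \<open>k + 2 * n\<close> of the first sequence and at index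
    \<open>k + 2 * n + 1\<close> of the second. The former makes the resulting map total, the latter
    surjective.\<close>
  define P where "P n s \<longleftrightarrow> same_type (k + 2 * n) L T (fst s) L T (snd s) \<and> (\<forall>i<k. fst s i = \<alpha> i \<and> snd s i = \<beta> i)"
    for n :: nat and s :: "(nat \<Rightarrow> nat) \<times> (nat \<Rightarrow> nat)"
  define Q where "Q n s s' \<longleftrightarrow> (\<forall>i < k + 2 * n. fst s' i = fst s i \<and> snd s' i = snd s i) \<and>
     fst s' (k + 2 * n) = n \<and> snd s' (Suc (k + 2 * n)) = n"
    for n :: nat and s s' :: "(nat \<Rightarrow> nat) \<times> (nat \<Rightarrow> nat)"
  have step: "\<exists>s'. P (Suc n) s' \<and> Q n s s'" if P: "P n s" for n s
  proof -
    let ?m = "k + 2 * n"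
    have "same_type ?m L T (fst s) L T (snd s)" using P by (simp add: P_def)
    then obtain d where "same_type (Suc ?m) L T ((fst s)(?m := n)) L T ((snd s)(?m := d))"
      using forth[OF order, of ?m "fst s" "snd s" n] by auto
    then obtain e where "same_type (Suc (Suc ?m)) L T ((snd s)(?m := d, Suc ?m := n)) L T ((fst s)(?m := n, Suc ?m := e))"
      using forth[OF order same_type_sym, of "Suc ?m" "(fst s)(?m := n)" "(snd s)(?m := d)" n] by auto
    from same_type_sym[OF this] show ?thesis
      using P unfolding P_def Q_def
      by (intro exI[of _ "((fst s)(?m := n, Suc ?m := e), (snd s)(?m := d, Suc ?m := n))"]) auto
  qed
  have "P 0 (\<alpha>, \<beta>)" using st by (simp add: P_def)
  then obtain s where s: "\<And>n. P n (s n)" "\<And>n. Q n (s n) (s (Suc n))"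
    using dependent_nat_choice[of P Q, OF _ step] by blast
  have m: "mono (\<lambda>n. k + 2 * n)" "\<exists>n. i < k + 2 * n" for i
    by (auto simp: mono_def intro: exI[of _ "Suc i"])
  obtain \<alpha>' where \<alpha>': "\<And>n i. i < k + 2 * n \<Longrightarrow> \<alpha>' i = fst (s n) i"
    using pointwise_limit[of "\<lambda>n. k + 2 * n" "\<lambda>n. fst (s n)"] s(2) m unfolding Q_def by metis
  obtain \<beta>' where \<beta>': "\<And>n i. i < k + 2 * n \<Longrightarrow> \<beta>' i = snd (s n) i"
    using pointwise_limit[of "\<lambda>n. k + 2 * n" "\<lambda>n. snd (s n)"] s(2) m unfolding Q_def by metis
  have sta: "same_type n L T \<alpha>' L T \<beta>'" for n
    by (rule same_type_reindex[OF s(1)[of n, unfolded P_def, THEN conjunct1], where r = id])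
      (use \<alpha>'[of _ n] \<beta>'[of _ n] in auto)
  have sur: "\<alpha>' (k + 2 * n) = n" "\<beta>' (Suc (k + 2 * n)) = n" for n
    using \<alpha>'[of "k + 2 * n" "Suc n"] \<beta>'[of "Suc (k + 2 * n)" "Suc n"] s(2)[of n] by (auto simp: Q_def)
  define g where "g x = \<beta>' (k + 2 * x)" for x
  have g: "g (\<alpha>' i) = \<beta>' i" for i
    using same_typeD(1)[OF sta[of "Suc (max i (k + 2 * \<alpha>' i))"], of i "k + 2 * \<alpha>' i"]
    by (simp add: g_def sur)
  show ?thesis
  proof (rule that[of g])
    have "inj g"
    proof (rule injI)
      fix x y assume "g x = g y"
      then show "x = y"
        using same_typeD(1)[OF sta[of "Suc (max (k + 2 * x) (k + 2 * y))"], of "k + 2 * x" "k + 2 * y"]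
        by (simp add: g_def sur)
    qed
    moreover have "surj g"
    proof (rule surjI)
      show "g (\<alpha>' (Suc (k + 2 * y))) = y" for y by (simp add: g sur)
    qed
    ultimately show "bij g" by (rule bijI)
    show "(g x, g y) \<in> L \<longleftrightarrow> (x, y) \<in> L" for x y
      using same_typeD(2)[OF sta[of "Suc (max (k + 2 * x) (k + 2 * y))"], of "k + 2 * x" "k + 2 * y"]
      by (simp add: g_def sur)
    show "(h, A, map g ys) \<in> T \<longleftrightarrow> (h, A, ys) \<in> T" for h A ys
    proof -
      let ?is = "map (\<lambda>x. k + 2 * x) ys"
      obtain n where n: "set ?is \<subseteq> {..<n}" using finite_nat_set_iff_bounded[of "set ?is"] by auto
      have "map \<alpha>' ?is = ys" by (auto intro!: map_idI simp: sur)
      moreover have "map \<beta>' ?is = map g ys" by (simp add: g_def)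
      ultimately show ?thesis using same_typeD(3)[OF sta[of n] n, of h A] by (simp only:)
    qed
    show "g (\<alpha> i) = \<beta> i" if "i < k" for i
    proof -
      have "\<alpha>' i = \<alpha> i" "\<beta>' i = \<beta> i"
        using \<alpha>'[of i 0] \<beta>'[of i 0] s(1)[of 0] that by (auto simp: P_def)
      then show ?thesis using g[of i] by simp
    qed
  qed
qed

end

section \<open>Orbit growth\<close>

lemma sorted_wrt_strict_unique:
  assumes "irreflp R" "transp R" "sorted_wrt R xs" "sorted_wrt R ys" "set xs = set ys"
  shows "xs = ys"
  using assms(3-)
proof (induction xs arbitrary: ys)
  case (Cons x xs)
  then obtain y ys' where ys: "ys = y # ys'" by (cases ys) auto
  have "x = y"
  proof (rule ccontr)
    assume "x \<noteq> y"
    then have "R x y" "R y x" using Cons.prems unfolding ys by auto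
    then show False using assms(1,2) by (meson irreflpD transpD)
  qed
  moreover have "x \<notin> set xs" "y \<notin> set ys'"
    using Cons.prems assms(1) unfolding ys by (auto dest: irreflpD)
  ultimately have "set xs = set ys'" using Cons.prems(3) unfolding ys by auto
  then show ?case using Cons.IH Cons.prems(1,2) ys \<open>x = y\<close> by auto
qed simp

text \<open>A root-free form of the bound \<open>4 ^ n / sqrt (2 * n + 1)\<close>. The induction
  uses the ratio \<open>2 * (2 * n + 1) / (n + 1)\<close> of consecutive central coefficients and
  \<open>(2 * n + 3) * (2 * n + 1) \<le> 4 * (n + 1)\<^sup>2\<close>.\<close>

lemma binomial_central_bound: "(2 * n + 1) * ((2 * n) choose n)\<^sup>2 \<le> 16 ^ n"
proof (induction n)
  case (Suc n)
  let ?c = "(2 * n) choose n" and ?d = "(2 * Suc n) choose Suc n"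
  have d: "(n + 1) * ?d = 2 * (2 * n + 1) * ?c"
  proof -
    define b where "b = Suc (2 * n) choose n"
    have b: "b = Suc (2 * n) choose Suc n"
      unfolding b_def using binomial_symmetric[of n "Suc (2 * n)"] by (simp del: binomial_Suc_Suc)
    have "2 * Suc n = Suc (Suc (2 * n))" by simp
    then have "(n + 1) * ?d = 2 * ((n + 1) * b)"
      using Suc_times_binomial[of n "Suc (2 * n)"] unfolding b_def by (simp del: binomial_Suc_Suc)
    also have "(n + 1) * b = (2 * n + 1) * ?c"
      using Suc_times_binomial[of n "2 * n"] unfolding b by (simp del: binomial_Suc_Suc)
    finally show ?thesis by simp
  qed
  define e where "e = ?d"
  have "(n + 1)\<^sup>2 * ((2 * Suc n + 1) * e\<^sup>2) = (2 * n + 3) * ((n + 1) * e)\<^sup>2"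
    by (simp add: power2_eq_square algebra_simps)
  also have "\<dots> = 4 * ((2 * n + 3) * (2 * n + 1)) * ((2 * n + 1) * ?c\<^sup>2)"
    unfolding e_def d by (simp add: power2_eq_square algebra_simps)
  also have "\<dots> \<le> 4 * (4 * (n + 1)\<^sup>2) * 16 ^ n"
    by (rule mult_le_mono[OF mult_le_mono2 Suc.IH]) (simp add: power2_eq_square algebra_simps)
  also have "\<dots> = (n + 1)\<^sup>2 * 16 ^ Suc n" by simp
  finally have "(2 * Suc n + 1) * e\<^sup>2 \<le> 16 ^ Suc n" by (simp only: mult_le_cancel1) simp
  then show ?case by (simp only: e_def)
qed simp

lemma binomial_sqrt_bound: "(k + 1) * (k choose j)\<^sup>2 \<le> 4 ^ k"
proof -
  have "(k + 1) * (k choose j)\<^sup>2 \<le> (k + 1) * (k choose (k div 2))\<^sup>2"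
    using binomial_maximum[of k j] by (intro mult_le_mono power_mono) auto
  also have "\<dots> \<le> 4 ^ k"
  proof (cases "even k")
    case True
    then obtain n where "k = 2 * n" by blast
    then show ?thesis using binomial_central_bound[of n] by (simp add: power_mult)
  next
    case False
    then obtain n where k: "k = 2 * n + 1" by (rule oddE)
    define c where "c = (2 * n + 1) choose n"
    \<comment> \<open>The odd case follows from the next even row, whose central coefficient is
      twice the middle one of row \<open>2 * n + 1\<close>.\<close>
    have cc: "(2 * Suc n) choose Suc n = 2 * c"
    proof -
      have "(2 * Suc n) choose Suc n = c + ((2 * n + 1) choose Suc n)" by (simp add: c_def)
      moreover have "(2 * n + 1) choose Suc n = c"
        unfolding c_def using binomial_symmetric[of n "2 * n + 1"] by (simp del: binomial_Suc_Suc)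
      ultimately show ?thesis by simp
    qed
    have "(2 * Suc n + 1) * (2 * c)\<^sup>2 \<le> 16 ^ Suc n"
      using binomial_central_bound[of "Suc n"] unfolding cc .
    moreover have "(2 * Suc n + 1) * (2 * c)\<^sup>2 = 4 * ((2 * n + 3) * c\<^sup>2)"
      by (simp add: power2_eq_square algebra_simps)
    moreover have "16 ^ Suc n = 4 * (4 * (16 :: nat) ^ n)" by simp
    moreover have "(2 * n + 2) * c\<^sup>2 \<le> (2 * n + 3) * c\<^sup>2" by (rule mult_le_mono1) simp
    ultimately have "(2 * n + 2) * c\<^sup>2 \<le> 4 * 16 ^ n" by linarith
    moreover have "4 ^ k = 4 * (16 :: nat) ^ n" unfolding k by (simp add: power_mult)
    moreover have "k div 2 = n" "k + 1 = 2 * n + 2" using k by simp_all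
    ultimately show ?thesis using k by (simp only: c_def)
  qed
  finally show ?thesis .
qed

text \<open>The possible places of facts on a \<open>k\<close>-tuple: \<open>I\<close> is the set of
  indices of the listed elements. Its size is prescribed by \<open>h\<close> and \<open>A\<close>,
  so each such pair contributes a single binomial coefficient.\<close>

definition fact_slots :: "nat \<Rightarrow> (nat \<times> nat set \<times> nat set) set" where
  "fact_slots k = {(h, A, I). core_size h \<le> k \<and> A \<subseteq> {..<h} \<and> I \<subseteq> {..<k} \<and> card I = card (positions h A)}"

lemma fact_slots_Sigma:
  "fact_slots k = (SIGMA h : {h. core_size h \<le> k}. SIGMA A : Pow {..<h}. {I. I \<subseteq> {..<k} \<and> card I = card (positions h A)})"
  by (auto simp: fact_slots_def)

lemma finite_core_size_le: "finite {h. core_size h \<le> k}"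
  by (rule finite_subset[of _ "{..k}"]) (use less_core_size in \<open>auto intro: less_imp_le order_trans\<close>)

lemma finite_fact_slots: "finite (fact_slots k)"
  unfolding fact_slots_Sigma using finite_core_size_le by (intro finite_SigmaI) auto

text \<open>The sum counts the pairs of \<open>h\<close> and a set of nodes. It is at most
  \<open>2 ^ Suc m\<close> for the largest admissible \<open>m\<close>, and the fourth power of that
  is \<open>core_size m\<close>.\<close>

lemma sum_core_size_le: "(\<Sum>h | core_size h \<le> k. 2 ^ h) ^ 4 \<le> (k :: nat)"
proof (cases "{h. core_size h \<le> k} = {}")
  case False
  define m where "m = Max {h. core_size h \<le> k}"
  have m: "core_size m \<le> k" "{h. core_size h \<le> k} \<subseteq> {..m}"
    using Max_in[OF finite_core_size_le False] Max_ge[OF finite_core_size_le[of k]] by (auto simp: m_def)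
  have "(\<Sum>h | core_size h \<le> k. 2 ^ h) \<le> (\<Sum>h\<le>m. 2 ^ h :: nat)"
    using m(2) by (intro sum_mono2) auto
  also have "\<dots> = (\<Sum>h=0..<Suc m. 2 ^ h)" by (simp only: lessThan_Suc_atMost atLeast0LessThan)
  also have "\<dots> \<le> 2 ^ Suc m" unfolding sum_power2 by (rule diff_le_self)
  finally have "(\<Sum>h | core_size h \<le> k. 2 ^ h) ^ 4 \<le> ((2 :: nat) ^ Suc m) ^ 4" by (rule power_mono) simp
  also have "\<dots> = (2 ^ 4) ^ Suc m" by (simp only: mult.commute flip: power_mult)
  also have "\<dots> = core_size m" by (simp add: core_size_def)
  finally show ?thesis using m(1) by simp
qed (simp only: sum.empty, simp)

lemma card_fact_slots:
  assumes "k \<ge> 16"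
  shows "2 * card (fact_slots k) \<le> 2 ^ k"
proof -
  define W where "W = (\<Sum>h | core_size h \<le> k. 2 ^ h :: nat)"
  define M where "M = k choose (k div 2)"
  have "card (fact_slots k) =
      (\<Sum>h | core_size h \<le> k. \<Sum>A\<in>Pow {..<h}. k choose card (positions h A))"
    unfolding fact_slots_Sigma using finite_core_size_le by (simp add: n_subsets)
  also have "\<dots> \<le> (\<Sum>h | core_size h \<le> k. \<Sum>A\<in>Pow {..<h}. M)"
    by (intro sum_mono) (simp add: M_def binomial_maximum)
  also have "\<dots> = W * M" by (simp add: W_def card_Pow sum_distrib_right)
  finally have c: "card (fact_slots k) \<le> W * M" .
  \<comment> \<open>\<open>W\<close> is at most the fourth root of \<open>k\<close>, so
    \<open>2 * W\<close> is at most \<open>sqrt k\<close> from \<open>k = 16\<close> on. The factor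
    \<open>sqrt (k + 1)\<close> saved by the binomial coefficient absorbs it.\<close>
  have "(4 * W\<^sup>2)\<^sup>2 = 16 * W ^ 4" by (simp add: power2_eq_square power4_eq_xxxx)
  also have "\<dots> \<le> 16 * k" using sum_core_size_le[of k] by (simp add: W_def)
  also have "\<dots> \<le> k\<^sup>2" using assms by (simp add: power2_eq_square)
  finally have W: "4 * W\<^sup>2 \<le> k" by (rule power2_le_imp_le) simp
  have "(2 * (W * M))\<^sup>2 = 4 * W\<^sup>2 * M\<^sup>2" by (simp add: power_mult_distrib)
  also have "\<dots> \<le> (k + 1) * M\<^sup>2" using W by (intro mult_le_mono) auto
  also have "\<dots> \<le> 4 ^ k" unfolding M_def by (rule binomial_sqrt_bound)
  also have "\<dots> = (2 ^ k)\<^sup>2" by (simp add: power2_eq_square flip: power_mult_distrib)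
  finally have "2 * (W * M) \<le> 2 ^ k" by (rule power2_le_imp_le) simp
  then show ?thesis using c by linarith
qed

text \<open>Facts use up half of the exponent \<open>2 ^ k\<close>. The other half pays for the
  order of the entries of a tuple and for a further factor \<open>2 ^ k\<close>, which makes the
  quotient tend to \<open>0\<close>.\<close>

lemma quadratic_le_exp: "(k :: nat) \<ge> 16 \<Longrightarrow> 2 * (k * k + k) \<le> 2 ^ k"
proof (induction k rule: nat_induct_at_least)
  case (Suc n)
  have "2 * (Suc n * Suc n + Suc n) \<le> 2 * (2 * (n * n + n))"
  proof -
    define q where "q = n * n"
    have "16 * n \<le> q" unfolding q_def using Suc(1) by (rule mult_le_mono1)
    moreover have "Suc n * Suc n = q + 2 * n + 1" by (simp add: q_def)
    ultimately show ?thesis using Suc(1) unfolding q_def[symmetric] by simp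
  qed
  also have "\<dots> \<le> 2 ^ Suc n" using Suc.IH by simp
  finally show ?case .
qed simp

section \<open>Types, automorphisms and orbits\<close>

context generic_order
begin

text \<open>Since facts list their elements in increasing order, the set of indices determines the list.\<close>

definition type_code :: "nat \<Rightarrow> nat list \<Rightarrow> (nat \<times> nat) set \<times> (nat \<times> nat set \<times> nat set) set" where
  "type_code k x = ({(i, j). i < k \<and> j < k \<and> (x ! i, x ! j) \<in> L},
     {(h, A, set is) | h A is. set is \<subseteq> {..<k} \<and> (h, A, map ((!) x) is) \<in> T})"

lemma distinct_index_list:
  assumes "(h, A, map f is) \<in> T"
  shows "distinct is"
  using strictly_sorted_distinct[OF labelled_orderD(2)[OF order] labelled_orderD(9)[OF order assms]]
  by (simp add: distinct_map)

lemma type_code_in: "type_code k x \<in> Pow ({..<k} \<times> {..<k}) \<times> Pow (fact_slots k)"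
proof -
  have "(h, A, set is) \<in> fact_slots k" if "is": "set is \<subseteq> {..<k}" "(h, A, map ((!) x) is) \<in> T" for h A "is"
  proof -
    have "card (set is) = card (positions h A)"
      using distinct_card[OF distinct_index_list[OF "is"(2)]] labelled_orderD(7)[OF order "is"(2)] by simp
    moreover have "card (set is) \<le> k" using card_mono[OF _ "is"(1)] by simp
    ultimately show ?thesis
      using core_size_le_card_positions[of h A] labelled_orderD(6)[OF order "is"(2)] "is"(1)
      by (auto simp: fact_slots_def)
  qed
  then show ?thesis unfolding type_code_def by auto
qed

lemma type_code_same_type:
  assumes "type_code k x = type_code k y"
  shows "same_type k L T ((!) x) L T ((!) y)"
proof -
  note D = labelled_orderD[OF order]
  have L: "(x ! i, x ! j) \<in> L \<longleftrightarrow> (y ! i, y ! j) \<in> L" if "i < k" "j < k" for i j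
    using assms that unfolding type_code_def by blast
  \<comment> \<open>By totality, the order also records which entries of the tuple coincide.\<close>
  have eq: "a = b \<longleftrightarrow> (a, b) \<notin> L \<and> (b, a) \<notin> L" for a b
    using D(2,4) unfolding irrefl_def total_on_def by blast
  have sub: "(h, A, map ((!) v) is) \<in> T"
    if uv: "type_code k u = type_code k v" and "is": "set is \<subseteq> {..<k}" "(h, A, map ((!) u) is) \<in> T" for u v h A "is"
  proof -
    have "(h, A, set is) \<in> snd (type_code k v)"
      unfolding uv[symmetric] using "is" by (auto simp: type_code_def)
    \<comment> \<open>The code only yields some list \<open>js\<close> with the same set of indices.
      Both lists turn out to be sorted by the order of the entries of \<open>v\<close>, hence they
      are equal.\<close>
    then obtain js where js: "set is = set js" "(h, A, map ((!) v) js) \<in> T" by (auto simp: type_code_def)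
    let ?R = "\<lambda>i j. (v ! i, v ! j) \<in> L"
    have "sorted_wrt (\<lambda>i j. (u ! i, u ! j) \<in> L) is" using D(9)[OF "is"(2)] by (simp add: sorted_wrt_map)
    moreover have "(u ! i, u ! j) \<in> L \<longleftrightarrow> (v ! i, v ! j) \<in> L" if "i \<in> set is" "j \<in> set is" for i j
    proof -
      have "i < k" "j < k" using that "is"(1) by auto
      then show ?thesis using uv unfolding type_code_def by blast
    qed
    ultimately have s1: "sorted_wrt ?R is" by (auto elim: sorted_wrt_mono_rel[rotated])
    have s2: "sorted_wrt ?R js" using D(9)[OF js(2)] by (simp add: sorted_wrt_map)
    have "irreflp ?R" using D(2) by (auto simp: irreflp_def irrefl_def)
    moreover have "transp ?R" using D(3) by (auto intro!: transpI dest: transD)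
    ultimately have "is = js" using sorted_wrt_strict_unique s1 s2 js(1) by blast
    then show ?thesis using js(2) by simp
  qed
  show ?thesis
    unfolding same_type_def using L eq sub[OF assms] sub[OF assms[symmetric]] by (metis (no_types))
qed

text \<open>Symbol \<open>0\<close> is the order, and \<open>Suc (prod_encode (h, i))\<close> is the
  relation of node \<open>i\<close> in the configuration for \<open>h\<close>. Only facts of single
  nodes become relations; bijections respecting the order and all facts are then automorphisms,
  which suffices to bound the number of orbits.\<close>

definition generic_structure :: "(nat, nat) rel_structure" where
  "generic_structure =
     \<lparr> carrier = UNIV, symbols = UNIV,
       arity = (\<lambda>r. case r of 0 \<Rightarrow> 2 | Suc c \<Rightarrow> (case prod_decode c of (h, i) \<Rightarrow> card (positions h {i}))),
       interp = (\<lambda>r. case r of 0 \<Rightarrow> {[a, b] | a b. (a, b) \<in> L}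
                  | Suc c \<Rightarrow> (case prod_decode c of (h, i) \<Rightarrow> {ys. (h, {i}, ys) \<in> T})) \<rparr>"

lemma carrier_generic_structure [simp]: "carrier generic_structure = UNIV"
  by (simp add: generic_structure_def)

lemma relational_structure_generic: "relational_structure generic_structure"
  using labelled_orderD(7)[OF order]
  by (auto simp: relational_structure_def generic_structure_def in_nlists_iff split: nat.split prod.split)

lemma structure_autI:
  assumes "bij g" "\<And>x y. (g x, g y) \<in> L \<longleftrightarrow> (x, y) \<in> L" "\<And>h A ys. (h, A, map g ys) \<in> T \<longleftrightarrow> (h, A, ys) \<in> T"
  shows "g \<in> structure_aut generic_structure"
proof -
  have "map g xs \<in> {[a, b] | a b. (a, b) \<in> L} \<longleftrightarrow> xs \<in> {[a, b] | a b. (a, b) \<in> L}"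
    if len: "length xs = 2" for xs
  proof -
    obtain a b where "xs = [a, b]" using len by (auto simp: length_Suc_conv numeral_2_eq_2)
    then show ?thesis using assms(2) by auto
  qed
  then show ?thesis
    using assms(1,3)
    by (auto simp: structure_aut_def generic_structure_def Bij_def in_nlists_iff split: nat.split prod.split)
qed

lemma orbit_eq_if_type_code_eq:
  assumes "length x = k" "length y = k" "type_code k x = type_code k y"
  shows "orbit (Aut generic_structure) (tuple_action UNIV k) x = orbit (Aut generic_structure) (tuple_action UNIV k) y"
proof -
  interpret group_action "Aut generic_structure" "nlists k UNIV" "tuple_action UNIV k"
    using group_action_tuples[of generic_structure k] by simp
  have xy: "x \<in> nlists k UNIV" "y \<in> nlists k UNIV" using assms by (auto simp: in_nlists_iff)
  obtain g where g: "g \<in> structure_aut generic_structure" "\<And>i. i < k \<Longrightarrow> g (x ! i) = y ! i"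
    using homogeneous[OF type_code_same_type[OF assms(3)]] structure_autI by metis
  have "map g x = y" using g(2) assms(1,2) by (intro nth_equalityI) auto
  then have y: "y \<in> orbit (Aut generic_structure) (tuple_action UNIV k) x"
    using g(1) xy(1) by (auto simp: orbit_def Aut_def tuple_action_def intro!: exI[of _ g])
  have x: "x \<in> orbit (Aut generic_structure) (tuple_action UNIV k) y" using orbit_sym xy y by blast
  have sub: "orbit (Aut generic_structure) (tuple_action UNIV k) z \<subseteq> nlists k UNIV" if "z \<in> nlists k UNIV" for z
    using that element_image unfolding orbit_def by blast
  show ?thesis
  proof (intro equalityI subsetI)
    show "z \<in> orbit (Aut generic_structure) (tuple_action UNIV k) y"
      if "z \<in> orbit (Aut generic_structure) (tuple_action UNIV k) x" for z
      using orbit_trans[OF xy(2,1) _ x that] sub[OF xy(1)] that by blast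
    show "z \<in> orbit (Aut generic_structure) (tuple_action UNIV k) x"
      if "z \<in> orbit (Aut generic_structure) (tuple_action UNIV k) y" for z
      using orbit_trans[OF xy(1,2) _ y that] sub[OF xy(2)] that by blast
  qed
qed

lemma tuple_orbits_bound:
  shows "finite (tuple_orbits generic_structure k)"
    and "card (tuple_orbits generic_structure k) \<le> 2 ^ (k * k) * 2 ^ card (fact_slots k)"
proof -
  let ?C = "Pow ({..<k} \<times> {..<k}) \<times> Pow (fact_slots k)"
  define F where "F c = orbit (Aut generic_structure) (tuple_action UNIV k) (SOME x. length x = k \<and> type_code k x = c)" for c
  have sub: "tuple_orbits generic_structure k \<subseteq> F ` ?C"
  proof
    fix O' assume "O' \<in> tuple_orbits generic_structure k"
    then obtain x where x: "O' = orbit (Aut generic_structure) (tuple_action UNIV k) x" "length x = k"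
      by (auto simp: tuple_orbits_def orbits_def in_nlists_iff)
    have "length (SOME y. length y = k \<and> type_code k y = type_code k x) = k \<and>
        type_code k (SOME y. length y = k \<and> type_code k y = type_code k x) = type_code k x"
      by (rule someI[of _ x]) (simp add: x)
    then have "O' = F (type_code k x)"
      unfolding F_def x(1) using x(2) by (intro orbit_eq_if_type_code_eq) auto
    then show "O' \<in> F ` ?C" using type_code_in by blast
  qed
  have fin: "finite ?C" using finite_fact_slots by simp
  show "finite (tuple_orbits generic_structure k)" using sub fin by (meson finite_imageI finite_subset)
  have "card (tuple_orbits generic_structure k) \<le> card ?C"
    using sub fin by (meson card_image_le card_mono finite_imageI order_trans)
  also have "\<dots> = 2 ^ (k * k) * 2 ^ card (fact_slots k)"
    using finite_fact_slots by (simp add: card_cartesian_product card_Pow)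
  finally show "card (tuple_orbits generic_structure k) \<le> 2 ^ (k * k) * 2 ^ card (fact_slots k)" .
qed

lemma omega_categorical_generic: "omega_categorical generic_structure"
  using tuple_orbits_bound(1) by (simp add: omega_categorical_def)

lemma orbit_growth_generic: "less_than_double_exponential_orbit_growth generic_structure"
  unfolding less_than_double_exponential_orbit_growth_def
proof (rule tendsto_sandwich[of "\<lambda>_. 0"])
  show "(\<lambda>k. (1 / 2 :: real) ^ k) \<longlonglongrightarrow> 0" by (rule LIMSEQ_realpow_zero) auto
  show "\<forall>\<^sub>F k in sequentially. real (card (tuple_orbits generic_structure k)) / 2 ^ 2 ^ k \<le> (1 / 2) ^ k"
  proof (rule eventually_sequentiallyI[of 16])
    fix k :: nat assume k: "16 \<le> k"
    have "2 * (k * k + card (fact_slots k) + k) \<le> 2 * 2 ^ k"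
      using add_mono[OF card_fact_slots[OF k] quadratic_le_exp[OF k]] by simp
    then have e: "k * k + card (fact_slots k) + k \<le> 2 ^ k" by simp
    have "card (tuple_orbits generic_structure k) * 2 ^ k \<le> 2 ^ (k * k) * 2 ^ card (fact_slots k) * 2 ^ k"
      using tuple_orbits_bound(2) by (intro mult_le_mono) auto
    also have "\<dots> = 2 ^ (k * k + card (fact_slots k) + k)" by (simp add: power_add)
    also have "\<dots> \<le> 2 ^ 2 ^ k" using e by (intro power_increasing) auto
    finally have "real (card (tuple_orbits generic_structure k) * 2 ^ k) \<le> real (2 ^ 2 ^ k)"
      by (simp only: of_nat_le_iff)
    then show "real (card (tuple_orbits generic_structure k)) / 2 ^ 2 ^ k \<le> (1 / 2) ^ k"
      by (simp add: field_simps)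
  qed
qed auto

end

section \<open>No uniformly continuous minion homomorphism\<close>

context generic_order
begin

lemma symbols_generic_structure: "symbols generic_structure = UNIV"
  by (simp add: generic_structure_def)

lemma Pol_holds:
  assumes f: "f \<in> ops (Pol generic_structure) n"
    and X: "\<And>p. p \<in> positions h {i} \<Longrightarrow> length (X p) = n"
    and h: "\<And>j. j < n \<Longrightarrow> holds T h {i} (\<lambda>p. X p ! j)"
  shows "holds T h {i} (\<lambda>p. f (X p))"
proof -
  let ?R = "Suc (prod_encode (h, i))" and ?xs = "map X (position_list h {i})"
  have "?xs \<in> nlists (arity generic_structure ?R) (nlists n UNIV)"
    using X by (auto simp: generic_structure_def in_nlists_iff)
  moreover have "map (\<lambda>x. x ! j) ?xs \<in> interp generic_structure ?R" if "j < n" for j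
    using h[OF that] by (simp add: generic_structure_def holds_def comp_def)
  ultimately have "map f ?xs \<in> interp generic_structure ?R"
    using f by (simp add: Pol_def structure_hom_def power_structure_def symbols_generic_structure del: map_map)
  then show ?thesis by (simp add: generic_structure_def holds_def comp_def)
qed

lemma PolI:
  assumes lt: "\<And>x y. length x = n \<Longrightarrow> length y = n \<Longrightarrow> (\<And>j. j < n \<Longrightarrow> (x ! j, y ! j) \<in> L) \<Longrightarrow> (g x, g y) \<in> L"
    and hd: "\<And>h i X. (\<And>p. p \<in> positions h {i} \<Longrightarrow> length (X p) = n) \<Longrightarrow>
       (\<And>j. j < n \<Longrightarrow> holds T h {i} (\<lambda>p. X p ! j)) \<Longrightarrow> holds T h {i} (\<lambda>p. g (X p))"
  shows "restrict g (nlists n UNIV) \<in> ops (Pol generic_structure) n"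
proof -
  let ?f = "restrict g (nlists n UNIV)"
  have "map ?f xs \<in> interp generic_structure R"
    if xs: "xs \<in> nlists (arity generic_structure R) (nlists n UNIV)"
      and j: "\<forall>j<n. map (\<lambda>x. x ! j) xs \<in> interp generic_structure R" for R xs
  proof -
    have len: "x \<in> nlists n UNIV" if "x \<in> set xs" for x using xs that by (simp add: in_nlists_iff[of xs])
    then have fg: "map ?f xs = map g xs" by simp
    show ?thesis
    proof (cases R)
      case 0
      then have "length xs = 2" using xs by (simp add: generic_structure_def in_nlists_iff)
      then obtain x y where xy: "xs = [x, y]" by (auto simp: length_Suc_conv numeral_2_eq_2)
      have "(x ! k, y ! k) \<in> L" if "k < n" for k using j that unfolding xy 0 by (simp add: generic_structure_def)
      then have "(g x, g y) \<in> L" using lt[of x y] len unfolding xy by (simp add: in_nlists_iff)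
      then show ?thesis unfolding fg unfolding xy 0 by (simp add: generic_structure_def)
    next
      case (Suc c)
      obtain h i where hi: "prod_decode c = (h, i)" by (cases "prod_decode c")
      have "length xs = card (positions h {i})" using xs hi Suc by (simp add: generic_structure_def in_nlists_iff)
      then obtain X where X: "xs = map X (position_list h {i})" by (rule map_position_list_exhaust)
      have "holds T h {i} (\<lambda>p. g (X p))"
      proof (rule hd)
        show "length (X p) = n" if "p \<in> positions h {i}" for p
          using len[of "X p"] that by (simp add: X in_nlists_iff)
        show "holds T h {i} (\<lambda>p. X p ! k)" if "k < n" for k
          using j that unfolding X by (simp add: generic_structure_def hi Suc holds_def comp_def)
      qed
      then show ?thesis unfolding fg unfolding X by (simp add: generic_structure_def hi Suc holds_def comp_def)
    qed
  qed
  then show ?thesis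
    by (simp add: Pol_def structure_hom_def power_structure_def)
qed

end

text \<open>The component \<open>c\<close> of the glued structure belongs to \<open>p\<close> for \<open>c = 0\<close>, to \<open>f\<^sub>c\<close> for \<open>1 \<le> c \<le> m\<close> and to \<open>q\<close>
  for \<open>c = m + 1\<close>. The point \<open>Edge j a b\<close> is the value at \<open>(a, b)\<close> of the \<open>j\<close>-th binary minor occurring in the
  chain of identities.\<close>

datatype glue_point = Diag nat | Edge nat nat nat | Free nat "nat list"

instance glue_point :: countable
  by countable_datatype

text \<open>Each point is the class of a triple of component \<open>c\<close> under the identities
  imposed on \<open>E\<close>. Equating the two variables in the identities makes all components
  agree on constant triples from \<open>E\<close>; these are the points \<open>Diag a\<close>.
  Triples matching no side of an identity stay \<open>Free\<close>.\<close>

definition glue :: "nat set \<Rightarrow> nat \<Rightarrow> nat \<Rightarrow> nat list \<Rightarrow> glue_point" where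
  "glue E m c x =
     (let a = x ! 0; b = x ! 1; d = x ! 2 in
      if a \<notin> E \<or> b \<notin> E \<or> d \<notin> E then Free c x
      else if a = b \<and> b = d then Diag a
      else if c = 0 then (if b = d then Edge 0 a b else if a = d then Edge 0 b a else Free c x)
      else if c \<le> m then (if a = b then Edge (c - 1) a d else if b = d then Edge c a b else Free c x)
      else (if a = b then Edge m a d else if a = d then Edge m a b else Free c x))"

text \<open>Without \<open>f\<^bsub>i+1\<^esub>\<close>, the identities are satisfied by last projections before it and first projections after it.\<close>

fun glue_section :: "nat \<Rightarrow> glue_point \<Rightarrow> nat" where
  "glue_section i (Diag a) = a"
| "glue_section i (Edge j a b) = (if j \<le> i then b else a)"
| "glue_section i (Free c x) = (if c \<le> i then x ! 2 else x ! 0)"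

text \<open>A single map on glued points restricts to a projection on every component but one. On
  component \<open>Suc i\<close> it would send (x,x,y) to y and (x,y,y) to x for all x, y in
  \<open>E\<close>, unlike any projection if these differ; hence the exclusion.\<close>

lemma glue_section_glue:
  assumes "i < m" "c \<noteq> Suc i"
  shows "glue_section i (glue E m c x) = x ! (if c \<le> i then 2 else 0)"
proof (cases "x ! 0 \<in> E \<and> x ! 1 \<in> E \<and> x ! 2 \<in> E")
  case True
  show ?thesis
    by (cases "x ! 0 = x ! 1"; cases "x ! 1 = x ! 2"; cases "x ! 0 = x ! 2"; cases c; cases "c \<le> m"; cases "c \<le> i")
      (use True assms in \<open>simp_all add: glue_def\<close>)
next
  case False
  then have "glue E m c x = Free c x" by (simp add: glue_def)
  then show ?thesis by simp
qed

lemma glue_eq_Free: 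
  assumes "glue E m c x = Free c' x'" shows "c = c'"
proof -
  have "case glue E m c x of Free e _ \<Rightarrow> e = c | _ \<Rightarrow> True"
  proof (cases "x ! 0 \<in> E \<and> x ! 1 \<in> E \<and> x ! 2 \<in> E")
    case True
    show ?thesis
      by (cases "x ! 0 = x ! 1"; cases "x ! 1 = x ! 2"; cases "x ! 0 = x ! 2"; cases c; cases "c \<le> m")
        (use True in \<open>simp_all add: glue_def\<close>)
  next
    case False
    then have "glue E m c x = Free c x" by (simp add: glue_def)
    then show ?thesis by simp
  qed
  then show ?thesis using assms by simp
qed

lemma glue_outside: "x ! 0 \<notin> E \<Longrightarrow> glue E m c x = Free c x"
  by (simp add: glue_def)

fun glue_entries :: "glue_point \<Rightarrow> nat set" where
  "glue_entries (Diag a) = {a}"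
| "glue_entries (Edge j a b) = {a, b}"
| "glue_entries (Free c x) = set x"

lemma glue_entries_glue:
  assumes "length x = 3"
  shows "glue_entries (glue E m c x) = set x"
proof -
  obtain a b d where "x = [a, b, d]" using assms by (auto simp: length_Suc_conv numeral_3_eq_3)
  then show ?thesis by (auto simp: glue_def Let_def)
qed
lemma glue_identities:
  assumes "a \<in> E" "b \<in> E"
  shows "glue E m 0 [a, b, b] = glue E m 0 [b, a, b]"
    and "m > 0 \<Longrightarrow> glue E m 0 [a, b, b] = glue E m 1 [a, a, b]"
    and "0 < c \<Longrightarrow> c \<le> m \<Longrightarrow> glue E m c [a, b, b] = glue E m (Suc c) [a, a, b]"
    and "glue E m (Suc m) [a, a, b] = glue E m (Suc m) [a, b, a]"
proof -
  have n: "[x, y, z] ! 0 = x" "[x, y, z] ! 1 = y" "[x, y, z] ! 2 = z" for x y z :: nat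
    by (simp_all add: numeral_2_eq_2)
  note g = glue_def[of E m _ "[_, _, _]", unfolded n Let_def]
  show "glue E m 0 [a, b, b] = glue E m 0 [b, a, b]" "glue E m (Suc m) [a, a, b] = glue E m (Suc m) [a, b, a]"
    by (cases "a = b"; simp add: g assms)+
  show "m > 0 \<Longrightarrow> glue E m 0 [a, b, b] = glue E m 1 [a, a, b]"
    by (cases "a = b"; simp add: g assms)
  show "0 < c \<Longrightarrow> c \<le> m \<Longrightarrow> glue E m c [a, b, b] = glue E m (Suc c) [a, a, b]"
    by (cases "a = b"; cases "c = m"; simp add: g assms)
qed

section \<open>Order and relations of the glued structure\<close>

lemma lexicographic_linear_order:
  fixes f :: "'b :: countable \<Rightarrow> 'a"
  assumes "irrefl L" "trans L" "total L"
    and "L' = {(s, t). (f s, f t) \<in> L \<or> f s = f t \<and> to_nat s < to_nat t}"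
  shows "irrefl L'" "trans L'" "total L'"
proof -
  show "irrefl L'" using assms(1) by (auto simp: assms(4) irrefl_def)
  show "trans L'"
  proof (rule transI)
    fix a b c assume "(a, b) \<in> L'" "(b, c) \<in> L'"
    then show "(a, c) \<in> L'"
      using transD[OF assms(2), of "f a" "f b" "f c"] unfolding assms(4) by auto
  qed
  show "total L'"
    using assms(3) unfolding assms(4) total_on_def
    by (auto) (metis inj_onD inj_to_nat iso_tuple_UNIV_I linorder_neqE_nat)
qed

context generic_order
begin

definition least :: "nat set \<Rightarrow> nat" where
  "least Y = (SOME a. a \<in> Y \<and> (\<forall>b \<in> Y. a = b \<or> (a, b) \<in> L))"

lemma least:
  assumes "finite Y" "Y \<noteq> {}"
  shows "least Y \<in> Y" "b \<in> Y \<Longrightarrow> least Y = b \<or> (least Y, b) \<in> L"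
proof -
  note D = labelled_orderD[OF order]
  have "\<exists>a. a \<in> Y \<and> (\<forall>b \<in> Y. a = b \<or> (a, b) \<in> L)"
    using assms
  proof (induction Y rule: finite_ne_induct)
    case (insert c Y)
    then obtain a where a: "a \<in> Y" "\<forall>b \<in> Y. a = b \<or> (a, b) \<in> L" by blast
    consider "(c, a) \<in> L" | "c = a" | "(a, c) \<in> L" using D(4) unfolding total_on_def by blast
    then show ?case
    proof cases
      case 1
      then have "c = b \<or> (c, b) \<in> L" if "b \<in> insert c Y" for b
        using that a(2) transD[OF D(3), of c a b] by auto
      then show ?thesis by blast
    qed (use a in blast)+
  qed auto
  from someI_ex[OF this] show "least Y \<in> Y" "b \<in> Y \<Longrightarrow> least Y = b \<or> (least Y, b) \<in> L"
    unfolding least_def[symmetric] by auto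
qed

lemma least_mono:
  assumes "length x = n" "length y = n" "n > 0" "\<And>j. j < n \<Longrightarrow> (x ! j, y ! j) \<in> L"
  shows "(least (set x), least (set y)) \<in> L"
proof -
  have ne: "set x \<noteq> {}" "set y \<noteq> {}" using assms(1-3) by auto
  obtain j where j: "j < n" "least (set y) = y ! j"
    using least(1)[OF _ ne(2)] assms(2) by (metis List.finite_set in_set_conv_nth)
  have "least (set x) = x ! j \<or> (least (set x), x ! j) \<in> L"
    using least(2)[OF _ ne(1), of "x ! j"] j assms(1) by auto
  then show ?thesis using assms(4)[OF j(1)] j(2) transD[OF labelled_orderD(3)[OF order]] by metis
qed

text \<open>The least entry of a triple depends neither on the arrangement nor on the multiplicity
  of its entries, so it is well defined on glued points; it is also strictly monotone. Ties are
  broken by an arbitrary enumeration.\<close>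

definition glue_less :: "(glue_point \<times> glue_point) set" where
  "glue_less = {(s, t). (least (glue_entries s), least (glue_entries t)) \<in> L \<or>
     least (glue_entries s) = least (glue_entries t) \<and> to_nat s < to_nat t}"

text \<open>A tuple of node \<open>k\<close> in the glued structure is the image, under a single
  component \<open>c\<close>, of a tuple of the third power.\<close>

definition glue_edge :: "nat set \<Rightarrow> nat \<Rightarrow> nat \<Rightarrow> nat \<Rightarrow> (nat \<Rightarrow> glue_point) \<Rightarrow> bool" where
  "glue_edge E m h k \<psi> \<longleftrightarrow> (\<exists>c x. (\<forall>p \<in> positions h {k}. length (x p) = 3 \<and> \<psi> p = glue E m c (x p)) \<and>
     (\<forall>j<3. holds T h {k} (\<lambda>p. x p ! j)))"

lemma glue_less_glue:
  assumes "length x = 3" "length y = 3" "\<And>j. j < 3 \<Longrightarrow> (x ! j, y ! j) \<in> L"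
  shows "(glue E m c x, glue E m c y) \<in> glue_less"
proof -
  have "(least (set x), least (set y)) \<in> L" using assms by (intro least_mono) auto
  then show ?thesis by (simp add: glue_less_def glue_entries_glue assms(1,2))
qed

lemma no_full_glue_edge:
  assumes E: "finite E" and m: "card E + 2 \<le> m" and h: "h > 0"
  shows "\<exists>k<h. \<not> glue_edge E m h k \<psi>"
proof (rule ccontr)
  assume "\<not> ?thesis"
  then have ge: "glue_edge E m h k \<psi>" if "k < h" for k using that by blast
  define P where "P k c x \<longleftrightarrow> (\<forall>p \<in> positions h {k}. length (x p) = 3 \<and> \<psi> p = glue E m c (x p)) \<and>
     (\<forall>j<3. holds T h {k} (\<lambda>p. x p ! j))" for k c x
  have "\<forall>k. \<exists>c. k < h \<longrightarrow> (\<exists>x. P k c x)" using ge unfolding glue_edge_def P_def by blast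
  then obtain c where "\<forall>k. k < h \<longrightarrow> (\<exists>x. P k (c k) x)" by metis
  then have "\<forall>k. \<exists>x. k < h \<longrightarrow> P k (c k) x" by blast
  then obtain x where "\<forall>k. k < h \<longrightarrow> P k (c k) (x k)" by metis
  then have cx: "\<And>k p. k < h \<Longrightarrow> p \<in> positions h {k} \<Longrightarrow> \<psi> p = glue E m (c k) (x k p)"
    "\<And>k j. k < h \<Longrightarrow> j < 3 \<Longrightarrow> holds T h {k} (\<lambda>p. x k p ! j)"
    unfolding P_def by blast+
  \<comment> \<open>The aim is a component \<open>Suc i\<close> used by no node; the section that
    omits it then carries the configuration back to the original structure.\<close>
  have "\<exists>i<m. \<forall>k<h. c k \<noteq> Suc i"
  proof (cases "core_size h \<le> card E")
    case True
    then have "h < m" using less_core_size[of h] m by linarith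
    have "\<not> Suc ` {..<m} \<subseteq> c ` {..<h}"
    proof
      assume "Suc ` {..<m} \<subseteq> c ` {..<h}"
      then have "card (Suc ` {..<m}) \<le> card (c ` {..<h})" by (intro card_mono) auto
      also have "\<dots> \<le> h" using card_image_le[of "{..<h}" c] by simp
      finally show False using \<open>h < m\<close> by (simp add: card_image)
    qed
    then show ?thesis by (force simp: image_iff)
  next
    case False
    \<comment> \<open>The first coordinates of the core are strictly increasing, so they cannot all
      lie in a set smaller than the core. A core element with first coordinate outside
      \<open>E\<close> becomes a \<open>Free\<close> point, which remembers its component; as the
      nodes share the core, they all use the same component.\<close>
    have free: "\<exists>p<core_size h. x k (2 * p) ! 0 \<notin> E" if k: "k < h" for k
    proof (rule ccontr)
      assume "\<not> ?thesis"
      then have sub: "(\<lambda>p. x k (2 * p) ! 0) ` {..<core_size h} \<subseteq> E" by auto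
      have inj: "inj_on (\<lambda>p. x k (2 * p) ! 0) {..<core_size h}"
      proof (rule linorder_inj_onI)
        fix p q assume "p < q" "p \<in> {..<core_size h}" "q \<in> {..<core_size h}"
        then have "(x k (2 * p) ! 0, x k (2 * q) ! 0) \<in> L"
          using labelled_order_holdsD(4)[OF order cx(2)[OF k, of 0]] core_in_positions by simp
        then show "x k (2 * p) ! 0 \<noteq> x k (2 * q) ! 0"
          using labelled_orderD(2)[OF order] by (auto simp: irrefl_def)
      qed auto
      show False using card_inj_on_le[OF inj sub E] False by simp
    qed
    have "c k = c k'" if kk: "k < h" "k' < h" for k k'
    proof -
      obtain p where p: "p < core_size h" "x k (2 * p) ! 0 \<notin> E" using free[OF kk(1)] by blast
      have "\<psi> (2 * p) = Free (c k) (x k (2 * p))"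
        using cx(1)[OF kk(1) core_in_positions[OF p(1)]] p(2) by (simp add: glue_outside)
      then have "glue E m (c k') (x k' (2 * p)) = Free (c k) (x k (2 * p))"
        using cx(1)[OF kk(2) core_in_positions[OF p(1)]] by simp
      then show ?thesis by (rule glue_eq_Free[symmetric])
    qed
    then have c: "c k = c 0" if "k < h" for k using that h by blast
    show ?thesis
    proof (cases "c 0 = Suc 0")
      case True
      then have "c k \<noteq> Suc 1" if "k < h" for k using c[OF that] by linarith
      then show ?thesis using m by (intro exI[of _ 1]) simp
    next
      case False
      then have "c k \<noteq> Suc 0" if "k < h" for k using c[OF that] by linarith
      then show ?thesis using m by (intro exI[of _ 0]) simp
    qed
  qed
  then obtain i where i: "i < m" "\<And>k. k < h \<Longrightarrow> c k \<noteq> Suc i" by blast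
  have "holds T h {k} (glue_section i \<circ> \<psi>)" if k: "k < h" for k
  proof -
    have "holds T h {k} (\<lambda>p. x k p ! (if c k \<le> i then 2 else 0))" using cx(2)[OF k] by simp
    moreover have "(glue_section i \<circ> \<psi>) p = x k p ! (if c k \<le> i then 2 else 0)" if "p \<in> positions h {k}" for p
      using cx(1)[OF k that] glue_section_glue[OF i(1) i(2)[OF k]] by simp
    ultimately show ?thesis using holds_cong[of h "{k}"] by (metis (no_types, lifting))
  qed
  then have "holds T h {..<h} (glue_section i \<circ> \<psi>)"
    using h by (auto intro!: labelled_order_finite_union[OF order, of "{..<h}"])
  then show False using labelled_order_holdsD(2)[OF order] by blast
qed

lemma locally_glued_polymorphisms:
  assumes E: "finite E"
  shows "\<exists>m f. (\<forall>c. f c \<in> ops (Pol generic_structure) 3) \<and>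
    (\<forall>a\<in>E. \<forall>b\<in>E. f 0 [a, b, b] = f 0 [b, a, b] \<and> f 0 [a, b, b] = f 1 [a, a, b] \<and>
       (\<forall>c. 0 < c \<longrightarrow> c \<le> m \<longrightarrow> f c [a, b, b] = f (Suc c) [a, a, b]) \<and>
       f (Suc m) [a, a, b] = f (Suc m) [a, b, a])"
proof -
  \<comment> \<open>\<open>m\<close> exceeds the number of nodes of any configuration with at most
    \<open>card E\<close> core elements. It is also at least \<open>2\<close>, so that a single
    component always misses one of \<open>Suc 0\<close> and \<open>Suc 1\<close>.\<close>
  define m where "m = card E + 2"
  define TJ where "TJ = {(h, A, map \<psi> (position_list h A)) | h A \<psi>. A \<noteq> {} \<and> A \<subseteq> {..<h} \<and> (\<forall>i\<in>A. glue_edge E m h i \<psi>)}"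
  note D = labelled_orderD[OF order]
  have oJ: "labelled_order UNIV glue_less TJ"
  proof (rule labelled_order_generated[OF _ _ _ _ _ _ _ _ TJ_def])
    show "irrefl glue_less" "trans glue_less" "total glue_less"
      using lexicographic_linear_order[OF D(2-4) glue_less_def] by auto
    show "glue_edge E m h i \<psi>'" if "glue_edge E m h i \<psi>" "\<And>p. p \<in> positions h {i} \<Longrightarrow> \<psi>' p = \<psi> p" for h i \<psi> \<psi>'
      using that unfolding glue_edge_def by metis
    show "(\<psi> p, \<psi> q) \<in> glue_less"
      if e: "glue_edge E m h i \<psi>" and p: "p \<in> positions h {i}" "q \<in> positions h {i}" "p < q" for h i \<psi> p q
    proof -
      obtain c x where cx: "\<forall>p \<in> positions h {i}. length (x p) = 3 \<and> \<psi> p = glue E m c (x p)"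
        "\<forall>j<3. holds T h {i} (\<lambda>p. x p ! j)"
        using e unfolding glue_edge_def by blast
      have "(x p ! j, x q ! j) \<in> L" if "j < 3" for j
        using labelled_order_holdsD(4)[OF order cx(2)[rule_format, OF that] p] .
      then show ?thesis using glue_less_glue[of "x p" "x q"] cx(1) p by simp
    qed
    show "\<exists>i<h. \<not> glue_edge E m h i \<psi>" if "h > 0" for h \<psi>
      using no_full_glue_edge[OF E _ that] by (simp add: m_def)
  qed auto
  obtain \<phi> where \<phi>: "\<And>x y. (\<phi> x, \<phi> y) \<in> L \<longleftrightarrow> (x, y) \<in> glue_less"
    "\<And>h A ys. (h, A, map \<phi> ys) \<in> T \<longleftrightarrow> (h, A, ys) \<in> TJ"
    using embedding[OF oJ] by (metis UNIV_I UNIV_not_empty countableI_type subset_UNIV)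
  define f where "f c = restrict (\<lambda>x. \<phi> (glue E m c x)) (nlists 3 UNIV)" for c
  have f: "f c [a, b, d] = \<phi> (glue E m c [a, b, d])" for a b c d by (simp add: f_def in_nlists_iff)
  have "f c \<in> ops (Pol generic_structure) 3" for c
    unfolding f_def
  proof (rule PolI)
    show "(\<phi> (glue E m c x), \<phi> (glue E m c y)) \<in> L"
      if "length x = 3" "length y = 3" "\<And>j. j < 3 \<Longrightarrow> (x ! j, y ! j) \<in> L" for x y
      using glue_less_glue[OF that] \<phi>(1) by blast
  next
    fix h i X assume X: "\<And>p. p \<in> positions h {i} \<Longrightarrow> length (X p) = 3" "\<And>j. j < 3 \<Longrightarrow> holds T h {i} (\<lambda>p. X p ! j)"
    have i: "{i} \<subseteq> {..<h}" using labelled_order_holdsD(2)[OF order X(2)[of 0]] by auto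
    have "glue_edge E m h i (\<lambda>p. glue E m c (X p))" using X unfolding glue_edge_def by blast
    then have "(h, {i}, map (\<lambda>p. glue E m c (X p)) (position_list h {i})) \<in> TJ"
      using i unfolding TJ_def by blast
    then have "(h, {i}, map \<phi> (map (\<lambda>p. glue E m c (X p)) (position_list h {i}))) \<in> T" using \<phi>(2) by blast
    then show "holds T h {i} (\<lambda>p. \<phi> (glue E m c (X p)))" by (simp add: holds_def comp_def)
  qed
  moreover have "f 0 [a, b, b] = f 0 [b, a, b] \<and> f 0 [a, b, b] = f 1 [a, a, b] \<and>
       (\<forall>c. 0 < c \<longrightarrow> c \<le> m \<longrightarrow> f c [a, b, b] = f (Suc c) [a, a, b]) \<and>
       f (Suc m) [a, a, b] = f (Suc m) [a, b, a]" if "a \<in> E" "b \<in> E" for a b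
    unfolding f by (intro conjI allI impI arg_cong[of _ _ \<phi>] glue_identities that) (auto simp: m_def)
  ultimately show ?thesis by blast
qed

lemma no_uniformly_continuous_minion_hom:
  assumes \<xi>: "minion_hom (Pol generic_structure) projection_clone \<xi>"
    and uc: "uniformly_continuous_clone_map (Pol generic_structure) \<xi>"
  shows False
proof -
  have car: "carrier (Pol generic_structure) = UNIV" "carrier projection_clone = {0, 1}"
    by (simp_all add: Pol_def projection_clone_def)
  obtain F where F: "finite F" "F \<subseteq> nlists 2 UNIV"
    "\<And>f g. f \<in> ops (Pol generic_structure) 2 \<Longrightarrow> g \<in> ops (Pol generic_structure) 2 \<Longrightarrow>
      (\<And>x. x \<in> F \<Longrightarrow> f x = g x) \<Longrightarrow> \<xi> 2 f = \<xi> 2 g"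
    using uc unfolding uniformly_continuous_clone_map_def car by (metis one_le_numeral)
  \<comment> \<open>Identities on \<open>E\<close> make the binary minors agree on all of
    \<open>F\<close>, and uniform continuity turns this into equality of their images.\<close>
  define E where "E = \<Union> (set ` F)"
  have E: "finite E" using F(1) by (auto simp: E_def)
  obtain m f where f: "\<forall>c. f c \<in> ops (Pol generic_structure) 3"
    and ids: "\<forall>a\<in>E. \<forall>b\<in>E. f 0 [a, b, b] = f 0 [b, a, b] \<and> f 0 [a, b, b] = f 1 [a, a, b] \<and>
       (\<forall>c. 0 < c \<longrightarrow> c \<le> m \<longrightarrow> f c [a, b, b] = f (Suc c) [a, a, b]) \<and>
       f (Suc m) [a, a, b] = f (Suc m) [a, b, a]"
    using locally_glued_polymorphisms[OF E] by (elim exE conjE)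
  note f = f[rule_format]
  have id1: "f 0 [a, b, b] = f 0 [b, a, b]" and id2: "f 0 [a, b, b] = f 1 [a, a, b]"
    and id3: "0 < c \<Longrightarrow> c \<le> m \<Longrightarrow> f c [a, b, b] = f (Suc c) [a, a, b]"
    and id4: "f (Suc m) [a, a, b] = f (Suc m) [a, b, a]" if "a \<in> E" "b \<in> E" for a b c
    using ids that by blast+
  have "\<xi> 3 (f c) \<in> ops projection_clone 3" for c
    using \<xi>[unfolded minion_hom_def, THEN conjunct1, rule_format, of 3 "f c"] f by simp
  then have "\<forall>c. \<exists>j<3. \<xi> 3 (f c) = (\<lambda>x \<in> nlists 3 {0, 1}. x ! j)"
    by (auto simp: projection_clone_def)
  then obtain j where j: "\<And>c. j c < 3" "\<And>c. \<xi> 3 (f c) = (\<lambda>x \<in> nlists 3 {0, 1}. x ! j c)" by metis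
  \<comment> \<open>At \<open>[0, 1]\<close> a binary minor of a projection returns the number of
    the variable put into the chosen coordinate, which gives information about
    \<open>j c\<close>.\<close>
  have \<xi>2: "\<xi> 2 (minor UNIV 3 2 ((!) \<pi>) (f c)) [0, 1] = \<pi> ! j c"
    if \<pi>: "length \<pi> = 3" "set \<pi> \<subseteq> {0, 1}" for \<pi> c
  proof -
    have \<pi>': "\<pi> ! i \<in> {0, 1}" if "i < 3" for i using subsetD[OF \<pi>(2) nth_mem[of i \<pi>]] \<pi>(1) that by simp
    have "\<pi> ! i < 2" if "i < 3" for i using \<pi>'[OF that] by auto
    then have "(!) \<pi> \<in> {..<3} \<rightarrow> {..<2}" by auto
    then have "\<xi> 2 (minor UNIV 3 2 ((!) \<pi>) (f c)) = minor {0, 1} 3 2 ((!) \<pi>) (\<xi> 3 (f c))"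
      using \<xi>[unfolded minion_hom_def car, THEN conjunct2, rule_format, of 3 2 "f c" "(!) \<pi>"] f[of c] by simp
    moreover have "[0, 1] ! (\<pi> ! i) = \<pi> ! i" if "i < 3" for i using \<pi>'[OF that] by auto
    moreover have "map (\<lambda>i. [0, 1] ! (\<pi> ! i)) [0..<3] \<in> nlists 3 {0, 1 :: nat}"
      using \<pi>' by (force simp: in_nlists_iff)
    moreover have "[0, 1] \<in> nlists 2 {0, 1 :: nat}" by (simp add: in_nlists_iff)
    ultimately show ?thesis using j(1)[of c] by (simp add: minor_def j(2))
  qed
  have eq: "\<pi> ! j c = \<pi>' ! j c'"
    if \<pi>: "length \<pi> = 3" "set \<pi> \<subseteq> {0, 1}" "length \<pi>' = 3" "set \<pi>' \<subseteq> {0, 1}"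
      and f': "\<And>a b. a \<in> E \<Longrightarrow> b \<in> E \<Longrightarrow> f c (map ((!) [a, b]) \<pi>) = f c' (map ((!) [a, b]) \<pi>')" for \<pi> \<pi>' c c'
  proof -
    have m: "minor UNIV 3 2 ((!) \<rho>) g [a, b] = g (map ((!) [a, b]) \<rho>)" if "length \<rho> = 3" for \<rho> :: "nat list" and g a and b :: nat
    proof -
      have "map (\<lambda>i. [a, b] ! (\<rho> ! i)) [0..<3] = map ((!) [a, b]) \<rho>"
        using that by (intro nth_equalityI) auto
      then show ?thesis by (simp add: minor_def in_nlists_iff)
    qed
    have ops: "minor UNIV 3 2 ((!) \<rho>) (f c) \<in> ops (Pol generic_structure) 2" if "length \<rho> = 3" "set \<rho> \<subseteq> {0, 1}" for \<rho> c
    proof -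
      have "(!) \<rho> \<in> {..<3} \<rightarrow> {..<2}"
      proof
        fix i :: nat assume "i \<in> {..<3}"
        then have "\<rho> ! i \<in> {0, 1}" using subsetD[OF that(2) nth_mem[of i \<rho>]] that(1) by simp
        then show "\<rho> ! i \<in> {..<2}" by auto
      qed
      then show ?thesis using Pol_minor[OF f[of c], of "(!) \<rho>" 2] by simp
    qed
    have "\<xi> 2 (minor UNIV 3 2 ((!) \<pi>) (f c)) = \<xi> 2 (minor UNIV 3 2 ((!) \<pi>') (f c'))"
    proof (rule F(3)[OF ops[OF \<pi>(1,2)] ops[OF \<pi>(3,4)]])
      fix x assume x: "x \<in> F"
      then have "length x = 2" using F(2) by (auto simp: in_nlists_iff)
      then obtain a b where ab: "x = [a, b]" by (auto simp: length_Suc_conv numeral_2_eq_2)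
      then have "a \<in> E" "b \<in> E" using x by (force simp: E_def)+
      then show "minor UNIV 3 2 ((!) \<pi>) (f c) x = minor UNIV 3 2 ((!) \<pi>') (f c') x"
        unfolding ab m[OF \<pi>(1)] m[OF \<pi>(3)] by (rule f')
    qed
    then show ?thesis using \<xi>2[OF \<pi>(1,2)] \<xi>2[OF \<pi>(3,4)] by metis
  qed
  \<comment> \<open>The first identity forces the last coordinate, number \<open>2\<close>, for
    \<open>f 0\<close>. The chain carries it to \<open>f (Suc m)\<close>, where the final identity
    excludes it.\<close>
  have lt3: "j c = 0 \<or> j c = 1 \<or> j c = 2" for c using j(1)[of c] by linarith
  have "[0, 1, 1] ! j 0 = [1, 0, 1 :: nat] ! j 0" using id1 by (intro eq) auto
  then have "j 0 = 2" using lt3[of 0] by auto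
  moreover have "[0, 1, 1] ! j 0 = [0, 0, 1 :: nat] ! j 1" using id2 by (intro eq) auto
  ultimately have j1: "j 1 = 2" using lt3[of 1] by auto
  have "j (Suc c) = 2" if "c \<le> m" for c
    using that
  proof (induction c)
    case (Suc c)
    have "[0, 1, 1] ! j (Suc c) = [0, 0, 1 :: nat] ! j (Suc (Suc c))" using id3[of _ _ "Suc c"] Suc by (intro eq) auto
    then show ?case using Suc lt3[of "Suc (Suc c)"] by auto
  qed (use j1 in simp)
  then have "j (Suc m) = 2" by simp
  moreover have "[0, 0, 1] ! j (Suc m) = [0, 1, 0 :: nat] ! j (Suc m)" using id4 by (intro eq) auto
  ultimately show False by simp
qed

end

section \<open>Existence of a minion homomorphism\<close>

text \<open>Tychonoff's theorem for finite discrete spaces: each constraint involves two coordinates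
  and so defines a closed set, and finite satisfiability is the finite intersection
  property.\<close>

lemma finite_choice_compactness:
  fixes D :: "'i \<Rightarrow> 'c set" and C :: "'i \<Rightarrow> 'i \<Rightarrow> 'c \<Rightarrow> 'c \<Rightarrow> bool"
  assumes fin: "\<And>i. i \<in> I \<Longrightarrow> finite (D i)"
    and sat: "\<And>K. finite K \<Longrightarrow> K \<subseteq> I \<Longrightarrow>
      \<exists>\<kappa>. (\<forall>i\<in>K. \<kappa> i \<in> D i) \<and> (\<forall>i\<in>K. \<forall>j\<in>K. C i j (\<kappa> i) (\<kappa> j))"
  shows "\<exists>\<kappa>. (\<forall>i\<in>I. \<kappa> i \<in> D i) \<and> (\<forall>i\<in>I. \<forall>j\<in>I. C i j (\<kappa> i) (\<kappa> j))"
proof (cases "I = {}")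
  case False
  define X where "X = product_topology (\<lambda>i. discrete_topology (D i)) I"
  define V where "V i j = {\<kappa> \<in> Pi\<^sub>E I D. C i j (\<kappa> i) (\<kappa> j)}" for i j
  have top: "topspace X = Pi\<^sub>E I D" by (simp add: X_def)
  have ne: "D i \<noteq> {}" if "i \<in> I" for i using sat[of "{i}"] that by auto
  have comp: "compact_space X"
    unfolding X_def compact_space_product_topology using fin by (simp add: compact_space_discrete_topology)
  have cyl: "closedin X {\<kappa> \<in> topspace X. \<kappa> i \<in> {a}}" if "i \<in> I" "a \<in> D i" for i a
  proof (rule closedin_continuous_map_preimage)
    show "continuous_map X (discrete_topology (D i)) (\<lambda>\<kappa>. \<kappa> i)"
      unfolding X_def by (rule continuous_map_product_projection[OF that(1)])
    show "closedin (discrete_topology (D i)) {a}" using that by simp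
  qed
  have closed: "closedin X (V i j)" if ij: "i \<in> I" "j \<in> I" for i j
  proof -
    let ?P = "{(a, b) \<in> D i \<times> D j. C i j a b}"
    let ?W = "\<lambda>(a, b). {\<kappa> \<in> topspace X. \<kappa> i \<in> {a}} \<inter> {\<kappa> \<in> topspace X. \<kappa> j \<in> {b}}"
    have "V i j = \<Union> (?W ` ?P)" using ij unfolding V_def top by (auto simp: PiE_mem)
    moreover have "finite ?P" using fin ij by (auto intro: finite_subset[of _ "D i \<times> D j"])
    moreover have "closedin X W" if "W \<in> ?W ` ?P" for W
      using that cyl ij by (auto intro!: closedin_Int)
    ultimately show ?thesis by (simp add: closedin_Union)
  qed
  let ?U = "{V i j | i j. i \<in> I \<and> j \<in> I}"
  have "\<Inter> \<F> \<noteq> {}" if F: "finite \<F>" "\<F> \<subseteq> ?U" for \<F>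
  proof -
    have "\<forall>W\<in>\<F>. \<exists>p. p \<in> I \<times> I \<and> W = V (fst p) (snd p)" using F(2) by force
    then obtain p where p: "\<And>W. W \<in> \<F> \<Longrightarrow> p W \<in> I \<times> I \<and> W = V (fst (p W)) (snd (p W))" by metis
    define K where "K = fst ` p ` \<F> \<union> snd ` p ` \<F>"
    have "finite K" "K \<subseteq> I" using F(1) p by (auto simp: K_def mem_Times_iff)
    then obtain \<kappa> where \<kappa>: "\<And>i. i \<in> K \<Longrightarrow> \<kappa> i \<in> D i" "\<And>i j. i \<in> K \<Longrightarrow> j \<in> K \<Longrightarrow> C i j (\<kappa> i) (\<kappa> j)"
      using sat[of K] by blast
    define \<kappa>' where "\<kappa>' = (\<lambda>i\<in>I. if i \<in> K then \<kappa> i else (SOME a. a \<in> D i))"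
    have "\<kappa>' \<in> Pi\<^sub>E I D" using \<kappa>(1) ne by (auto simp: \<kappa>'_def some_in_eq)
    moreover have "\<kappa>' i = \<kappa> i" if "i \<in> K" for i using that \<open>K \<subseteq> I\<close> by (auto simp: \<kappa>'_def)
    ultimately have V: "\<kappa>' \<in> V i j" if "i \<in> K" "j \<in> K" for i j using that \<kappa>(2) by (simp add: V_def)
    have "\<kappa>' \<in> W" if W: "W \<in> \<F>" for W
    proof -
      have "fst (p W) \<in> K" "snd (p W) \<in> K" using W by (auto simp: K_def)
      then show ?thesis using V p[OF W] by blast
    qed
    then show ?thesis by blast
  qed
  then have "\<Inter> ?U \<noteq> {}"
    using compact_space_fip[THEN iffD1, OF comp, rule_format, of ?U] closed by blast
  then obtain \<kappa> where \<kappa>: "\<And>i j. i \<in> I \<Longrightarrow> j \<in> I \<Longrightarrow> \<kappa> \<in> V i j" by blast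
  then show ?thesis using False by (intro exI[of _ \<kappa>]) (fastforce simp: V_def)
qed simp

section \<open>Binary minors and compatible choices of coordinates\<close>

definition unary_minor :: "nat \<times> (nat list \<Rightarrow> nat) \<Rightarrow> nat list \<Rightarrow> nat" where
  "unary_minor q = minor UNIV (fst q) 1 (\<lambda>_. 0) (snd q)"

definition binary_minor :: "nat \<times> (nat list \<Rightarrow> nat) \<Rightarrow> nat set \<Rightarrow> nat list \<Rightarrow> nat" where
  "binary_minor q A = minor UNIV (fst q) 2 (\<lambda>l. if l \<in> A then 1 else 0) (snd q)"

text \<open>The pairs \<open>q\<close> and \<open>r\<close> consist of an arity and an operation;
  \<open>i\<close> and \<open>j\<close> are the coordinates chosen for them. Binary minors give
  constraints enough, since a coordinate is determined by the sets that contain it.\<close>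

definition compatible_choices :: "nat \<times> (nat list \<Rightarrow> nat) \<Rightarrow> nat \<times> (nat list \<Rightarrow> nat) \<Rightarrow> nat \<Rightarrow> nat \<Rightarrow> bool" where
  "compatible_choices q r i j \<longleftrightarrow>
     (\<forall>A B. A \<subseteq> {..<fst q} \<longrightarrow> B \<subseteq> {..<fst r} \<longrightarrow> binary_minor q A = binary_minor r B \<longrightarrow> (i \<in> A \<longleftrightarrow> j \<in> B))"

lemma unary_minor_apply: "snd q (map (\<lambda>l. a) [0..<fst q]) = unary_minor q [a]"
  by (simp add: unary_minor_def minor_def in_nlists_iff)

lemma binary_minor_apply: "snd q (map (\<lambda>l. if l \<in> A then b else a) [0..<fst q]) = binary_minor q A [a, b]"
proof -
  have e: "map (\<lambda>l. if l \<in> A then b else a) [0..<fst q] = map (\<lambda>l. [a, b] ! (if l \<in> A then 1 else 0)) [0..<fst q]"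
    by auto
  show ?thesis unfolding e by (simp add: binary_minor_def minor_def in_nlists_iff)
qed

text \<open>Consequently operations with different unary minors do not constrain each other, and
  each unary minor can be treated separately.\<close>

lemma unary_minor_eq_if_binary_minor_eq:
  assumes "binary_minor q A = binary_minor r B"
  shows "unary_minor q = unary_minor r"
proof -
  have u: "unary_minor s [a] = binary_minor s C [a, a]" for s C and a :: nat
    unfolding binary_minor_apply[symmetric] unary_minor_apply[symmetric] by (simp only: if_cancel)
  show ?thesis
  proof
    fix x
    show "unary_minor q x = unary_minor r x"
    proof (cases "length x = 1")
      case True
      then obtain a where "x = [a]" by (auto simp: length_Suc_conv)
      then show ?thesis using u[of q a A] u[of r a B] assms by simp
    next
      case False
      then show ?thesis by (simp add: unary_minor_def minor_def in_nlists_iff)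
    qed
  qed
qed

lemma binary_minor_empty:
  assumes "unary_minor q = unary_minor r"
  shows "binary_minor q {} = binary_minor r {}"
proof
  fix x
  show "binary_minor q {} x = binary_minor r {} x"
  proof (cases "length x = 2")
    case True
    then obtain a b where "x = [a, b]" by (auto simp: length_Suc_conv numeral_2_eq_2)
    then show ?thesis
      using binary_minor_apply[of q "{}" b a] binary_minor_apply[of r "{}" b a]
        unary_minor_apply[of q a] unary_minor_apply[of r a] assms by simp
  next
    case False
    then show ?thesis by (simp add: binary_minor_def minor_def in_nlists_iff)
  qed
qed

text \<open>\<open>i\<close>, \<open>j\<close> and \<open>t\<close> are the digits of
  \<open>v\<close> in base \<open>h\<close>; \<open>t\<close> numbers the links from
  \<open>i\<close> to \<open>j\<close>.\<close>

lemma link_exhaust: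
  assumes "i < h" "j < h" "t < h"
  obtains v where "v < h ^ 3" "link_source h v = i" "link_target h v = j" "v mod h = t"
proof
  let ?v = "(i * h + j) * h + t"
  have "?v < (i * h + j) * h + h" using assms(3) by simp
  also have "\<dots> = (i * h + Suc j) * h" by simp
  also have "\<dots> \<le> (i * h + h) * h" using assms(2) by (intro mult_le_mono1 add_le_mono) auto
  also have "\<dots> = Suc i * h * h" by simp
  also have "\<dots> \<le> h * h * h" using assms(1) by (intro mult_le_mono1) auto
  finally show "?v < h ^ 3" by (simp only: power3_eq_cube)
  have d: "?v div h = i * h + j" using assms(3) by simp
  have "?v div h\<^sup>2 = ?v div h div h" by (simp only: power2_eq_square div_mult2_eq)
  also have "\<dots> = i" unfolding d using assms(2) by simp
  finally show "link_source h ?v = i" by (simp only: link_source_def)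
  show "link_target h ?v = j" unfolding link_target_def d using assms(2) by simp
  show "?v mod h = t" using assms(3) by simp
qed

context generic_order
begin

text \<open>The common unary minor is what makes all nodes send a given core element, at which all
  columns agree, to the same point.\<close>

lemma finite_choices_same_unary:
  fixes K :: "(nat \<times> (nat list \<Rightarrow> nat)) set"
  assumes K: "finite K" and pol: "\<And>q. q \<in> K \<Longrightarrow> snd q \<in> ops (Pol generic_structure) (fst q)"
    and u: "\<And>q. q \<in> K \<Longrightarrow> unary_minor q = u"
  shows "\<exists>\<kappa>. (\<forall>q\<in>K. \<kappa> q < fst q) \<and> (\<forall>q\<in>K. \<forall>r\<in>K. compatible_choices q r (\<kappa> q) (\<kappa> r))"
proof (rule ccontr)
  assume unsat: "\<not> ?thesis"
  then have K0: "K \<noteq> {}" by auto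
  define s where "s = card K"
  have s0: "s > 0" using K K0 by (simp add: s_def card_gt_0_iff)
  \<comment> \<open>Every polymorphism is used for at least two nodes, so that coincidences among minors of the same
    polymorphism also are links between distinct nodes.\<close>
  define node where "node i = from_nat_into K (i mod s)" for i
  have nodeK: "node i \<in> K" for i unfolding node_def using K0 by (rule from_nat_into)
  have node_surj: "\<exists>i<s. node i = q" if q: "q \<in> K" for q
  proof -
    have "from_nat_into K ` {..<s} = K"
      unfolding s_def using bij_betw_from_nat_into_finite[OF K] by (rule bij_betw_imp_surj_on)
    then have "q \<in> from_nat_into K ` {..<s}" using q by (simp only:)
    then obtain i where "i < s" "from_nat_into K i = q" by blast
    then show ?thesis by (auto simp: node_def intro!: exI[of _ i])
  qed
  have node_add: "node (i + s) = node i" for i by (simp add: node_def)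
  \<comment> \<open>\<open>Co q r\<close> is the set of constraints between \<open>q\<close> and
    \<open>r\<close>. The common unary minor makes the pair of empty sets one of them, so every link
    can be assigned a constraint.\<close>
  define Co where "Co q r = {(A, B). A \<subseteq> {..<fst q} \<and> B \<subseteq> {..<fst r} \<and> binary_minor q A = binary_minor r B}"
    for q r :: "nat \<times> (nat list \<Rightarrow> nat)"
  have finCo: "finite (Co q r)" for q r
    by (rule finite_subset[of _ "Pow {..<fst q} \<times> Pow {..<fst r}"]) (auto simp: Co_def)
  have neCo: "Co (node i) (node j) \<noteq> {}" for i j
  proof -
    have "({}, {}) \<in> Co (node i) (node j)"
      using binary_minor_empty[of "node i" "node j"] u nodeK by (simp add: Co_def)
    then show ?thesis by blast
  qed
  \<comment> \<open>\<open>h\<close> is large in two respects: every polymorphism gets at least two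
    nodes, and from any node to any other there are at least as many links as constraints.\<close>
  define h where "h = 2 * s + (\<Sum>(q, r)\<in>K \<times> K. card (Co q r))"
  have h: "2 * s \<le> h" "card (Co (node i) (node j)) \<le> h" for i j
  proof -
    show "2 * s \<le> h" by (simp add: h_def)
    have "card (Co (node i) (node j)) \<le> (\<Sum>(q, r)\<in>K \<times> K. card (Co q r))"
      using member_le_sum[of "(node i, node j)" "K \<times> K" "\<lambda>(q, r). card (Co q r)"] nodeK K by simp
    then show "card (Co (node i) (node j)) \<le> h" by (simp add: h_def)
  qed
  define co where "co v = from_nat_into (Co (node (link_source h v)) (node (link_target h v))) (v mod h)" for v
  have co: "co v \<in> Co (node (link_source h v)) (node (link_target h v))" for v
    unfolding co_def by (rule from_nat_into[OF neCo])
  have co_surj: "\<exists>v<h ^ 3. link_source h v = i \<and> link_target h v = j \<and> co v = (A, B)"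
    if AB: "(A, B) \<in> Co (node i) (node j)" and ij: "i < h" "j < h" for i j A B
  proof -
    have "from_nat_into (Co (node i) (node j)) ` {..<card (Co (node i) (node j))} = Co (node i) (node j)"
      using bij_betw_from_nat_into_finite[OF finCo] by (rule bij_betw_imp_surj_on)
    then obtain t where t: "t < card (Co (node i) (node j))" "from_nat_into (Co (node i) (node j)) t = (A, B)"
      using AB by (metis (no_types, lifting) imageE lessThan_iff)
    then have "t < h" using h(2)[of i j] by linarith
    then obtain v where "v < h ^ 3" "link_source h v = i" "link_target h v = j" "v mod h = t"
      using link_exhaust[OF ij] by metis
    then show ?thesis using t(2) by (auto simp: co_def)
  qed
  \<comment> \<open>The core element at position \<open>p\<close> is \<open>2p\<close>; the two copies of the link at position \<open>p\<close> are \<open>2p\<close> and \<open>2p + 1\<close>.\<close>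
  define row where "row k v = (if link_source h v = k then fst (co v) else snd (co v))" for k v
  define col where "col k l p = (if even p then 2 * p else 2 * p + of_bool (l \<in> row k (p div 2)))"
    for k l p :: nat
  \<comment> \<open>The tuples of node \<open>k\<close> are the columns \<open>col k l\<close>, one
    for each coordinate \<open>l\<close> of its polymorphism. A complete configuration thus chooses
    a coordinate for every node, and a link has the same copy at both ends exactly if its constraint
    is met.\<close>
  define Ed where "Ed h' k \<psi> \<longleftrightarrow> h' = h \<and> k < h \<and> (\<exists>l < fst (node k). \<forall>p \<in> positions h {k}. \<psi> p = col k l p)"
    for h' k and \<psi> :: "nat \<Rightarrow> nat"
  define TG where "TG = {(h, A, map \<psi> (position_list h A)) | h A \<psi>. A \<noteq> {} \<and> A \<subseteq> {..<h} \<and> (\<forall>i\<in>A. Ed h i \<psi>)}"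
  have no_full: "\<exists>k<h. \<not> Ed h k \<psi>" for \<psi>
  proof (rule ccontr)
    assume "\<not> ?thesis"
    then have "\<forall>k. \<exists>l. k < h \<longrightarrow> l < fst (node k) \<and> (\<forall>p \<in> positions h {k}. \<psi> p = col k l p)"
      unfolding Ed_def by blast
    then obtain l where "\<forall>k. k < h \<longrightarrow> l k < fst (node k) \<and> (\<forall>p \<in> positions h {k}. \<psi> p = col k (l k) p)"
      by (rule choice[THEN exE])
    then have l: "\<And>k. k < h \<Longrightarrow> l k < fst (node k)"
      "\<And>k p. k < h \<Longrightarrow> p \<in> positions h {k} \<Longrightarrow> \<psi> p = col k (l k) p" by blast+
    have link: "l i \<in> A \<longleftrightarrow> l j \<in> B"
      if AB: "(A, B) \<in> Co (node i) (node j)" and ij: "i < h" "j < h" "i \<noteq> j" for i j A B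
    proof -
      obtain v where v: "v < h ^ 3" "link_source h v = i" "link_target h v = j" "co v = (A, B)"
        using co_surj[OF AB ij(1,2)] by blast
      then have "v \<in> boundary h {i}" "v \<in> boundary h {j}" using ij(3) by (auto simp: boundary_def)
      then have "col i (l i) (2 * v + 1) = col j (l j) (2 * v + 1)"
        using l(2)[OF ij(1) link_in_positions] l(2)[OF ij(2) link_in_positions] by metis
      then show ?thesis using v ij(3) by (simp add: col_def row_def of_bool_def split: if_splits)
    qed
    \<comment> \<open>The two nodes of one polymorphism are linked by the trivial coincidences of a
      minor with itself, which force the same choice at both.\<close>
    have copy: "l (i + s) = l i" if "i < s" for i
    proof -
      have "l i < fst (node i)" using l(1)[of i] h(1) that by linarith
      then have "({l i}, {l i}) \<in> Co (node i) (node (i + s))" by (simp add: Co_def node_add)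
      then show ?thesis using link[of "{l i}" "{l i}" i "i + s"] h(1) that s0 by auto
    qed
    define idx where "idx q = (SOME i. i < s \<and> node i = q)" for q
    have idx: "idx q < s" "node (idx q) = q" if "q \<in> K" for q
      using someI_ex[of "\<lambda>i. i < s \<and> node i = q"] node_surj[OF that] unfolding idx_def by auto
    have "l (idx q) < fst q" if "q \<in> K" for q
      using l(1)[of "idx q"] idx[OF that] h(1) by simp
    moreover have "compatible_choices q r (l (idx q)) (l (idx r))" if qr: "q \<in> K" "r \<in> K" for q r
      unfolding compatible_choices_def
    proof (intro allI impI)
      fix A B assume "A \<subseteq> {..<fst q}" "B \<subseteq> {..<fst r}" "binary_minor q A = binary_minor r B"
      then have "(A, B) \<in> Co (node (idx q)) (node (idx r + s))"
        using idx[OF qr(1)] idx[OF qr(2)] by (simp add: Co_def node_add)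
      then have "l (idx q) \<in> A \<longleftrightarrow> l (idx r + s) \<in> B"
        using idx(1)[OF qr(1)] idx(1)[OF qr(2)] h(1) by (intro link) auto
      then show "l (idx q) \<in> A \<longleftrightarrow> l (idx r) \<in> B" using copy[OF idx(1)[OF qr(2)]] by simp
    qed
    ultimately have "\<exists>\<kappa>. (\<forall>q\<in>K. \<kappa> q < fst q) \<and> (\<forall>q\<in>K. \<forall>r\<in>K. compatible_choices q r (\<kappa> q) (\<kappa> r))"
      by (intro exI[of _ "\<lambda>q. l (idx q)"]) blast
    with unsat show False ..
  qed
  have oG: "labelled_order UNIV {(x, y :: nat). x < y} TG"
  proof (rule labelled_order_generated[OF _ _ _ _ _ _ _ _ TG_def])
    show "irrefl {(x, y :: nat). x < y}" by (simp add: irrefl_def)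
    show "trans {(x, y :: nat). x < y}" by (auto simp: trans_def)
    show "total {(x, y :: nat). x < y}" by (auto simp: total_on_def)
    show "Ed h' i \<psi>'" if "Ed h' i \<psi>" "\<And>p. p \<in> positions h' {i} \<Longrightarrow> \<psi>' p = \<psi> p" for h' i \<psi> \<psi>'
      using that unfolding Ed_def by auto
    show "(\<psi> p, \<psi> q) \<in> {(x, y). x < y}"
      if "Ed h' i \<psi>" "p \<in> positions h' {i}" "q \<in> positions h' {i}" "p < q" for h' i \<psi> p q
      using that by (auto simp: Ed_def col_def of_bool_def)
    show "\<exists>i<h'. \<not> Ed h' i \<psi>" if "h' > 0" for h' \<psi>
      using no_full[of \<psi>] that by (cases "h' = h") (auto simp: Ed_def)
  qed auto
  obtain \<phi> where \<phi>: "\<And>g A ys. (g, A, map \<phi> ys) \<in> T \<longleftrightarrow> (g, A, ys) \<in> TG"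
    using embedding[OF oG] by (metis UNIV_not_empty countableI_type subset_UNIV)
  \<comment> \<open>The polymorphism at each node is applied to its columns, position by position.
    At a link it yields a binary minor evaluated at the two copies; that of the source is taken, and
    the coincidence \<open>co\<close> equates it with that of the target.\<close>
  define \<Psi> where "\<Psi> p = (if even p then u [\<phi> (2 * p)] else
      binary_minor (node (link_source h (p div 2))) (fst (co (p div 2))) [\<phi> (2 * p), \<phi> (2 * p + 1)])" for p
  have "holds T h {k} \<Psi>" if k: "k < h" for k
  proof -
    define X where "X p = map (\<lambda>l. \<phi> (col k l p)) [0..<fst (node k)]" for p
    have "holds T h {k} (\<lambda>p. snd (node k) (X p))"
    proof (rule Pol_holds[OF pol[OF nodeK]])
      show "length (X p) = fst (node k)" for p by (simp add: X_def)
      show "holds T h {k} (\<lambda>p. X p ! l)" if l: "l < fst (node k)" for l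
      proof -
        have "Ed h k (col k l)" using k l unfolding Ed_def by blast
        then have "(h, {k}, map (col k l) (position_list h {k})) \<in> TG" using k unfolding TG_def by blast
        then have "(h, {k}, map \<phi> (map (col k l) (position_list h {k}))) \<in> T" using \<phi> by blast
        then show ?thesis using l by (simp add: holds_def X_def comp_def)
      qed
    qed
    moreover have "snd (node k) (X p) = \<Psi> p" if p: "p \<in> positions h {k}" for p
    proof (cases "even p")
      case True
      then have "X p = map (\<lambda>l. \<phi> (2 * p)) [0..<fst (node k)]" by (simp add: X_def col_def)
      then show ?thesis using unary_minor_apply[of "node k"] u[OF nodeK] True by (simp add: \<Psi>_def)
    next
      case False
      then obtain v where v: "p = 2 * v + 1" "v \<in> boundary h {k}" using p by (auto simp: positions_def)
      have "X p = map (\<lambda>l. if l \<in> row k v then \<phi> (2 * p + 1) else \<phi> (2 * p)) [0..<fst (node k)]"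
        by (auto simp: X_def col_def v(1))
      then have 1: "snd (node k) (X p) = binary_minor (node k) (row k v) [\<phi> (2 * p), \<phi> (2 * p + 1)]"
        by (simp only: binary_minor_apply)
      have 2: "\<Psi> p = binary_minor (node (link_source h v)) (fst (co v)) [\<phi> (2 * p), \<phi> (2 * p + 1)]"
        by (simp add: \<Psi>_def v(1))
      show ?thesis
      proof (cases "link_source h v = k")
        case True
        then show ?thesis unfolding 1 2 by (simp add: row_def)
      next
        case False
        then have "link_target h v = k" using v(2) by (auto simp: boundary_def)
        then have "binary_minor (node (link_source h v)) (fst (co v)) = binary_minor (node k) (snd (co v))"
          using co[of v] by (auto simp: Co_def)
        then show ?thesis unfolding 1 2 using False by (simp add: row_def)
      qed
    qed
    ultimately show ?thesis using holds_cong[of h "{k}" "\<lambda>p. snd (node k) (X p)" \<Psi> T] by simp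
  qed
  moreover have "h > 0" using h(1) s0 by linarith
  ultimately have "holds T h {..<h} \<Psi>"
    by (auto intro!: labelled_order_finite_union[OF order, of "{..<h}"])
  then show False using labelled_order_holdsD(2)[OF order] by blast
qed

lemma finite_choices:
  fixes K :: "(nat \<times> (nat list \<Rightarrow> nat)) set"
  assumes K: "finite K" and pol: "\<And>q. q \<in> K \<Longrightarrow> snd q \<in> ops (Pol generic_structure) (fst q)"
  shows "\<exists>\<kappa>. (\<forall>q\<in>K. \<kappa> q < fst q) \<and> (\<forall>q\<in>K. \<forall>r\<in>K. compatible_choices q r (\<kappa> q) (\<kappa> r))"
proof -
  have "\<forall>u. \<exists>\<kappa>. (\<forall>q\<in>{q \<in> K. unary_minor q = u}. \<kappa> q < fst q) \<and>
      (\<forall>q\<in>{q \<in> K. unary_minor q = u}. \<forall>r\<in>{q \<in> K. unary_minor q = u}. compatible_choices q r (\<kappa> q) (\<kappa> r))"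
    using K pol by (intro allI finite_choices_same_unary) auto
  then obtain \<kappa> where \<kappa>: "\<forall>u. (\<forall>q\<in>{q \<in> K. unary_minor q = u}. \<kappa> u q < fst q) \<and>
      (\<forall>q\<in>{q \<in> K. unary_minor q = u}. \<forall>r\<in>{q \<in> K. unary_minor q = u}. compatible_choices q r (\<kappa> u q) (\<kappa> u r))"
    by (rule choice[THEN exE])
  have "compatible_choices q r (\<kappa> (unary_minor q) q) (\<kappa> (unary_minor r) r)" if "q \<in> K" "r \<in> K" for q r
  proof (cases "unary_minor q = unary_minor r")
    case True
    then show ?thesis using \<kappa>[rule_format, of "unary_minor r", THEN conjunct2, rule_format, of q r] that by simp
  next
    case False
    then show ?thesis using unary_minor_eq_if_binary_minor_eq unfolding compatible_choices_def by blast
  qed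
  then show ?thesis using \<kappa> by (intro exI[of _ "\<lambda>q. \<kappa> (unary_minor q) q"]) auto
qed

lemma ex_minion_hom: "\<exists>\<xi>. minion_hom (Pol generic_structure) projection_clone \<xi>"
proof -
  define I where "I = {q. 1 \<le> fst q \<and> snd q \<in> ops (Pol generic_structure) (fst q)}"
  have "\<exists>\<kappa>. (\<forall>q\<in>I. \<kappa> q \<in> {..<fst q}) \<and> (\<forall>q\<in>I. \<forall>r\<in>I. compatible_choices q r (\<kappa> q) (\<kappa> r))"
  proof (rule finite_choice_compactness)
    fix K assume "finite K" "K \<subseteq> I"
    then show "\<exists>\<kappa>. (\<forall>q\<in>K. \<kappa> q \<in> {..<fst q}) \<and> (\<forall>q\<in>K. \<forall>r\<in>K. compatible_choices q r (\<kappa> q) (\<kappa> r))"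
      using finite_choices[of K] by (auto simp: I_def)
  qed simp
  then obtain \<kappa> where \<kappa>: "\<And>q. q \<in> I \<Longrightarrow> \<kappa> q < fst q"
    "\<And>q r. q \<in> I \<Longrightarrow> r \<in> I \<Longrightarrow> compatible_choices q r (\<kappa> q) (\<kappa> r)" by auto
  define \<xi> where "\<xi> n f = (\<lambda>x \<in> nlists n {0, 1 :: nat}. x ! \<kappa> (n, f))" for n f
  have car: "carrier (Pol generic_structure) = UNIV" "carrier projection_clone = {0, 1}"
    by (simp_all add: Pol_def projection_clone_def)
  have "minion_hom (Pol generic_structure) projection_clone \<xi>"
    unfolding minion_hom_def car
  proof (intro conjI allI impI ballI)
    fix n f assume "1 \<le> n" "f \<in> ops (Pol generic_structure) n"
    then have "\<kappa> (n, f) < n" using \<kappa>(1)[of "(n, f)"] by (simp add: I_def)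
    then show "\<xi> n f \<in> ops projection_clone n" by (auto simp: \<xi>_def projection_clone_def)
  next
    fix n k :: nat and f \<pi>
    assume n: "1 \<le> n" and k: "1 \<le> k" and f: "f \<in> ops (Pol generic_structure) n" and \<pi>: "\<pi> \<in> {..<n} \<rightarrow> {..<k}"
    define g where "g = minor UNIV n k \<pi> f"
    have g: "g \<in> ops (Pol generic_structure) k"
      using Pol_minor[OF f \<pi>] by (simp add: g_def)
    have I: "(n, f) \<in> I" "(k, g) \<in> I" using n k f g by (auto simp: I_def)
    let ?i = "\<kappa> (n, f)"
    have i: "?i < n" using \<kappa>(1)[OF I(1)] by simp
    have \<pi>k: "\<pi> l < k" if "l < n" for l using \<pi> that by auto
    \<comment> \<open>\<open>?A\<close> consists of the coordinates that \<pi> identifies with the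
      chosen one. Its binary minor of \<open>f\<close> is the binary minor of \<open>g\<close> at
      \<open>{\<pi> ?i}\<close>, so compatibility forces the choice for \<open>g\<close> to be
      \<open>\<pi> ?i\<close>.\<close>
    let ?A = "{l. l < n \<and> \<pi> l = \<pi> ?i}"
    have "binary_minor (n, f) ?A = binary_minor (k, g) {\<pi> ?i}"
    proof
      fix x
      show "binary_minor (n, f) ?A x = binary_minor (k, g) {\<pi> ?i} x"
      proof (cases "length x = 2")
        case True
        let ?y = "map (\<lambda>m. x ! (if m \<in> {\<pi> ?i} then 1 else 0)) [0..<k]"
        have e: "map (\<lambda>l. ?y ! \<pi> l) [0..<n] = map (\<lambda>l. x ! (if l \<in> ?A then 1 else 0)) [0..<n]"
          using \<pi>k by auto
        have "binary_minor (k, g) {\<pi> ?i} x = g ?y"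
          using True by (simp add: binary_minor_def minor_def in_nlists_iff)
        also have "\<dots> = f (map (\<lambda>l. ?y ! \<pi> l) [0..<n])" by (simp add: g_def minor_def in_nlists_iff)
        also have "\<dots> = binary_minor (n, f) ?A x"
          unfolding e using True by (simp add: binary_minor_def minor_def in_nlists_iff)
        finally show ?thesis ..
      qed (simp add: binary_minor_def minor_def in_nlists_iff)
    qed
    then have "?i \<in> ?A \<longleftrightarrow> \<kappa> (k, g) \<in> {\<pi> ?i}"
      using \<kappa>(2)[OF I, unfolded compatible_choices_def, rule_format, of ?A "{\<pi> ?i}"] \<pi>k[OF i] by auto
    then have \<kappa>g: "\<kappa> (k, g) = \<pi> ?i" using i by simp
    show "\<xi> k (minor UNIV n k \<pi> f) = minor {0, 1} n k \<pi> (\<xi> n f)"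
      unfolding g_def[symmetric]
    proof
      fix x
      show "\<xi> k g x = minor {0, 1} n k \<pi> (\<xi> n f) x"
      proof (cases "x \<in> nlists k {0, 1}")
        case True
        then have "x ! \<pi> l \<in> {0, 1}" if "l < n" for l
          using \<pi>k[OF that] nth_mem[of "\<pi> l" x] unfolding in_nlists_iff by metis
        then have "map (\<lambda>l. x ! \<pi> l) [0..<n] \<in> nlists n {0, 1}" by (simp add: in_nlists_iff)
        then show ?thesis using True i \<kappa>g by (simp add: \<xi>_def minor_def)
      qed (simp add: \<xi>_def minor_def)
    qed
  qed
  then show ?thesis by blast
qed

end

theorem theorem1p5:
  shows "\<exists>S :: (nat, nat) rel_structure.
           relational_structure S \<and>
           (omega_categorical S \<and> less_than_double_exponential_orbit_growth S) \<and>
           (\<exists>\<xi>. minion_hom (Pol S) projection_clone \<xi>) \<and>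
           \<not> (\<exists>\<xi>. minion_hom (Pol S) projection_clone \<xi> \<and>
                   uniformly_continuous_clone_map (Pol S) \<xi>)"
proof -
  obtain L :: "(nat \<times> nat) set" and T where "labelled_order UNIV L T" "extension_property L T"
    by (rule ex_generic_labelled_order)
  then interpret generic_order L T by unfold_locales
  show ?thesis
    using relational_structure_generic omega_categorical_generic orbit_growth_generic ex_minion_hom
      no_uniformly_continuous_minion_hom by blast
qed


end
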